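(* Assume the setting below, and suppose in addition that $\inf H>0$, that $d(T_tx,T_{t'}x)\le C|t-t'|^\eta$ for all $t,t'\ge0$, $x\in M$, and that $\mu_Y(H>n)=O(n^{-\beta})$ for some $\beta>1$. For $v\in C_0^\eta(M,\mathbb R^d)$ define $v_t=\int_0^tv\circ T_s\,ds$ and $S_t=\int_0^t\int_0^s(v\circ T_r)\otimes(v\circ T_s)\,dr\,ds$. (a) Let $2<p<\beta$. There is $C>0$ such that $|v_t|_{2(p-1)}\le Ct^{1/2}\|v\|_\eta$ for all $v\in C_0^\eta(M,\mathbb R^d)$, $t>0$. (b) Let $4<p<\beta$. There is $C>0$ such that $|S_t|_{2(p-1)/3}\le Ct\|v\|_\eta^2$ for all $v\in C_0^\eta(M,\mathbb R^d)$, $t>0$.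
   Context: Setting (nonuniformly expanding semiflow). Let $(M,d)$ be a bounded metric space, $Y\subset X\subset M$ Borel subsets and $T_t:M\to M$ a measurable semiflow. Let $h:X\to(0,\infty)$ be such that $f(x)=T_{h(x)}x$ defines $f:X\to X$, and $\tau:Y\to\mathbb Z^+$ such that $F(y)=f^{\tau(y)}y$ defines $F:Y\to Y$. Let $\mu_0$ be a finite Borel measure on $X$ with $\mu_0(Y)>0$, $f$ nonsingular and ergodic for $\mu_0$, $\tau\in L^1$. There is an at most countable measurable partition $\{Y_j\}$ of $Y$ with $\tau$ constant on each $Y_j$, and constants $\lambda>1$, $C\ge1$, $\eta\in(0,1]$ such that for all $j$: (1) $F$ restricts to a measure-theoretic bijection from $Y_j$ onto $Y$; (2) $d(Fy,Fy')\ge\lambda d(y,y')$ for $y,y'\in Y_j$; (3) $\zeta_0=\frac{d\mu_0|_Y}{d\mu_0|_Y\circ F}$ satisfies $|\log\zeta_0(y)-\log\zeta_0(y')|\le Cd(Fy,Fy')^\eta$ for $y,y'\in Y_j$. Let $\mu_Y$ be the unique ergodic $F$-invariant probability measure on $Y$ absolutely continuous w.r.t. $\mu_0$. With $\bar\tau=\int\tau\,d\mu_Y$, let $\mu_X=\pi_*\mu^\tau$, where $\mu^\tau=(\mu_Y\times\text{counting})/\bar\tau$ on $\{(y,\ell):0\le\ell\le\tau(y)-1\}$ and $\pi(y,\ell)=f^\ell y$. Assume $h\in L^1(\mu_X)$ and let $\mu_M$ be the image of $(\mu_X\times\text{Lebesgue})/\int h\,d\mu_X$ on $\{(x,u):0\le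 u\le h(x)\}$ under $(x,u)\mapsto T_ux$. The separation time $s(y,y')$ is the least $n\ge0$ with $F^ny,F^ny'$ in distinct $Y_j$; $d_\theta(y,y')=\theta^{s(y,y')}$. The induced roof function is $H(y)=\sum_{\ell=0}^{\tau(y)-1}h(f^\ell y)$. Assume there are $\theta\in(0,1)$ and $C\ge1$ such that for all $j$: $\sup_{y\ne y'\in Y_j}|H(y)-H(y')|/d_\theta(y,y')\le C\inf_{Y_j}H$, and $d(T_ty,T_ty')\le C\theta^{s(y,y')}$ for $y,y'\in Y_j$, $t\in[0,H(y)]\cap[0,H(y')]$. For $v:M\to\mathbb R^d$, $\|v\|_\eta=|v|_\infty+\sup_{x\ne x'}|v(x)-v(x')|/d(x,x')^\eta$; $C_0^\eta(M,\mathbb R^d)$ is the set of $v$ with $\|v\|_\eta<\infty$ and $\int v\,d\mu_M=0$. $a\otimes b=ab^T$. Norms $|\cdot|_q$ in the conclusions are on $L^q(M,\mu_M)$. *)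

theory Defs
  imports "HOL-Probability.Probability"
begin

text \<open>mu_X = pi_* mu^tau : the image of (mu_Y x counting)/tau_bar on the tower
  {(y,l). 0 <= l <= tau y - 1} under (y,l) |-> f^l y.\<close>
definition tower_measure :: "'a::topological_space measure \<Rightarrow> ('a \<Rightarrow> nat) \<Rightarrow> ('a \<Rightarrow> 'a) \<Rightarrow> 'a measure" where
  "tower_measure \<mu>Y \<tau> f = measure_of UNIV (sets borel)
     (\<lambda>A. (\<integral>\<^sup>+ y. ennreal (\<Sum>l<\<tau> y. indicator A ((f ^^ l) y)) \<partial>\<mu>Y)
          / (\<integral>\<^sup>+ y. ennreal (real (\<tau> y)) \<partial>\<mu>Y))"

text \<open>mu_M : the image of (mu_X x Lebesgue)/int h dmu_X on {(x,u). 0 <= u <= h x}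
  under (x,u) |-> T_u x.\<close>
definition suspension_measure :: "'a::topological_space measure \<Rightarrow> ('a \<Rightarrow> real) \<Rightarrow> (real \<Rightarrow> 'a \<Rightarrow> 'a) \<Rightarrow> 'a measure" where
  "suspension_measure \<mu>X h T = measure_of UNIV (sets borel)
     (\<lambda>B. (\<integral>\<^sup>+ x. (\<integral>\<^sup>+ u\<in>{0..h x}. indicator B (T u x) \<partial>lborel) \<partial>\<mu>X)
          / (\<integral>\<^sup>+ x. ennreal (h x) \<partial>\<mu>X))"

definition induced_roof :: "('a \<Rightarrow> real) \<Rightarrow> ('a \<Rightarrow> 'a) \<Rightarrow> ('a \<Rightarrow> nat) \<Rightarrow> 'a \<Rightarrow> real" where
  "induced_roof h f \<tau> y = (\<Sum>l<\<tau> y. h ((f ^^ l) y))"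

definition sep_time :: "'a set set \<Rightarrow> ('a \<Rightarrow> 'a) \<Rightarrow> 'a \<Rightarrow> 'a \<Rightarrow> enat" where
  "sep_time P F y y' =
     (if \<exists>n. \<not> (\<exists>j\<in>P. (F ^^ n) y \<in> j \<and> (F ^^ n) y' \<in> j)
      then enat (LEAST n. \<not> (\<exists>j\<in>P. (F ^^ n) y \<in> j \<and> (F ^^ n) y' \<in> j))
      else \<infinity>)"

definition d_theta :: "real \<Rightarrow> 'a set set \<Rightarrow> ('a \<Rightarrow> 'a) \<Rightarrow> 'a \<Rightarrow> 'a \<Rightarrow> real" where
  "d_theta \<theta> P F y y' = (case sep_time P F y y' of enat n \<Rightarrow> \<theta> ^ n | \<infinity> \<Rightarrow> 0)"

definition holder_norm :: "real \<Rightarrow> ('a::metric_space \<Rightarrow> 'b::real_normed_vector) \<Rightarrow> real" where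
  "holder_norm \<eta> v = (SUP x. norm (v x))
     + Sup (insert 0 {norm (v x - v x') / dist x x' powr \<eta> | x x'. x \<noteq> x'})"

definition holder0 :: "real \<Rightarrow> 'a::metric_space measure \<Rightarrow> ('a \<Rightarrow> 'b::euclidean_space) set" where
  "holder0 \<eta> \<mu> = {v. bounded (range v)
      \<and> (\<exists>K. \<forall>x x'. norm (v x - v x') \<le> K * dist x x' powr \<eta>)
      \<and> v \<in> borel_measurable borel
      \<and> (\<integral>x. v x \<partial>\<mu>) = 0}"

definition Lq_norm :: "'a measure \<Rightarrow> real \<Rightarrow> ('a \<Rightarrow> 'b::real_normed_vector) \<Rightarrow> ereal" where
  "Lq_norm M q g =
     (let I = (\<integral>\<^sup>+ x. ennreal (norm (g x) powr q) \<partial>M)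
      in if I = \<infinity> then \<infinity> else ereal (enn2real I powr (1 / q)))"

definition outer :: "real^'n \<Rightarrow> real^'n \<Rightarrow> real^'n^'n" where
  "outer a b = (\<chi> i j. a $ i * b $ j)"

end

theory Submission
  imports Defs
begin

text \<open>
  Write \<open>H\<close> for the induced roof, \<open>F y = T (H y) y\<close>, and \<open>\<Phi> y = \<integral>\<^sub>0\<^bsup>H y\<^esup> a (T u y) du\<close> for a scalar
  observable \<open>a\<close> of mean zero. Full branches and bounded distortion make the transfer operator of
  \<open>F\<close> preserve a cone of log-Lipschitz densities and lose a fixed fraction of every density to the
  constants; hence the invariant density is regular and \<open>\<bar>E[(u \<circ> F\<^sup>n) \<Phi>]\<bar> \<le> C \<gamma>\<^sup>n E\<bar>u\<bar>\<close>.

  If \<open>G\<close> has derivative \<open>G'\<close> along the flow, then \<open>\<integral> G a\<close> over the suspension is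
  \<open>E[G \<Phi>]\<close> up to an error \<open>E[H \<integral>\<^sub>0\<^bsup>H\<^esup> \<bar>G' (T u y)\<bar> du]\<close>, and telescoping \<open>G\<close> along \<open>F\<close> bounds
  \<open>E[G \<Phi>]\<close> by the decay of correlations. So \<open>\<bar>\<integral> G a\<bar> \<le> C \<integral> (H + 1) \<bar>G'\<bar>\<close>.

  Finally \<open>\<bar>a\<^sub>t\<bar>\<^sup>r\<close> is the time integral of \<open>r \<psi>(a\<^sub>t\<^sub>-\<^sub>s \<circ> T\<^sub>s) (a \<circ> T\<^sub>s)\<close>, where
  \<open>\<psi>(x) = sgn x \<bar>x\<bar>\<^bsup>r-1\<^esup>\<close>; integrating, using invariance and the estimate with
  \<open>G = \<psi>(a\<^sub>s)\<close>, the \<open>r\<close>-th moment is bounded by a time integral of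
  \<open>\<integral> (H + 1) \<bar>a\<^sub>s\<bar>\<^bsup>r-2\<^esup>\<close>, and Young's inequality closes the argument with \<open>r = 2 (p - 1)\<close>, because
  \<open>H \<in> L\<^sup>p\<close> on the base means \<open>H \<in> L\<^bsup>p-1\<^esup>\<close> on the suspension. The iterated integral is treated in
  the same way with \<open>G = \<psi>(S\<^sub>s) b\<^sub>s\<close>.
\<close>

section \<open>Transfer operator of the induced map\<close>

text \<open>Two features of the decay estimate are dictated by its later use. It is linear in the
  \<open>L\<^sup>1\<close> norm of the function composed with iterates of \<open>F\<close>, because
  that function will be the difference of \<open>G\<close> and \<open>G\<close> after
  \<open>F\<close>, whose only good bound is the integral of the derivative over a fibre; hence the
  densities themselves are compared in the sup norm. And it is relative to the mean of a function
  that is regular inside each cell only, since the roof may be unbounded across cells. In the moment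
  bounds, the derivative of a flow integral along the flow involves the observable only at its two
  end times. Differentiating \<open>\<psi>\<close> of it therefore costs one power of the integral
  and brings in no power of time. Young's inequality with a parameter of order \<open>1 / t0\<close>
  then yields growth \<open>t0 powr (r / 2)\<close> plus a fraction of the largest moment on
  \<open>[0, t0]\<close>; that supremum is finite because observables are bounded, so the fraction
  can be absorbed.\<close>

locale gibbs_markov =
  fixes F :: "'a::metric_space \<Rightarrow> 'a" and Y :: "'a set" and P :: "'a set set"
    and \<mu>0 :: "'a measure" and \<zeta>0 :: "'a \<Rightarrow> real" and lam C0 \<eta> \<theta> :: real
  assumes bounded_M: "bounded (UNIV :: 'a set)"
    and Y_sets [measurable]: "Y \<in> sets borel"
    and F_meas [measurable]: "F \<in> borel_measurable borel"
    and F_Y: "F ` Y \<subseteq> Y"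
    and mu0_finite: "finite_measure \<mu>0"
    and mu0_sets [measurable_cong]: "sets \<mu>0 = sets borel"
    and mu0_Y: "emeasure \<mu>0 Y > 0"
    and P_countable: "countable P"
    and P_sets: "\<And>j. j \<in> P \<Longrightarrow> j \<in> sets borel"
    and P_disjoint: "disjoint P"
    and P_cover: "\<Union> P = Y"
    and constants: "lam > 1" "C0 \<ge> 1" "0 < \<eta>" "\<eta> \<le> 1" "0 < \<theta>" "\<theta> < 1" "lam powr (- \<eta>) \<le> \<theta>"
    and zeta0_meas [measurable]: "\<zeta>0 \<in> borel_measurable borel"
    and zeta0_pos: "\<And>y. y \<in> Y \<Longrightarrow> \<zeta>0 y > 0"
    and full_branch: "\<And>j. j \<in> P \<Longrightarrow> \<exists>N. N \<in> null_sets \<mu>0 \<and> N \<subseteq> j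
            \<and> inj_on F (j - N) \<and> F ` (j - N) \<subseteq> Y
            \<and> (\<forall>A \<in> sets borel. A \<subseteq> j - N \<longrightarrow> F ` A \<in> sets borel)
            \<and> Y - F ` (j - N) \<in> null_sets \<mu>0
            \<and> (\<forall>A \<in> sets borel. A \<subseteq> j - N \<longrightarrow>
                 emeasure \<mu>0 A = (\<integral>\<^sup>+ y\<in>F ` A. ennreal (\<zeta>0 (the_inv_into (j - N) F y)) \<partial>\<mu>0))"
    and expanding: "\<And>j y y'. j \<in> P \<Longrightarrow> y \<in> j \<Longrightarrow> y' \<in> j \<Longrightarrow> dist (F y) (F y') \<ge> lam * dist y y'"
    and distortion: "\<And>j y y'. j \<in> P \<Longrightarrow> y \<in> j \<Longrightarrow> y' \<in> j \<Longrightarrow>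
            \<bar>ln (\<zeta>0 y) - ln (\<zeta>0 y')\<bar> \<le> C0 * dist (F y) (F y') powr \<eta>"
begin

abbreviation e :: "'a \<Rightarrow> 'a \<Rightarrow> real" where "e \<equiv> d_theta \<theta> P F"

section \<open>Symbolic distance and its comparison with the metric\<close>

definition same_cell :: "nat \<Rightarrow> 'a \<Rightarrow> 'a \<Rightarrow> bool" where
  "same_cell n y y' = (\<exists>j\<in>P. (F ^^ n) y \<in> j \<and> (F ^^ n) y' \<in> j)"

lemma space_mu0 [simp]: "space \<mu>0 = UNIV"
  using sets_eq_imp_space_eq[OF mu0_sets] by simp

lemma e_nonneg: "0 \<le> e y y'"
  using constants by (auto simp: d_theta_def split: enat.split)

lemma e_le_1: "e y y' \<le> 1"
  using constants by (auto simp: d_theta_def power_le_one split: enat.split)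

text \<open>Hides \<open>LEAST\<close> and \<open>enat\<close> from the sequel. Pairs that never
  separate get distance 0, while points in different cells, or outside \<open>Y\<close>, separate at
  time 0 and get distance 1.\<close>

lemma e_cases:
  obtains n where "e y y' = \<theta> ^ n" "\<And>i. i < n \<Longrightarrow> same_cell i y y'" "\<not> same_cell n y y'"
  | "e y y' = 0" "\<And>i. same_cell i y y'"
proof (cases "\<exists>n. \<not> same_cell n y y'")
  case True
  define n where "n = (LEAST n. \<not> same_cell n y y')"
  have "sep_time P F y y' = enat n"
    unfolding sep_time_def n_def using True by (simp only: if_True same_cell_def)
  then have e: "e y y' = \<theta> ^ n" by (simp add: d_theta_def)
  have "\<not> same_cell n y y'" unfolding n_def using True by (rule LeastI_ex)
  moreover have "same_cell i y y'" if "i < n" for i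
    using not_less_Least[of i "\<lambda>n. \<not> same_cell n y y'"] that unfolding n_def by blast
  ultimately show ?thesis using that(1) e by blast
next
  case False
  then have "sep_time P F y y' = \<infinity>" unfolding sep_time_def by (simp only: if_False same_cell_def)
  then show ?thesis using that(2) False by (simp add: d_theta_def)
qed

text \<open>Points of one cell share an itinerary exactly one symbol longer than that of their
  images. Read backwards, inverse branches contract by the factor \<open>\<theta>\<close>, which is
  the source of the contraction in \<open>transfer_exists\<close>.\<close>

lemma e_step:
  assumes "j \<in> P" "y \<in> j" "y' \<in> j"
  shows "e y y' = \<theta> * e (F y) (F y')"
proof -
  have 0: "same_cell 0 y y'" using assms by (auto simp: same_cell_def)
  have Suc: "same_cell (Suc i) y y' = same_cell i (F y) (F y')" for i
    by (simp add: same_cell_def funpow_Suc_right del: funpow.simps)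
  show ?thesis
  proof (cases rule: e_cases[of y y'])
    case (1 n)
    obtain k where n: "n = Suc k" using 1 0 by (cases n) auto
    show ?thesis
    proof (cases rule: e_cases[of "F y" "F y'"])
      case (1 l)
      note l = this
      have "l = k"
      proof (rule linorder_cases[of l k])
        assume "l < k" then show ?thesis using l(3) Suc[of l] \<open>\<And>i. i < n \<Longrightarrow> same_cell i y y'\<close>[of "Suc l"] n by simp
      next
        assume "k < l" then show ?thesis using l(2)[of k] Suc[of k] \<open>\<not> same_cell n y y'\<close> n by simp
      qed
      then show ?thesis using l(1) 1 n \<open>e y y' = \<theta> ^ n\<close> by simp
    next
      case 2
      then show ?thesis using Suc[of k] \<open>\<not> same_cell n y y'\<close> n by simp
    qed
  next
    case 2
    note c = this
    show ?thesis
    proof (cases rule: e_cases[of "F y" "F y'"])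
      case (1 l)
      then show ?thesis using Suc[of l] c(2)[of "Suc l"] by simp
    next
      case 2
      then show ?thesis using c by simp
    qed
  qed
qed

lemma expanding_pow:
  assumes "\<And>i. i < n \<Longrightarrow> same_cell i y y'"
  shows "lam ^ n * dist y y' \<le> dist ((F ^^ n) y) ((F ^^ n) y')"
  using assms
proof (induction n)
  case (Suc n)
  obtain j where j: "j \<in> P" "(F ^^ n) y \<in> j" "(F ^^ n) y' \<in> j" using Suc.prems[of n] by (auto simp: same_cell_def)
  have "lam ^ Suc n * dist y y' = lam * (lam ^ n * dist y y')" by simp
  also have "\<dots> \<le> lam * dist ((F ^^ n) y) ((F ^^ n) y')"
    using Suc constants by (intro mult_left_mono) auto
  also have "\<dots> \<le> dist (F ((F ^^ n) y)) (F ((F ^^ n) y'))" using expanding[OF j] by simp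
  finally show ?case by simp
qed simp

text \<open>Chosen positive, unlike the diameter of a one-point space, so that
  \<open>D powr (1 - \<eta>) * D powr \<eta>\<close> equals \<open>D\<close>.\<close>

definition D :: real where "D = (SOME d. d > 0 \<and> (\<forall>x y::'a. dist x y \<le> d))"

lemma D: "D > 0" "dist (x::'a) y \<le> D"
proof -
  obtain d where "\<forall>x y::'a. dist x y \<le> d"
    using bounded_M unfolding bounded_two_points by auto
  then have "max d 1 > 0 \<and> (\<forall>x y::'a. dist x y \<le> max d 1)" by (auto simp: le_max_iff_disj)
  then have "D > 0 \<and> (\<forall>x y::'a. dist x y \<le> D)" unfolding D_def by (rule someI)
  then show "D > 0" "dist (x::'a) y \<le> D" by auto
qed

text \<open>Before separation at time \<open>n\<close> the distance has grown by at least
  \<open>lam ^ n\<close> and is still at most \<open>D\<close>; raising to the power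
  \<open>\<eta>\<close> leaves \<open>(lam powr (-\<eta>)) ^ n\<close>, which is at most
  \<open>\<theta> ^ n\<close>. Points that never separate coincide.\<close>

lemma dist_powr_le_e: "dist y y' powr \<eta> \<le> D powr \<eta> * e y y'"
proof (cases rule: e_cases[of y y'])
  case (1 n)
  have "lam ^ n * dist y y' \<le> D" using expanding_pow[of n y y'] 1 D(2) order_trans by blast
  then have "(lam ^ n * dist y y') powr \<eta> \<le> D powr \<eta>" using constants by (intro powr_mono2) auto
  then have *: "lam powr (\<eta> * n) * dist y y' powr \<eta> \<le> D powr \<eta>"
    using constants by (simp add: powr_mult powr_powr mult.commute flip: powr_realpow)
  have "dist y y' powr \<eta> \<le> D powr \<eta> * lam powr (- (\<eta> * n))"
    using * constants by (simp add: powr_minus field_simps)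
  also have "lam powr (- (\<eta> * n)) = (lam powr (-\<eta>)) ^ n"
    using constants by (simp add: powr_powr flip: powr_realpow)
  also have "\<dots> \<le> \<theta> ^ n" using constants by (intro power_mono) auto
  finally show ?thesis using 1 by (simp add: mult_left_mono)
next
  case 2
  have "dist y y' \<le> D * (1/lam) ^ n" for n
    using order_trans[OF expanding_pow[of n y y'] D(2)] 2 constants by (simp add: field_simps)
  moreover have "(\<lambda>n. D * (1/lam) ^ n) \<longlonglongrightarrow> D * 0"
    using constants by (intro tendsto_intros LIMSEQ_power_zero) auto
  ultimately have "dist y y' \<le> D * 0" by (intro LIMSEQ_le_const) auto
  then show ?thesis using e_nonneg by simp
qed

text \<open>Split off the factor \<open>dist y y' powr (1 - \<eta>)\<close>, at most
  \<open>D powr (1 - \<eta>)\<close>, and use the Hoelder estimate for the rest.\<close>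

lemma dist_le_e: "dist y y' \<le> D * e y y'"
proof -
  have "dist y y' = dist y y' powr (1 - \<eta>) * dist y y' powr \<eta>"
    by (cases "dist y y' = 0") (simp_all flip: powr_add)
  also have "\<dots> \<le> D powr (1 - \<eta>) * (D powr \<eta> * e y y')"
    using D constants dist_powr_le_e e_nonneg by (intro mult_mono powr_mono2) auto
  also have "\<dots> = D * e y y'" using D(1) by (simp flip: powr_add mult.assoc)
  finally show ?thesis .
qed

section \<open>Reference measure on \<open>Y\<close> and inverse branches\<close>

definition m :: "'a measure" where "m = density \<mu>0 (indicator Y)"

lemma sets_m [measurable_cong, simp]: "sets m = sets borel"
  and space_m [simp]: "space m = UNIV"
  by (simp_all add: m_def mu0_sets)

lemma emeasure_m: "A \<in> sets borel \<Longrightarrow> emeasure m A = emeasure \<mu>0 (A \<inter> Y)"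
  using emeasure_density[of "indicator Y" \<mu>0 A] mu0_sets
  by (simp add: m_def indicator_inter_arith[symmetric] Int_commute)

lemma AE_m: "(AE x in m. Q x) \<longleftrightarrow> (AE x in \<mu>0. x \<in> Y \<longrightarrow> Q x)"
  unfolding m_def by (subst AE_density) (auto simp: indicator_def)

lemma nn_integral_m:
  "f \<in> borel_measurable borel \<Longrightarrow> (\<integral>\<^sup>+x. f x \<partial>m) = (\<integral>\<^sup>+x. indicator Y x * f x \<partial>\<mu>0)"
  unfolding m_def by (subst nn_integral_density) auto

sublocale finite_m: finite_measure m
proof
  have "emeasure m (space m) = emeasure \<mu>0 Y" by (simp add: emeasure_m)
  then show "emeasure m (space m) \<noteq> \<infinity>"
    using finite_measure.emeasure_finite[OF mu0_finite, of Y] by simp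
qed

definition m1 :: real where "m1 = measure m UNIV"

lemma m1_pos: "m1 > 0"
  using mu0_Y finite_m.emeasure_eq_measure[of UNIV] emeasure_m[of UNIV]
  by (simp add: m1_def)

lemma AE_m_Y: "AE x in m. x \<in> Y"
  by (simp add: AE_m)

text \<open>\<open>i\<close> is an inverse branch of \<open>F\<close> into the cell
  \<open>j\<close>, meaningful only on \<open>B\<close>, which misses a null part of
  \<open>Y\<close>. The last clause is the change of variables, stated for nonnegative functions so
  that no integrability is involved.\<close>

definition is_branch :: "'a set \<Rightarrow> 'a set \<Rightarrow> ('a \<Rightarrow> 'a) \<Rightarrow> bool" where
  "is_branch j B i \<longleftrightarrow> B \<in> sets borel \<and> Y - B \<in> null_sets \<mu>0 \<and> i \<in> borel_measurable borel
     \<and> (\<forall>y\<in>B. i y \<in> j \<and> F (i y) = y)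
     \<and> (\<forall>w\<in>borel_measurable borel. (\<integral>\<^sup>+x. w x * indicator j x \<partial>\<mu>0)
            = (\<integral>\<^sup>+y. indicator B y * ennreal (\<zeta>0 (i y)) * w (i y) \<partial>m))"

text \<open>Images under \<open>F\<close> of measurable subsets of the good part of the cell are
  measurable, which is measurability of the inverse. The hypothesis gives the change of variables
  for sets; written as an equality of two measures it extends to functions.\<close>

lemma branch:
  assumes j: "j \<in> P"
  shows "\<exists>B i. is_branch j B i"
proof -
  obtain N where N: "N \<in> null_sets \<mu>0" "N \<subseteq> j" and inj: "inj_on F (j - N)"
    and FY: "F ` (j - N) \<subseteq> Y"
    and img: "\<And>A. A \<in> sets borel \<Longrightarrow> A \<subseteq> j - N \<Longrightarrow> F ` A \<in> sets borel"
    and YB: "Y - F ` (j - N) \<in> null_sets \<mu>0"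
    and em: "\<And>A. A \<in> sets borel \<Longrightarrow> A \<subseteq> j - N \<Longrightarrow>
         emeasure \<mu>0 A = (\<integral>\<^sup>+ y\<in>F ` A. ennreal (\<zeta>0 (the_inv_into (j - N) F y)) \<partial>\<mu>0)"
    using full_branch[OF j] by (elim exE conjE) (rule that, auto)
  have jN [measurable]: "j - N \<in> sets borel" using P_sets[OF j] N mu0_sets by auto
  define B where "B = F ` (j - N)"
  have B [measurable]: "B \<in> sets borel" unfolding B_def by (rule img) auto
  \<comment> \<open>An arbitrary value for \<open>i\<close> off \<open>B\<close>: being constant
    there, the total function stays measurable.\<close>
  obtain x0 :: 'a where True by simp
  define i where "i y = (if y \<in> B then the_inv_into (j - N) F y else x0)" for y
  have iB: "i y \<in> j - N" "F (i y) = y" if "y \<in> B" for y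
    using that the_inv_into_into[OF inj _ subset_refl, of y] f_the_inv_into_f[OF inj, of y]
    unfolding i_def B_def by simp_all
  have iF: "i (F x) = x" if "x \<in> j - N" for x
    using that inj by (simp add: i_def B_def the_inv_into_f_f)
  have vim: "i -` A \<inter> B = F ` (A \<inter> (j - N))" for A
  proof (intro set_eqI iffI)
    fix y assume "y \<in> i -` A \<inter> B"
    then have "i y \<in> A \<inter> (j - N)" "y = F (i y)" using iB[of y] by auto
    then show "y \<in> F ` (A \<inter> (j - N))" by (rule image_eqI[rotated])
  next
    fix y assume "y \<in> F ` (A \<inter> (j - N))"
    then obtain x where "x \<in> A" "x \<in> j - N" "y = F x" by blast
    then show "y \<in> i -` A \<inter> B" using iF[of x] by (simp add: B_def)
  qed
  have i_meas [measurable]: "i \<in> borel_measurable borel"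
  proof (rule measurableI)
    fix A :: "'a set" assume A: "A \<in> sets borel"
    have "\<And>x. x \<notin> B \<Longrightarrow> i x = x0" by (simp add: i_def)
    then have eq: "i -` A = (i -` A \<inter> B) \<union> (if x0 \<in> A then - B else {})"
      by (auto split: if_splits)
    have "i -` A \<inter> B \<in> sets borel" unfolding vim using A by (intro img) auto
    moreover have "(if x0 \<in> A then - B else {}) \<in> sets borel" using B by (simp add: borel_comp)
    ultimately have "i -` A \<in> sets borel" by (subst eq) (rule sets.Un)
    then show "i -` A \<inter> space borel \<in> sets borel" by simp
  qed simp
  let ?d = "density \<mu>0 (\<lambda>y. indicator B y * ennreal (\<zeta>0 (i y)))"
  have eq: "density \<mu>0 (indicator (j - N)) = distr ?d borel i"
  proof (rule measure_eqI)
    fix A assume "A \<in> sets (density \<mu>0 (indicator (j - N)))"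
    then have A [measurable]: "A \<in> sets borel" by (simp add: mu0_sets)
    have "emeasure (density \<mu>0 (indicator (j - N))) A = emeasure \<mu>0 (A \<inter> (j - N))"
      using emeasure_density[of "indicator (j-N)" \<mu>0 A] mu0_sets
      by (simp add: indicator_inter_arith[symmetric] Int_commute)
    also have "\<dots> = (\<integral>\<^sup>+ y\<in>F ` (A \<inter> (j - N)). ennreal (\<zeta>0 (the_inv_into (j - N) F y)) \<partial>\<mu>0)"
      by (rule em) auto
    also have "\<dots> = (\<integral>\<^sup>+ y. (indicator B y * ennreal (\<zeta>0 (i y))) * indicator (i -` A) y \<partial>\<mu>0)"
      unfolding vim[symmetric] by (rule nn_integral_cong) (simp add: indicator_def i_def)
    also have "\<dots> = emeasure ?d (i -` A)"
      using measurable_sets[OF i_meas A] mu0_sets by (subst emeasure_density) auto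
    also have "\<dots> = emeasure (distr ?d borel i) A"
      using mu0_sets by (subst emeasure_distr) auto
    finally show "emeasure (density \<mu>0 (indicator (j - N))) A = emeasure (distr ?d borel i) A" .
  qed (simp add: mu0_sets)
  have "(\<integral>\<^sup>+x. w x * indicator j x \<partial>\<mu>0)
            = (\<integral>\<^sup>+y. indicator B y * ennreal (\<zeta>0 (i y)) * w (i y) \<partial>m)"
    if w [measurable]: "w \<in> borel_measurable borel" for w :: "'a \<Rightarrow> ennreal"
  proof -
    have "(\<integral>\<^sup>+x. w x * indicator j x \<partial>\<mu>0) = (\<integral>\<^sup>+x. indicator (j - N) x * w x \<partial>\<mu>0)"
      using AE_not_in[OF N(1)] by (intro nn_integral_cong_AE) (auto simp: indicator_def)
    also have "\<dots> = (\<integral>\<^sup>+x. w x \<partial>density \<mu>0 (indicator (j - N)))"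
      by (subst nn_integral_density) auto
    also have "\<dots> = (\<integral>\<^sup>+y. w (i y) \<partial>?d)"
      unfolding eq by (subst nn_integral_distr) auto
    also have "\<dots> = (\<integral>\<^sup>+y. indicator B y * ennreal (\<zeta>0 (i y)) * w (i y) \<partial>\<mu>0)"
      by (subst nn_integral_density) auto
    also have "\<dots> = (\<integral>\<^sup>+y. indicator Y y * (indicator B y * ennreal (\<zeta>0 (i y)) * w (i y)) \<partial>\<mu>0)"
      using FY by (intro nn_integral_cong) (auto simp: indicator_def B_def)
    finally show ?thesis by (subst nn_integral_m) auto
  qed
  then show ?thesis using B YB i_meas iB unfolding B_def[symmetric] is_branch_def by (intro exI[of _ B] exI[of _ i]) auto
qed

section \<open>Cones of log-Lipschitz densities and the dual transfer operator\<close>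

definition reg :: "real \<Rightarrow> ('a \<Rightarrow> real) \<Rightarrow> bool" where
  "reg R g \<longleftrightarrow> (\<exists>Z\<in>null_sets m. \<forall>y\<in>Y - Z. \<forall>y'\<in>Y - Z. g y \<le> exp (R * e y y') * g y')"

text \<open>Pairs are compared only inside a cell. This suffices as input of the transfer operator,
  whose branches send any two points into a common cell, and it is what functions like the roof,
  unbounded across cells, can satisfy.\<close>

definition breg :: "real \<Rightarrow> ('a \<Rightarrow> real) \<Rightarrow> bool" where
  "breg R g \<longleftrightarrow> (\<exists>Z\<in>null_sets m. \<forall>j\<in>P. \<forall>y\<in>j - Z. \<forall>y'\<in>j - Z. g y \<le> exp (R * e y y') * g y')"

definition dens :: "('a \<Rightarrow> real) \<Rightarrow> bool" where
  "dens g \<longleftrightarrow> (\<forall>x. 0 \<le> g x) \<and> integrable m g"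

text \<open>\<open>tr g g'\<close> says that \<open>g'\<close> is the image of \<open>g\<close> under the transfer operator, in dual form: this
  fixes \<open>g'\<close> only almost everywhere, which suits branches that are bijections only up to null sets.\<close>

definition tr :: "('a \<Rightarrow> real) \<Rightarrow> ('a \<Rightarrow> real) \<Rightarrow> bool" where
  "tr g g' \<longleftrightarrow> (\<forall>u\<in>borel_measurable borel. \<forall>b. (\<forall>x. \<bar>u x\<bar> \<le> b) \<longrightarrow>
     (\<integral>y. u (F y) * g y \<partial>m) = (\<integral>y. u y * g' y \<partial>m))"

lemma reg_imp_breg: "reg R g \<Longrightarrow> breg R g"
  unfolding reg_def breg_def using P_cover by blast

lemma integrable_bdd_mult:
  fixes u g :: "'a \<Rightarrow> real"
  assumes "u \<in> borel_measurable borel" "\<And>x. \<bar>u x\<bar> \<le> b" "integrable M g" "sets M = sets borel"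
  shows "integrable M (\<lambda>x. u x * g x)"
proof (rule Bochner_Integration.integrable_bound[where f="\<lambda>x. b * g x"])
  show "integrable M (\<lambda>x. b * g x)" using assms by simp
  show "(\<lambda>x. u x * g x) \<in> borel_measurable M"
    using assms measurable_cong_sets[OF assms(4) refl, of borel] borel_measurable_integrable[OF assms(3)] by measurable
  have "0 \<le> b" using assms(2) order_trans abs_ge_zero by blast
  then show "AE x in M. norm (u x * g x) \<le> norm (b * g x)"
    using assms(2) by (auto simp: abs_mult intro!: mult_right_mono)
qed

text \<open>Distortion of \<open>ln \<zeta>0\<close> along an inverse branch, measured by the
  distance \<open>e\<close> of the image points.\<close>

definition K0 :: real where "K0 = C0 * D powr \<eta>"

lemma K0_nonneg: "K0 \<ge> 0" using constants by (simp add: K0_def)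

text \<open>The image is the sum over all branches of \<open>\<zeta>0 (i y) * g (i y)\<close>. Terms
  of one branch at two points are compared directly: the Jacobian contributes \<open>K0\<close>, and
  \<open>g\<close>, evaluated at points that are closer by the factor \<open>\<theta>\<close>,
  contributes \<open>\<theta> * R\<close>. As every branch is defined almost everywhere on
  \<open>Y\<close>, summation yields regularity across cells from regularity inside cells.\<close>

lemma transfer_exists:
  assumes g: "dens g" and R: "breg R g"
  shows "\<exists>g'. dens g' \<and> reg (K0 + \<theta> * R) g' \<and> tr g g'"
proof -
  have g0: "0 \<le> g x" and gi: "integrable m g" for x using g by (auto simp: dens_def)
  have g_meas [measurable]: "g \<in> borel_measurable borel"
    using borel_measurable_integrable[OF gi] by simp
  obtain B i where "\<And>j. j \<in> P \<Longrightarrow> is_branch j (B j) (i j)" using branch by metis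
  note bi = this[unfolded is_branch_def]
  have B [measurable]: "B j \<in> sets borel" and i [measurable]: "i j \<in> borel_measurable borel" if "j \<in> P" for j
    using bi[OF that] by auto
  have iB: "i j y \<in> j" "F (i j y) = y" if "j \<in> P" "y \<in> B j" for j y
    using bi[OF that(1)] that by auto
  have cov: "(\<integral>\<^sup>+x. w x * indicator j x \<partial>\<mu>0)
            = (\<integral>\<^sup>+y. indicator (B j) y * ennreal (\<zeta>0 (i j y)) * w (i j y) \<partial>m)"
    if "j \<in> P" "w \<in> borel_measurable borel" for j and w :: "'a \<Rightarrow> ennreal"
    using bi[OF that(1)] that(2) by blast
  define t where "t j y = indicator (B j) y * ennreal (\<zeta>0 (i j y) * g (i j y))" for j y
  have t [measurable]: "t j \<in> borel_measurable borel" if "j \<in> P" for j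
    using B[OF that] i[OF that] unfolding t_def by measurable
  \<comment> \<open>The sum is an integral over the counting measure on \<open>P\<close> with values
    in \<open>ennreal\<close>: Tonelli applies, and finiteness almost everywhere is deduced
    afterwards from the total mass.\<close>
  define G where "G y = (\<integral>\<^sup>+j. t j y \<partial>count_space P)" for y
  interpret cP: sigma_finite_measure "count_space P"
    by (rule sigma_finite_measure_count_space_countable[OF P_countable])
  have G [measurable]: "G \<in> borel_measurable borel"
    unfolding G_def
  proof (rule cP.borel_measurable_nn_integral)
    have "(\<lambda>(j, y). t j y) \<in> borel_measurable (count_space P \<Otimes>\<^sub>M borel)"
      using t P_countable by (intro measurable_pair_measure_countable1) auto
    then show "(\<lambda>(y, j). t j y) \<in> borel_measurable (borel \<Otimes>\<^sub>M count_space P)"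
      by (subst measurable_pair_swap_iff) (simp add: split_beta')
  qed
  have nn: "(\<integral>\<^sup>+y. u y * G y \<partial>m) = (\<integral>\<^sup>+x. u (F x) * ennreal (g x) \<partial>m)"
    if u [measurable]: "u \<in> borel_measurable borel" for u :: "'a \<Rightarrow> ennreal"
  proof -
    have one: "(\<integral>\<^sup>+j. c * indicator j x \<partial>count_space P) = indicator Y x * c" for x :: 'a and c :: ennreal
    proof (cases "x \<in> Y")
      case True
      then obtain k where k: "k \<in> P" "x \<in> k" using P_cover by auto
      have "(\<integral>\<^sup>+j. c * indicator j x \<partial>count_space P) = (\<integral>\<^sup>+j. c * indicator {k} j \<partial>count_space P)"
        using k P_disjoint by (intro nn_integral_cong) (auto simp: indicator_def disjoint_def)
      also have "\<dots> = c" using k by (subst nn_integral_cmult_indicator) auto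
      finally show ?thesis using True by simp
    next
      case False
      then have "(\<integral>\<^sup>+j. c * indicator j x \<partial>count_space P) = (\<integral>\<^sup>+j. 0 \<partial>count_space P)"
        using P_cover by (intro nn_integral_cong) (auto simp: indicator_def)
      then show ?thesis using False by simp
    qed
    have "(\<integral>\<^sup>+x. u (F x) * ennreal (g x) \<partial>m) = (\<integral>\<^sup>+x. indicator Y x * (u (F x) * ennreal (g x)) \<partial>\<mu>0)"
      by (rule nn_integral_m) measurable
    also have "\<dots> = (\<integral>\<^sup>+x. \<integral>\<^sup>+j. (u (F x) * ennreal (g x)) * indicator j x \<partial>count_space P \<partial>\<mu>0)"
      by (simp only: one)
    also have "\<dots> = (\<integral>\<^sup>+j. \<integral>\<^sup>+x. (u (F x) * ennreal (g x)) * indicator j x \<partial>\<mu>0 \<partial>count_space P)"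
    proof (intro nn_integral_count_space_nn_integral P_countable)
      fix j assume "j \<in> P"
      then have [measurable]: "j \<in> sets borel" by (rule P_sets)
      show "(\<lambda>x. (u (F x) * ennreal (g x)) * indicator j x) \<in> borel_measurable \<mu>0" by measurable
    qed
    also have "\<dots> = (\<integral>\<^sup>+j. \<integral>\<^sup>+y. u y * t j y \<partial>m \<partial>count_space P)"
    proof (rule nn_integral_cong)
      fix j assume "j \<in> space (count_space P)"
      then have j: "j \<in> P" by simp
      have z: "0 \<le> \<zeta>0 (i j y)" if "y \<in> B j" for y
        using zeta0_pos[of "i j y"] iB[OF j that] j P_cover by force
      show "(\<integral>\<^sup>+x. (u (F x) * ennreal (g x)) * indicator j x \<partial>\<mu>0) = (\<integral>\<^sup>+y. u y * t j y \<partial>m)"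
        by (subst cov[OF j], measurable, rule nn_integral_cong)
           (auto simp: t_def indicator_def iB[OF j] ennreal_mult z g0 ac_simps)
    qed
    also have "\<dots> = (\<integral>\<^sup>+y. \<integral>\<^sup>+j. u y * t j y \<partial>count_space P \<partial>m)"
      using t by (intro nn_integral_count_space_nn_integral[symmetric] P_countable) measurable
    also have "\<dots> = (\<integral>\<^sup>+y. u y * G y \<partial>m)"
      unfolding G_def by (simp add: nn_integral_cmult)
    finally show ?thesis by simp
  qed
  have gfin: "(\<integral>\<^sup>+x. ennreal (g x) \<partial>m) < \<infinity>"
    using gi g0 by (auto simp: integrable_iff_bounded)
  have Gfin: "AE y in m. G y \<noteq> \<infinity>"
    using nn[of "\<lambda>_. 1"] gfin by (intro nn_integral_PInf_AE) auto
  define g' where "g' y = enn2real (G y)" for y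
  have g' [measurable]: "g' \<in> borel_measurable borel" unfolding g'_def by measurable
  have gG: "AE y in m. ennreal (g' y) = G y"
    using Gfin by eventually_elim (auto simp: g'_def less_top)
  have g'0: "0 \<le> g' y" for y by (simp add: g'_def)
  have g'i: "integrable m g'"
  proof (rule integrableI_bounded)
    have "(\<integral>\<^sup>+y. ennreal (norm (g' y)) \<partial>m) = (\<integral>\<^sup>+y. 1 * G y \<partial>m)"
      using gG g'0 by (intro nn_integral_cong_AE) auto
    also have "\<dots> < \<infinity>" using nn[of "\<lambda>_. 1"] gfin by auto
    finally show "(\<integral>\<^sup>+y. ennreal (norm (g' y)) \<partial>m) < \<infinity>" .
  qed measurable
  have trp: "(\<integral>y. u (F y) * g y \<partial>m) = (\<integral>y. u y * g' y \<partial>m)"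
    if [measurable]: "u \<in> borel_measurable borel" and u0: "\<And>x. 0 \<le> u x" for u
  proof -
    have "(\<integral>y. u (F y) * g y \<partial>m) = enn2real (\<integral>\<^sup>+y. ennreal (u (F y) * g y) \<partial>m)"
      using u0 g0 by (intro integral_eq_nn_integral) auto
    also have "(\<integral>\<^sup>+y. ennreal (u (F y) * g y) \<partial>m) = (\<integral>\<^sup>+y. ennreal (u y) * G y \<partial>m)"
      using nn[of "\<lambda>x. ennreal (u x)"] u0 g0 by (simp add: ennreal_mult)
    also have "\<dots> = (\<integral>\<^sup>+y. ennreal (u y * g' y) \<partial>m)"
      using gG by (intro nn_integral_cong_AE) (auto simp: ennreal_mult u0 g'0)
    also have "enn2real \<dots> = (\<integral>y. u y * g' y \<partial>m)"
      using u0 g'0 by (intro integral_eq_nn_integral[symmetric]) auto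
    finally show ?thesis .
  qed
  have "tr g g'"
    unfolding tr_def
  proof (intro ballI allI impI)
    fix u :: "'a \<Rightarrow> real" and b assume u [measurable]: "u \<in> borel_measurable borel" and b: "\<forall>x. \<bar>u x\<bar> \<le> b"
    have b0: "0 \<le> b" using b order_trans abs_ge_zero by blast
    have i1: "integrable m (\<lambda>y. u (F y) * g y)" using b gi by (intro integrable_bdd_mult[where b=b]) auto
    have i2: "integrable m (\<lambda>y. u y * g' y)" using b g'i by (intro integrable_bdd_mult[where b=b]) auto
    \<comment> \<open>Signed test functions reduce to nonnegative ones by adding the bound
      \<open>b\<close> and subtracting the constant case.\<close>
    have "(\<integral>y. (u (F y) + b) * g y \<partial>m) = (\<integral>y. (u y + b) * g' y \<partial>m)"
      using b by (intro trp[of "\<lambda>x. u x + b"]) (auto simp: abs_le_iff, smt (verit))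
    moreover have "(\<integral>y. b * g y \<partial>m) = (\<integral>y. b * g' y \<partial>m)"
      using b0 by (intro trp[of "\<lambda>x. b"]) auto
    ultimately show "(\<integral>y. u (F y) * g y \<partial>m) = (\<integral>y. u y * g' y \<partial>m)"
      using i1 i2 gi g'i by (auto simp: distrib_right)
  qed
  moreover have "reg (K0 + \<theta> * R) g'"
  proof -
    obtain Z0 where Z0: "Z0 \<in> null_sets m"
      and gR: "\<And>j y y'. j \<in> P \<Longrightarrow> y \<in> j - Z0 \<Longrightarrow> y' \<in> j - Z0 \<Longrightarrow> g y \<le> exp (R * e y y') * g y'"
      using R unfolding breg_def by blast
    have Z0b [measurable]: "Z0 \<in> sets borel" using Z0 by auto
    \<comment> \<open>The branches avoid the exceptional set of \<open>g\<close> almost everywhere: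
      by the change of variables the weight \<open>\<zeta>0\<close> integrates to 0 over the points
      whose preimage lies in \<open>Z0\<close>, and this weight is positive.\<close>
    have "AE y in m. y \<in> B j \<and> i j y \<notin> Z0" if j: "j \<in> P" for j
    proof -
      have [measurable]: "B j \<in> sets borel" "i j \<in> borel_measurable borel" using B i j by auto
      have 1: "AE y in m. y \<in> B j"
        unfolding AE_m using bi[OF j] AE_not_in[of "Y - B j" \<mu>0] by auto
      have "(\<integral>\<^sup>+y. indicator (B j) y * ennreal (\<zeta>0 (i j y)) * indicator Z0 (i j y) \<partial>m)
          = (\<integral>\<^sup>+x. indicator Z0 x * indicator j x \<partial>\<mu>0)"
        by (rule cov[OF j, symmetric]) measurable
      also have "\<dots> \<le> (\<integral>\<^sup>+x. indicator Y x * indicator Z0 x \<partial>\<mu>0)"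
        using P_cover j by (intro nn_integral_mono) (auto simp: indicator_def)
      also have "\<dots> = emeasure m Z0" by (subst nn_integral_m[symmetric]) auto
      also have "\<dots> = 0" using Z0 by auto
      finally have "(\<integral>\<^sup>+y. indicator (B j) y * ennreal (\<zeta>0 (i j y)) * indicator Z0 (i j y) \<partial>m) = 0" by simp
      then have "AE y in m. indicator (B j) y * ennreal (\<zeta>0 (i j y)) * indicator Z0 (i j y) = (0::ennreal)"
        by (subst (asm) nn_integral_0_iff_AE) (measurable, auto simp: j)
      with 1 show ?thesis
      proof eventually_elim
        case (elim y)
        have "0 < \<zeta>0 (i j y)" using zeta0_pos iB[OF j] elim j P_cover by blast
        then show ?case using elim by (auto simp: indicator_def)
      qed
    qed
    then have "AE y in m. \<forall>j\<in>P. y \<in> B j \<and> i j y \<notin> Z0"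
      by (subst AE_ball_countable[OF P_countable]) auto
    with Gfin have "AE y in m. (\<forall>j\<in>P. y \<in> B j \<and> i j y \<notin> Z0) \<and> G y \<noteq> \<infinity>" by eventually_elim auto
    then obtain Z where Z: "Z \<in> null_sets m"
      and good: "\<And>y. y \<notin> Z \<Longrightarrow> (\<forall>j\<in>P. y \<in> B j \<and> i j y \<notin> Z0) \<and> G y \<noteq> \<infinity>"
      by (rule AE_E3) auto
    have "g' y \<le> exp ((K0 + \<theta> * R) * e y y') * g' y'" if y: "y \<notin> Z" and y': "y' \<notin> Z" for y y'
    proof -
      have tt: "t j y \<le> ennreal (exp ((K0 + \<theta> * R) * e y y')) * t j y'" if j: "j \<in> P" for j
      proof -
        have yB: "y \<in> B j" "y' \<in> B j" "i j y \<in> j - Z0" "i j y' \<in> j - Z0"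
          using good[OF y] good[OF y'] j iB by auto
        have zp: "\<zeta>0 (i j y) > 0" "\<zeta>0 (i j y') > 0" using yB j P_cover zeta0_pos by blast+
        have ee: "e (i j y) (i j y') = \<theta> * e y y'"
          using e_step[OF j, of "i j y" "i j y'"] yB iB[OF j] by auto
        have "ln (\<zeta>0 (i j y)) - ln (\<zeta>0 (i j y')) \<le> C0 * dist y y' powr \<eta>"
          using distortion[OF j, of "i j y" "i j y'"] yB iB[OF j] by auto
        also have "\<dots> \<le> K0 * e y y'"
          unfolding K0_def mult.assoc using dist_powr_le_e constants by (intro mult_left_mono) auto
        finally have "exp (ln (\<zeta>0 (i j y))) \<le> exp (K0 * e y y' + ln (\<zeta>0 (i j y')))" by simp
        then have z: "\<zeta>0 (i j y) \<le> exp (K0 * e y y') * \<zeta>0 (i j y')" using zp by (simp add: exp_add)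
        have "g (i j y) \<le> exp (R * (\<theta> * e y y')) * g (i j y')" using gR[OF j yB(3,4)] ee by simp
        with z have "\<zeta>0 (i j y) * g (i j y) \<le> (exp (K0 * e y y') * \<zeta>0 (i j y')) * (exp (R * (\<theta> * e y y')) * g (i j y'))"
          using zp g0 by (intro mult_mono) auto
        also have "\<dots> = exp ((K0 + \<theta> * R) * e y y') * (\<zeta>0 (i j y') * g (i j y'))"
          by (simp add: algebra_simps flip: exp_add)
        finally show ?thesis
          using yB zp g0 by (simp add: t_def ennreal_mult[symmetric] ennreal_leI)
      qed
      have "G y \<le> (\<integral>\<^sup>+j. ennreal (exp ((K0 + \<theta> * R) * e y y')) * t j y' \<partial>count_space P)"
        unfolding G_def using tt by (intro nn_integral_mono) auto
      also have "\<dots> = ennreal (exp ((K0 + \<theta> * R) * e y y')) * G y'"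
        unfolding G_def by (subst nn_integral_cmult) auto
      finally have le: "G y \<le> ennreal (exp ((K0 + \<theta> * R) * e y y')) * G y'" .
      have "enn2real (G y) \<le> enn2real (ennreal (exp ((K0 + \<theta> * R) * e y y')) * G y')"
        using good[OF y'] by (intro enn2real_mono le) (auto simp: ennreal_mult_eq_top_iff less_top[symmetric])
      then show ?thesis by (simp add: g'_def enn2real_mult)
    qed
    then show ?thesis unfolding reg_def using Z by blast
  qed
  ultimately show ?thesis using g'0 g'i by (auto simp: dens_def)
qed

end

section \<open>Density of Lipschitz functions and contraction of densities\<close>

definition lipschitz_approx :: "'a::metric_space measure \<Rightarrow> ('a \<Rightarrow> real) \<Rightarrow> bool" where
  "lipschitz_approx M f \<longleftrightarrow> (\<forall>\<epsilon>>0. \<exists>a L b. L-lipschitz_on UNIV a \<and> (\<forall>x. \<bar>a x\<bar> \<le> b)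
     \<and> (\<integral>x. \<bar>f x - a x\<bar> \<partial>M) < \<epsilon>)"

lemma lipschitz_bdd_integrable:
  fixes a :: "'a::metric_space \<Rightarrow> real"
  assumes "finite_measure M" "sets M = sets borel" "L-lipschitz_on UNIV a" "\<And>x. \<bar>a x\<bar> \<le> b"
  shows "integrable M a"
proof (rule finite_measure.integrable_const_bound[OF assms(1), of _ b])
  show "AE x in M. norm (a x) \<le> b" using assms(4) by auto
  have "a \<in> borel_measurable borel"
    using lipschitz_on_continuous_on[OF assms(3)] by (rule borel_measurable_continuous_onI)
  then show "a \<in> borel_measurable M" using assms(2) measurable_cong_sets by blast
qed

lemma lipschitz_approx_add:
  fixes f g :: "'a::metric_space \<Rightarrow> real"
  assumes M: "finite_measure M" "sets M = sets borel" and i: "integrable M f" "integrable M g"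
    and f: "lipschitz_approx M f" and g: "lipschitz_approx M g"
  shows "lipschitz_approx M (\<lambda>x. f x + g x)"
  unfolding lipschitz_approx_def
proof (intro allI impI)
  fix \<epsilon> :: real assume "\<epsilon> > 0"
  then have h: "\<epsilon> / 2 > 0" by simp
  obtain a L b where a: "L-lipschitz_on UNIV a" "\<And>x. \<bar>a x\<bar> \<le> b" "(\<integral>x. \<bar>f x - a x\<bar> \<partial>M) < \<epsilon>/2"
    using f h unfolding lipschitz_approx_def by meson
  obtain a' L' b' where a': "L'-lipschitz_on UNIV a'" "\<And>x. \<bar>a' x\<bar> \<le> b'" "(\<integral>x. \<bar>g x - a' x\<bar> \<partial>M) < \<epsilon>/2"
    using g h unfolding lipschitz_approx_def by meson
  have ia: "integrable M a" "integrable M a'"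
    using lipschitz_bdd_integrable[OF M] a a' by blast+
  have "(\<integral>x. \<bar>(f x + g x) - (a x + a' x)\<bar> \<partial>M) \<le> (\<integral>x. \<bar>f x - a x\<bar> + \<bar>g x - a' x\<bar> \<partial>M)"
    using i ia by (intro integral_mono) auto
  also have "\<dots> < \<epsilon>" using i ia a a' by (subst Bochner_Integration.integral_add) auto
  finally have "(\<integral>x. \<bar>(f x + g x) - (a x + a' x)\<bar> \<partial>M) < \<epsilon>" .
  moreover have "(L + L')-lipschitz_on UNIV (\<lambda>x. a x + a' x)" by (intro lipschitz_on_add a a')
  moreover have "\<bar>a x + a' x\<bar> \<le> b + b'" for x using a(2)[of x] a'(2)[of x] by linarith
  ultimately show "\<exists>a L b. L-lipschitz_on UNIV a \<and> (\<forall>x. \<bar>a x\<bar> \<le> b) \<and> (\<integral>x. \<bar>f x + g x - a x\<bar> \<partial>M) < \<epsilon>"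
    by blast
qed

lemma lipschitz_approx_cmult:
  fixes f :: "'a::metric_space \<Rightarrow> real"
  assumes f: "lipschitz_approx M f"
  shows "lipschitz_approx M (\<lambda>x. c * f x)"
  unfolding lipschitz_approx_def
proof (intro allI impI)
  fix \<epsilon> :: real assume e: "\<epsilon> > 0"
  then have "\<epsilon> / (\<bar>c\<bar> + 1) > 0" by (intro divide_pos_pos) auto
  then obtain a L b where a: "L-lipschitz_on UNIV a" "\<And>x. \<bar>a x\<bar> \<le> b" "(\<integral>x. \<bar>f x - a x\<bar> \<partial>M) < \<epsilon>/(\<bar>c\<bar> + 1)"
    using f unfolding lipschitz_approx_def by meson
  have "(\<integral>x. \<bar>c * f x - c * a x\<bar> \<partial>M) = \<bar>c\<bar> * (\<integral>x. \<bar>f x - a x\<bar> \<partial>M)"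
    by (simp add: abs_mult flip: right_diff_distrib)
  also have "\<dots> \<le> \<bar>c\<bar> * (\<epsilon> / (\<bar>c\<bar> + 1))" using a(3) by (intro mult_left_mono) auto
  also have "\<dots> < \<epsilon>" using e by (simp add: field_simps)
  finally have "(\<integral>x. \<bar>c * f x - c * a x\<bar> \<partial>M) < \<epsilon>" .
  moreover have "(\<bar>c\<bar> * L)-lipschitz_on UNIV (\<lambda>x. c * a x)" by (rule lipschitz_on_cmult_real[OF a(1)])
  moreover have "\<bar>c * a x\<bar> \<le> \<bar>c\<bar> * b" for x using a(2)[of x] by (auto simp: abs_mult intro: mult_left_mono)
  ultimately show "\<exists>a L b. L-lipschitz_on UNIV a \<and> (\<forall>x. \<bar>a x\<bar> \<le> b) \<and> (\<integral>x. \<bar>c * f x - a x\<bar> \<partial>M) < \<epsilon>"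
    by blast
qed

lemma lipschitz_approx_lim:
  fixes f :: "'a::metric_space \<Rightarrow> real"
  assumes M: "finite_measure M" "sets M = sets borel" and i: "integrable M f" "\<And>n::nat. integrable M (s n)"
    and s: "\<And>n. lipschitz_approx M (s n)" and w: "integrable M w"
    and dom: "\<And>n x. \<bar>s n x\<bar> \<le> w x" and lim: "\<And>x. (\<lambda>n. s n x) \<longlonglongrightarrow> f x"
  shows "lipschitz_approx M f"
  unfolding lipschitz_approx_def
proof (intro allI impI)
  fix \<epsilon> :: real assume e: "\<epsilon> > 0"
  have "(\<lambda>n. \<integral>x. \<bar>f x - s n x\<bar> \<partial>M) \<longlonglongrightarrow> (\<integral>x. 0 \<partial>M)"
  proof (rule integral_dominated_convergence[where w="\<lambda>x. \<bar>f x\<bar> + w x"])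
    show "AE x in M. (\<lambda>n. \<bar>f x - s n x\<bar>) \<longlonglongrightarrow> 0"
    proof (intro AE_I2 tendsto_rabs_zero)
      show "(\<lambda>n. f x - s n x) \<longlonglongrightarrow> 0" for x
        using tendsto_diff[OF tendsto_const lim, of "f x" x] by simp
    qed
    show "AE x in M. norm \<bar>f x - s n x\<bar> \<le> \<bar>f x\<bar> + w x" for n
      using dom[of n] by (intro AE_I2) (smt (verit) real_norm_def)
  qed (use i w in auto)
  then obtain n where n: "(\<integral>x. \<bar>f x - s n x\<bar> \<partial>M) < \<epsilon> / 2"
    using order_tendstoD(2)[of _ "0::real" sequentially "\<epsilon> / 2"] e
    by (auto simp: eventually_sequentially)
  obtain a L b where a: "L-lipschitz_on UNIV a" "\<And>x. \<bar>a x\<bar> \<le> b" "(\<integral>x. \<bar>s n x - a x\<bar> \<partial>M) < \<epsilon>/2"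
    using s[of n] e unfolding lipschitz_approx_def by (metis half_gt_zero)
  have ia: "integrable M a" using lipschitz_bdd_integrable[OF M] a by blast
  have "(\<integral>x. \<bar>f x - a x\<bar> \<partial>M) \<le> (\<integral>x. \<bar>f x - s n x\<bar> + \<bar>s n x - a x\<bar> \<partial>M)"
    using i ia by (intro integral_mono) auto
  also have "\<dots> < \<epsilon>" using i ia a n by (subst Bochner_Integration.integral_add) auto
  finally show "\<exists>a L b. L-lipschitz_on UNIV a \<and> (\<forall>x. \<bar>a x\<bar> \<le> b) \<and> (\<integral>x. \<bar>f x - a x\<bar> \<partial>M) < \<epsilon>"
    using a by blast
qed

lemma lipschitz_approx_self:
  "L-lipschitz_on UNIV f \<Longrightarrow> (\<And>x. \<bar>f x\<bar> \<le> b) \<Longrightarrow> lipschitz_approx M f"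
  unfolding lipschitz_approx_def
  by (intro allI impI exI[of _ f] exI[of _ L] exI[of _ b]) auto

text \<open>The indicator is the limit of the truncated multiples
  \<open>min 1 (k * infdist x (- U))\<close>, which are Lipschitz with constant
  \<open>k\<close>.\<close>

lemma lipschitz_approx_open:
  fixes U :: "'a::metric_space set"
  assumes M: "finite_measure M" "sets M = sets borel" and U: "open U"
  shows "lipschitz_approx M (indicator U)"
\<comment> \<open>The distance to the empty complement is 0 by convention, so the whole space is
  treated apart.\<close>
proof (cases "U = UNIV")
  case True
  then show ?thesis by (intro lipschitz_approx_self[of 0 _ 1]) (auto intro!: lipschitz_onI)
next
  case False
  define a where "a k x = min 1 (real k * infdist x (- U))" for k x
  have a01: "0 \<le> a k x" "a k x \<le> 1" for k x by (auto simp: a_def infdist_nonneg)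
  have lip: "(real k)-lipschitz_on UNIV (a k)" for k
  proof (rule lipschitz_onI)
    fix x y :: 'a
    have "\<bar>real k * infdist x (- U) - real k * infdist y (- U)\<bar> = real k * \<bar>infdist x (- U) - infdist y (- U)\<bar>"
      by (simp add: abs_mult flip: right_diff_distrib)
    also have "\<dots> \<le> real k * dist x y" by (intro mult_left_mono infdist_triangle_abs) auto
    finally show "dist (a k x) (a k y) \<le> real k * dist x y" unfolding a_def dist_real_def by linarith
  qed auto
  show ?thesis
  proof (rule lipschitz_approx_lim[OF M, where s=a and w="\<lambda>_. 1"])
    show "integrable M (indicator U :: 'a \<Rightarrow> real)"
      using U M by (intro integrable_real_indicator) (auto simp: finite_measure.emeasure_finite less_top[symmetric])
    show "integrable M (a k)" for k using a01 by (intro lipschitz_bdd_integrable[OF M lip, of k 1]) auto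
    show "lipschitz_approx M (a k)" for k using a01 by (intro lipschitz_approx_self[OF lip, of k 1]) auto
    show "integrable M (\<lambda>_. 1::real)" using M(1) by (simp add: finite_measure.integrable_const)
    show "\<bar>a k x\<bar> \<le> 1" for k x using a01[of k x] by simp
    show "(\<lambda>k. a k x) \<longlonglongrightarrow> indicator U x" for x
    proof (cases "x \<in> U")
      case True
      have "infdist x (- U) \<noteq> 0"
        using in_closed_iff_infdist_zero[of "- U" x] U False True by auto
      then have p: "infdist x (- U) > 0" using infdist_nonneg[of x "- U"] by linarith
      obtain k0 :: nat where k0: "1 / infdist x (- U) < real k0" using reals_Archimedean2 by blast
      have "a k x = 1" if "k \<ge> k0" for k
      proof -
        have "1 < real k0 * infdist x (- U)" using k0 p by (simp add: field_simps)
        also have "\<dots> \<le> real k * infdist x (- U)" using that p by (intro mult_right_mono) auto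
        finally show ?thesis by (simp add: a_def)
      qed
      then have "eventually (\<lambda>k. a k x = 1) sequentially" by (auto simp: eventually_sequentially)
      then show ?thesis using True by (simp add: tendsto_eventually)
    next
      case False
      then have "infdist x (- U) = 0" by (intro infdist_zero) auto
      then show ?thesis using False by (simp add: a_def)
    qed
  qed
qed

text \<open>Open sets form a generator closed under intersection, and approximability survives
  complements and countable disjoint unions, so Dynkin's argument reaches every Borel set.\<close>

lemma lipschitz_approx_set:
  fixes A :: "'a::metric_space set"
  assumes M: "finite_measure M" "sets M = sets borel" and A: "A \<in> sets borel"
  shows "lipschitz_approx M (indicator A)"
proof -
  have Int: "Int_stable {S :: 'a set. open S}" by (auto simp: Int_stable_def)
  have int: "integrable M (indicator A :: 'a \<Rightarrow> real)" if "A \<in> sets borel" for A :: "'a set"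
    using that M by (intro integrable_real_indicator) (auto simp: finite_measure.emeasure_finite less_top[symmetric])
  have sub: "{S :: 'a set. open S} \<subseteq> Pow UNIV" by simp
  have "A \<in> sigma_sets UNIV {S. open S}" using A by (simp add: borel_def)
  from Int sub this show ?thesis
  proof (induction rule: sigma_sets_induct_disjoint)
    case (basic A) then show ?case using lipschitz_approx_open[OF M] by simp
  next
    case empty show ?case by (rule lipschitz_approx_open[OF M]) simp
  next
    case (compl A)
    then have A: "A \<in> sets borel" by (simp add: borel_def)
    have "lipschitz_approx M (\<lambda>x. indicator UNIV x + (-1) * indicator A x)"
      using int[OF A] int[of UNIV] M compl lipschitz_approx_open[OF M, of UNIV]
      by (intro lipschitz_approx_add lipschitz_approx_cmult) auto
    also have "(\<lambda>x. indicator UNIV x + (-1) * indicator A x) = (indicator (UNIV - A) :: 'a \<Rightarrow> real)"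
      by (auto simp: indicator_def fun_eq_iff)
    finally show ?case .
  next
    case (union A)
    have A: "A i \<in> sets borel" for i using union by (auto simp: borel_def)
    have fin: "lipschitz_approx M (\<lambda>x. \<Sum>i<n. indicator (A i) x)" for n
    proof (induction n)
      case 0 show ?case using lipschitz_approx_self[of 0 "\<lambda>_. 0" 0 M] by (simp add: lipschitz_onI)
    next
      case (Suc n)
      then show ?case using int[OF A] union M by (simp, intro lipschitz_approx_add) auto
    qed
    have sums: "(\<lambda>n. \<Sum>i<n. indicator (A i) x) \<longlonglongrightarrow> (indicator (\<Union>i. A i) x :: real)" for x
      using indicator_sums[of A x] union(1) by (auto simp: sums_def disjoint_family_on_def)
    have le: "(\<Sum>i<n. indicator (A i) x) \<le> (1::real)" for n x
      using union(1) by (subst indicator_UN_disjoint[symmetric]) (auto simp: disjoint_family_on_def)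
    show ?case
      by (rule lipschitz_approx_lim[OF M, where s="\<lambda>n x. \<Sum>i<n. indicator (A i) x" and w="\<lambda>_. 1"])
         (use int A fin sums le M in \<open>auto simp: sum_nonneg finite_measure.integrable_const\<close>)
  qed
qed

text \<open>Supplies the regular starting points of the iteration towards the invariant
  density.\<close>

lemma lipschitz_approx_integrable:
  fixes f :: "'a::metric_space \<Rightarrow> real"
  assumes M: "finite_measure M" "sets M = sets borel" and f: "integrable M f"
  shows "lipschitz_approx M f"
  using f
proof (induction rule: integrable_induct)
  case (base A c)
  have "lipschitz_approx M (\<lambda>x. c * indicator A x)"
    using base M by (intro lipschitz_approx_cmult lipschitz_approx_set) auto
  then show ?case by (simp add: mult.commute)
next
  case (add f g)
  then show ?case by (intro lipschitz_approx_add M)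
next
  case (lim f s)
  have sp: "space M = UNIV" using sets_eq_imp_space_eq[OF M(2)] by simp
  show ?case
    by (rule lipschitz_approx_lim[OF M, where s=s and w="\<lambda>x. 2 * \<bar>f x\<bar>"])
       (use lim sp in auto)
qed

context gibbs_markov
begin

section \<open>Contraction of the transfer operator on the cones\<close>

lemma reg_mono:
  assumes "reg R g" "R \<le> R'" "\<And>x. 0 \<le> g x"
  shows "reg R' g"
proof -
  have "g y \<le> exp (R' * e y y') * g y'" if "g y \<le> exp (R * e y y') * g y'" for y y'
  proof -
    have "exp (R * e y y') * g y' \<le> exp (R' * e y y') * g y'"
      using assms e_nonneg by (intro mult_right_mono) (auto intro!: mult_right_mono)
    with that show ?thesis by linarith
  qed
  then show ?thesis using assms(1) unfolding reg_def by blast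
qed

lemma tr_integral:
  assumes "tr g g'" shows "(\<integral>y. g y \<partial>m) = (\<integral>y. g' y \<partial>m)"
  using assms[unfolded tr_def, rule_format, of "\<lambda>_. 1" 1] by simp

text \<open>Test the duality with the sign of \<open>g' - k'\<close>.\<close>

lemma tr_L1_contraction:
  assumes t: "tr g g'" "tr k k'" and i: "integrable m g" "integrable m g'" "integrable m k" "integrable m k'"
  shows "(\<integral>y. \<bar>g' y - k' y\<bar> \<partial>m) \<le> (\<integral>y. \<bar>g y - k y\<bar> \<partial>m)"
proof -
  have [measurable]: "g' \<in> borel_measurable borel" "k' \<in> borel_measurable borel"
    using borel_measurable_integrable[OF i(2)] borel_measurable_integrable[OF i(4)] by auto
  define u where "u y = sgn (g' y - k' y)" for y
  have u [measurable]: "u \<in> borel_measurable borel" unfolding u_def by measurable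
  have ub: "\<bar>u y\<bar> \<le> 1" for y by (simp add: u_def sgn_if)
  have I: "integrable m (\<lambda>y. u y * g' y)" "integrable m (\<lambda>y. u y * k' y)"
    "integrable m (\<lambda>y. u (F y) * g y)" "integrable m (\<lambda>y. u (F y) * k y)"
    using ub i by (auto intro!: integrable_bdd_mult[where b=1])
  have "(\<integral>y. \<bar>g' y - k' y\<bar> \<partial>m) = (\<integral>y. u y * g' y - u y * k' y \<partial>m)"
    by (rule Bochner_Integration.integral_cong) (auto simp: u_def abs_sgn algebra_simps)
  also have "\<dots> = (\<integral>y. u (F y) * g y \<partial>m) - (\<integral>y. u (F y) * k y \<partial>m)"
    using t[unfolded tr_def, rule_format, OF u ub] I by simp
  also have "\<dots> = (\<integral>y. u (F y) * (g y - k y) \<partial>m)" using I by (simp add: right_diff_distrib)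
  also have "\<dots> \<le> (\<integral>y. \<bar>g y - k y\<bar> \<partial>m)"
  proof (rule integral_mono)
    show "integrable m (\<lambda>y. u (F y) * (g y - k y))" using I by (simp add: right_diff_distrib)
    show "u (F y) * (g y - k y) \<le> \<bar>g y - k y\<bar>" for y
    proof -
      have "u (F y) * (g y - k y) \<le> \<bar>u (F y)\<bar> * \<bar>g y - k y\<bar>" by (metis abs_ge_self abs_mult)
      also have "\<dots> \<le> 1 * \<bar>g y - k y\<bar>" using ub by (intro mult_right_mono) auto
      finally show ?thesis by simp
    qed
  qed (use i in auto)
  finally show ?thesis .
qed

text \<open>The lower bound \<open>\<delta>\<close> turns an additive Lipschitz bound into a
  multiplicative one, via \<open>1 + x \<le> exp x\<close>.\<close>

lemma lipschitz_reg:
  assumes L: "L-lipschitz_on UNIV a" and \<delta>: "\<delta> > 0" and a: "\<And>x. \<delta> \<le> a x"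
  shows "reg (L * D / \<delta>) a"
proof -
  have L0: "0 \<le> L" using L by (rule lipschitz_on_nonneg)
  have "a y \<le> exp (L * D / \<delta> * e y y') * a y'" for y y'
  proof -
    have "a y - a y' \<le> L * dist y y'" using lipschitz_onD[OF L, of y y'] by (simp add: dist_real_def)
    also have "\<dots> \<le> L * (D * e y y')" using dist_le_e L0 by (intro mult_left_mono) auto
    also have "\<dots> = (L * D / \<delta> * e y y') * \<delta>" using \<delta> by simp
    also have "\<dots> \<le> (L * D / \<delta> * e y y') * a y'"
      using a L0 D e_nonneg \<delta> by (intro mult_left_mono) auto
    finally have "a y \<le> (1 + L * D / \<delta> * e y y') * a y'" by (simp add: algebra_simps)
    also have "\<dots> \<le> exp (L * D / \<delta> * e y y') * a y'"
      using a[of y'] \<delta> by (intro mult_right_mono exp_ge_add_one_self) auto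
    finally show ?thesis .
  qed
  then show ?thesis unfolding reg_def by (intro bexI[of _ "{}"]) auto
qed

text \<open>As \<open>e\<close> is at most 1, any two values differ by a factor of at most
  \<open>exp R\<close>; averaging one of the two points over \<open>m\<close> compares each value
  with the mean.\<close>

lemma reg_bounds:
  assumes g: "dens g" and R: "reg R g" "R \<ge> 0"
  shows "AE y in m. g y \<le> exp R * (\<integral>y. g y \<partial>m) / m1 \<and> (\<integral>y. g y \<partial>m) / m1 \<le> exp R * g y"
proof -
  have g0: "0 \<le> g x" and gi: "integrable m g" for x using g by (auto simp: dens_def)
  obtain Z where Z: "Z \<in> null_sets m" and gR: "\<And>y y'. y \<in> Y - Z \<Longrightarrow> y' \<in> Y - Z \<Longrightarrow> g y \<le> exp (R * e y y') * g y'"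
    using R unfolding reg_def by blast
  have gR': "g y \<le> exp R * g y'" if "y \<in> Y - Z" "y' \<in> Y - Z" for y y'
  proof -
    have "R * e y y' \<le> R" using R(2) e_le_1[of y y'] by (simp add: mult_left_le)
    then have "exp (R * e y y') * g y' \<le> exp R * g y'" using g0 by (intro mult_right_mono) auto
    then show ?thesis using gR[OF that] by linarith
  qed
  have AEZ: "AE y in m. y \<in> Y - Z" using AE_m_Y AE_not_in[OF Z] by eventually_elim auto
  then show ?thesis
  proof eventually_elim
    case (elim y)
    have "(\<integral>x. g y \<partial>m) \<le> (\<integral>x. exp R * g x \<partial>m)"
      using AEZ gi gR'[OF elim] by (intro integral_mono_AE) auto
    then have 1: "g y * m1 \<le> exp R * (\<integral>x. g x \<partial>m)" by (simp add: m1_def ac_simps)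
    have "(\<integral>x. g x \<partial>m) \<le> (\<integral>x. exp R * g y \<partial>m)"
      using AEZ gi gR'[OF _ elim] by (intro integral_mono_AE) auto
    then have 2: "(\<integral>x. g x \<partial>m) \<le> exp R * g y * m1" by (simp add: m1_def ac_simps)
    show ?case using 1 2 m1_pos by (simp add: field_simps)
  qed
qed

text \<open>Lets a constant be removed from a function in the cone of \<open>R1\<close> without
  leaving the larger cone of \<open>R\<close>. What is needed is \<open>\<kappa> * (exp (R * t) - 1)
  \<le> (exp (R * t) - exp (R1 * t)) * x'\<close>, uniformly in the distance \<open>t\<close>. The
  first difference is at most \<open>R * exp R * t\<close>, the second at least
  \<open>(R - R1) * t\<close>, and the quotient of these slopes is the bound imposed on
  \<open>\<kappa>\<close>.\<close>

lemma exp_subtract: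
  fixes x x' t R R1 \<kappa> :: real
  assumes x: "x \<le> exp (R1 * t) * x'" "0 \<le> x'" and t: "0 \<le> t" "t \<le> 1" and R: "0 \<le> R1" "R1 < R"
    and k: "0 \<le> \<kappa>" "\<kappa> \<le> (R - R1) / (R * exp R) * x'"
  shows "x - \<kappa> \<le> exp (R * t) * (x' - \<kappa>)"
proof -
  define q where "q = (R - R1) / (R * exp R)"
  have q0: "0 \<le> q" using R by (simp add: q_def)
  have "exp (R * t) = exp (R1 * t) * exp ((R - R1) * t)" by (simp add: algebra_simps flip: exp_add)
  moreover have "exp ((R - R1) * t) \<ge> 1 + (R - R1) * t" by (rule exp_ge_add_one_self)
  moreover have e1: "exp (R1 * t) \<ge> 1" using R t by simp
  ultimately have "exp (R * t) \<ge> exp (R1 * t) * (1 + (R - R1) * t)" by simp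
  moreover have "exp (R1 * t) * ((R - R1) * t) \<ge> 1 * ((R - R1) * t)"
    using e1 R t by (intro mult_right_mono) auto
  ultimately have a: "exp (R * t) - exp (R1 * t) \<ge> (R - R1) * t" by (simp add: algebra_simps)
  have "1 + (- (R * t)) \<le> exp (- (R * t))" by (rule exp_ge_add_one_self)
  then have "exp (R * t) * (1 - R * t) \<le> exp (R * t) * exp (- (R * t))" by (intro mult_left_mono) auto
  then have "exp (R * t) - 1 \<le> R * t * exp (R * t)" by (simp add: algebra_simps exp_minus_inverse)
  also have "\<dots> \<le> R * t * exp R" using R t by (intro mult_left_mono) (auto simp: mult_left_le)
  finally have b: "exp (R * t) - 1 \<le> R * t * exp R" .
  have "q * (exp (R * t) - 1) \<le> q * (R * t * exp R)" using q0 b by (rule mult_left_mono[rotated])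
  also have "\<dots> = (R - R1) * t" using R by (simp add: q_def)
  finally have c: "q * (exp (R * t) - 1) \<le> exp (R * t) - exp (R1 * t)" using a by linarith
  have "\<kappa> * (exp (R * t) - 1) \<le> (q * x') * (exp (R * t) - 1)"
    using k R t by (intro mult_right_mono) (auto simp: q_def)
  also have "\<dots> = (q * (exp (R * t) - 1)) * x'" by simp
  also have "\<dots> \<le> (exp (R * t) - exp (R1 * t)) * x'" using c x by (intro mult_right_mono)
  finally show ?thesis using x by (simp add: algebra_simps)
qed

text \<open>The fraction of a density that one step of the transfer operator moves into the constants.\<close>

definition gap :: "real \<Rightarrow> real" where
  "gap R = (R - (K0 + \<theta> * R)) / (R * exp R) * exp (- R)"

lemma gap_bounds:
  assumes "K0 + \<theta> * R < R" shows "0 < gap R" "gap R < 1" "R > 0"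
proof -
  have "(1 - \<theta>) * R > K0" using assms by (simp add: algebra_simps)
  then have "(1 - \<theta>) * R > 0" using K0_nonneg by linarith
  then show R: "R > 0" using constants by (simp add: zero_less_mult_iff)
  then show "0 < gap R" using assms by (auto simp: gap_def)
  have "(R - (K0 + \<theta> * R)) / (R * exp R) < 1"
  proof -
    have "R - (K0 + \<theta> * R) < R"
      using K0_nonneg constants R by (smt (verit) mult_pos_pos)
    also have "R \<le> R * exp R" using R by simp
    finally show ?thesis using R by simp
  qed
  then show "gap R < 1" unfolding gap_def using R
    by (smt (verit) exp_gt_zero exp_less_one_iff mult_less_cancel_right2 mult_le_cancel_right2 \<open>0 < gap R\<close> gap_def)
qed

text \<open>One step puts the density into the cone of \<open>K0 + \<theta> * R\<close>, strictly
  inside that of \<open>R\<close>, so \<open>exp_subtract\<close> allows a constant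
  \<open>\<kappa>\<close> to be split off. The factor \<open>exp (- R)\<close> of
  \<open>gap R\<close> is the lower bound of \<open>g'\<close> relative to its mean; the other
  factor is the slope quotient of \<open>exp_subtract\<close>.\<close>

lemma reduce_density:
  assumes gap: "K0 + \<theta> * R < R" and g: "dens g" "reg R g"
  defines "I \<equiv> (\<integral>y. g y \<partial>m)"
  shows "\<exists>g' g''. dens g' \<and> tr g g' \<and> dens g'' \<and> reg R g'' \<and> (\<integral>y. g'' y \<partial>m) = (1 - gap R) * I
     \<and> (AE y in m. g' y = g'' y + gap R * I / m1)"
proof -
  define R1 where "R1 = K0 + \<theta> * R"
  define \<kappa> where "\<kappa> = gap R * I / m1"
  note G = gap_bounds[OF gap]
  have R1: "0 \<le> R1" "R1 < R" using gap G(3) K0_nonneg constants by (auto simp: R1_def)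
  obtain g' where g': "dens g'" "reg R1 g'" "tr g g'"
    using transfer_exists[OF g(1) reg_imp_breg[OF g(2)]] by (auto simp: R1_def)
  have g'0: "0 \<le> g' x" and g'i: "integrable m g'" for x using g'(1) by (auto simp: dens_def)
  have I': "(\<integral>y. g' y \<partial>m) = I" using tr_integral[OF g'(3)] by (simp add: I_def)
  have I0: "0 \<le> I" unfolding I'[symmetric] using g'0 by simp
  have k0: "0 \<le> \<kappa>" using I0 G m1_pos by (simp add: \<kappa>_def)
  obtain Z where Z: "Z \<in> null_sets m"
    and gR: "\<And>y y'. y \<in> Y - Z \<Longrightarrow> y' \<in> Y - Z \<Longrightarrow> g' y \<le> exp (R1 * e y y') * g' y'"
    using g'(2) unfolding reg_def by blast
  have AEk: "AE y in m. \<kappa> \<le> (R - R1) / (R * exp R) * g' y"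
    using reg_bounds[OF g'(1,2) R1(1)]
  proof eventually_elim
    case (elim y)
    have "I / m1 \<le> exp R1 * g' y" using elim by (simp add: I')
    also have "\<dots> \<le> exp R * g' y" using R1 g'0 by (intro mult_right_mono) auto
    finally have "exp (- R) * (I / m1) \<le> exp (-R) * (exp R * g' y)" by (intro mult_left_mono) auto
    also have "\<dots> = g' y" by (simp flip: mult.assoc exp_add)
    finally have "exp (- R) * (I / m1) \<le> g' y" .
    then have "(R - R1) / (R * exp R) * (exp (- R) * (I / m1)) \<le> (R - R1) / (R * exp R) * g' y"
      using R1 G by (intro mult_left_mono) auto
    then show ?case by (simp add: \<kappa>_def gap_def R1_def)
  qed
  then obtain Z' where Z': "Z' \<in> null_sets m" and kg: "\<And>y. y \<notin> Z' \<Longrightarrow> \<kappa> \<le> (R - R1) / (R * exp R) * g' y"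
    by (rule AE_E3) auto
  have "R - R1 \<le> R * exp R" using R1 G(3) by (smt (verit) exp_gt_one mult_le_cancel_left1)
  then have q1: "(R - R1) / (R * exp R) \<le> 1" using G(3) by simp
  have kg1: "\<kappa> \<le> g' y" if "y \<notin> Z'" for y
    using kg[OF that] mult_right_mono[OF q1 g'0[of y]] by linarith
  \<comment> \<open>The truncation gives nonnegativity at every point, as \<open>dens\<close>
    demands; it is inactive off the null set \<open>Z'\<close>.\<close>
  define g'' where "g'' y = max 0 (g' y - \<kappa>)" for y
  have g''i: "integrable m g''" unfolding g''_def using g'i by auto
  have eq: "g'' y = g' y - \<kappa>" if "y \<notin> Z'" for y using kg1[OF that] by (simp add: g''_def)
  have AEeq: "AE y in m. g' y = g'' y + \<kappa>" using AE_not_in[OF Z'] by eventually_elim (simp add: eq)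
  have "(\<integral>y. g'' y \<partial>m) = (\<integral>y. g' y - \<kappa> \<partial>m)"
    using AEeq g''i g'i by (intro integral_cong_AE) (auto simp: borel_measurable_integrable)
  also have "\<dots> = I - \<kappa> * m1" using g'i I' by (simp add: m1_def)
  also have "\<dots> = (1 - gap R) * I" using m1_pos by (simp add: \<kappa>_def algebra_simps)
  finally have int: "(\<integral>y. g'' y \<partial>m) = (1 - gap R) * I" .
  have "reg R g''"
    unfolding reg_def
  proof (intro bexI[of _ "Z \<union> Z'"] ballI)
    fix y y' assume y: "y \<in> Y - (Z \<union> Z')" "y' \<in> Y - (Z \<union> Z')"
    have "g' y - \<kappa> \<le> exp (R * e y y') * (g' y' - \<kappa>)"
      using y gR[of y y'] kg[of y'] k0 R1 e_nonneg e_le_1 g'0 by (intro exp_subtract[where ?R1.0=R1]) auto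
    then show "g'' y \<le> exp (R * e y y') * g'' y'" using eq y by simp
  qed (use Z Z' in auto)
  then show ?thesis using g' g''i int AEeq
    by (intro exI[of _ g'] exI[of _ g'']) (auto simp: dens_def \<kappa>_def g''_def)
qed

lemma funpow_F_meas [measurable]: "(F ^^ n) \<in> borel_measurable borel"
  by (induction n) auto

text \<open>Both densities have the same mass \<open>I\<close>, so \<open>reduce_density\<close>
  removes the same constant from both, and it cancels in the difference. The remainders stay in the
  cone, with mass \<open>(1 - gap R) * I\<close>. Only the base case estimates sizes: there both
  densities lie between 0 and \<open>exp R * I / m1\<close>, which leaves the
  \<open>L\<^sup>1\<close> norm of \<open>u\<close>.\<close>

lemma decay_densities:
  assumes gap: "K0 + \<theta> * R < R" and u [measurable]: "u \<in> borel_measurable borel" and ub: "\<And>x. \<bar>u x\<bar> \<le> b"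
    and "dens g" "reg R g" "dens k" "reg R k" "(\<integral>y. g y \<partial>m) = I" "(\<integral>y. k y \<partial>m) = I"
  shows "\<bar>\<integral>y. u ((F ^^ n) y) * (g y - k y) \<partial>m\<bar> \<le> exp R / m1 * (1 - gap R) ^ n * I * (\<integral>y. \<bar>u y\<bar> \<partial>m)"
  using assms(4-)
proof (induction n arbitrary: g k I)
  case 0
  note G = gap_bounds[OF gap]
  have i: "integrable m g" "integrable m k" using 0 by (auto simp: dens_def)
  have ui: "integrable m (\<lambda>y. \<bar>u y\<bar>)" using ub by (intro finite_m.integrable_const_bound[of _ b]) auto
  have "\<bar>\<integral>y. u y * (g y - k y) \<partial>m\<bar> \<le> (\<integral>y. \<bar>u y * (g y - k y)\<bar> \<partial>m)" by (rule integral_abs_bound)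
  also have "\<dots> \<le> (\<integral>y. exp R / m1 * I * \<bar>u y\<bar> \<partial>m)"
  proof (rule integral_mono_AE)
    show "integrable m (\<lambda>y. \<bar>u y * (g y - k y)\<bar>)"
      using i ub by (intro integrable_abs integrable_bdd_mult[where b=b]) auto
    show "integrable m (\<lambda>y. exp R / m1 * I * \<bar>u y\<bar>)" using ui by simp
    show "AE y in m. \<bar>u y * (g y - k y)\<bar> \<le> exp R / m1 * I * \<bar>u y\<bar>"
      using reg_bounds[OF 0(1,2) less_imp_le[OF G(3)]] reg_bounds[OF 0(3,4) less_imp_le[OF G(3)]]
    proof eventually_elim
      case (elim y)
      have "0 \<le> g y" "0 \<le> k y" using 0 by (auto simp: dens_def)
      then have "\<bar>g y - k y\<bar> \<le> exp R / m1 * I" using elim 0 by auto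
      then have "\<bar>u y\<bar> * \<bar>g y - k y\<bar> \<le> \<bar>u y\<bar> * (exp R / m1 * I)" by (intro mult_left_mono) auto
      then show ?case by (simp add: abs_mult ac_simps)
    qed
  qed
  finally show ?case by simp
next
  case (Suc n)
  obtain g' g'' where g: "dens g'" "tr g g'" "dens g''" "reg R g''" "(\<integral>y. g'' y \<partial>m) = (1 - gap R) * I"
    "AE y in m. g' y = g'' y + gap R * I / m1"
    using reduce_density[OF gap Suc.prems(1,2)] Suc.prems(5) by auto
  obtain k' k'' where k: "dens k'" "tr k k'" "dens k''" "reg R k''" "(\<integral>y. k'' y \<partial>m) = (1 - gap R) * I"
    "AE y in m. k' y = k'' y + gap R * I / m1"
    using reduce_density[OF gap Suc.prems(3,4)] Suc.prems(6) by auto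
  have i: "integrable m g" "integrable m g'" "integrable m g''" "integrable m k" "integrable m k'" "integrable m k''"
    using Suc.prems g k by (auto simp: dens_def)
  have un [measurable]: "(\<lambda>y. u ((F ^^ n) y)) \<in> borel_measurable borel" by measurable
  have J: "integrable m (\<lambda>y. u ((F ^^ n) y) * w y)" "integrable m (\<lambda>y. u ((F ^^ n) (F y)) * w y)"
    if "integrable m w" for w
    using that ub by (auto intro!: integrable_bdd_mult[where b=b])
  have "(\<integral>y. u ((F ^^ Suc n) y) * (g y - k y) \<partial>m)
      = (\<integral>y. u ((F ^^ n) (F y)) * g y \<partial>m) - (\<integral>y. u ((F ^^ n) (F y)) * k y \<partial>m)"
    using J i by (simp add: funpow_Suc_right right_diff_distrib del: funpow.simps)
  also have "\<dots> = (\<integral>y. u ((F ^^ n) y) * g' y \<partial>m) - (\<integral>y. u ((F ^^ n) y) * k' y \<partial>m)"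
    using g(2)[unfolded tr_def, rule_format, OF un, of b] k(2)[unfolded tr_def, rule_format, OF un, of b] ub by simp
  also have "\<dots> = (\<integral>y. u ((F ^^ n) y) * g' y - u ((F ^^ n) y) * k' y \<partial>m)" using J i by simp
  also have "\<dots> = (\<integral>y. u ((F ^^ n) y) * (g'' y - k'' y) \<partial>m)"
  proof (rule integral_cong_AE)
    show "AE y in m. u ((F ^^ n) y) * g' y - u ((F ^^ n) y) * k' y = u ((F ^^ n) y) * (g'' y - k'' y)"
      using g(6) k(6) by eventually_elim (simp add: algebra_simps)
  qed (use J i in \<open>auto simp: right_diff_distrib\<close>)
  also have "\<bar>\<dots>\<bar> \<le> exp R / m1 * (1 - gap R) ^ n * ((1 - gap R) * I) * (\<integral>y. \<bar>u y\<bar> \<partial>m)"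
    using g k by (intro Suc.IH)
  finally show ?case by (simp add: ac_simps)
qed

end

section \<open>Decay of correlations\<close>

locale gibbs_markov_inv = gibbs_markov +
  fixes \<mu>Y :: "'a measure"
  assumes muY_prob: "prob_space \<mu>Y"
    and muY_sets [measurable_cong]: "sets \<mu>Y = sets borel"
    and muY_on_Y: "emeasure \<mu>Y (UNIV - Y) = 0"
    and muY_ac: "absolutely_continuous \<mu>0 \<mu>Y"
    and muY_inv: "\<And>A. A \<in> sets borel \<Longrightarrow> emeasure \<mu>Y (F -` A \<inter> Y) = emeasure \<mu>Y A"
begin

sublocale Y: prob_space \<mu>Y by (rule muY_prob)

lemma space_muY [simp]: "space \<mu>Y = UNIV"
  using sets_eq_imp_space_eq[OF muY_sets] by simp

lemma AE_Y: "AE y in \<mu>Y. y \<in> Y"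
  using muY_on_Y muY_sets by (intro AE_I[of _ _ "UNIV - Y"]) auto

lemma distr_F: "distr \<mu>Y borel F = \<mu>Y"
proof (rule measure_eqI)
  fix A assume "A \<in> sets (distr \<mu>Y borel F)"
  then have A [measurable]: "A \<in> sets borel" by simp
  have "emeasure (distr \<mu>Y borel F) A = emeasure \<mu>Y (F -` A)"
    by (subst emeasure_distr) auto
  also have "\<dots> = emeasure \<mu>Y (F -` A \<inter> Y)"
    using AE_Y measurable_sets_borel[OF F_meas A] muY_sets by (intro emeasure_eq_AE) auto
  finally show "emeasure (distr \<mu>Y borel F) A = emeasure \<mu>Y A" using muY_inv by simp
qed (simp add: muY_sets)

lemma integral_F:
  fixes u :: "'a \<Rightarrow> real" assumes [measurable]: "u \<in> borel_measurable borel"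
  shows "(\<integral>y. u (F y) \<partial>\<mu>Y) = (\<integral>y. u y \<partial>\<mu>Y)"
  using integral_distr[of F \<mu>Y borel u] distr_F by simp

lemma integral_F_pow:
  fixes u :: "'a \<Rightarrow> real" assumes [measurable]: "u \<in> borel_measurable borel"
  shows "(\<integral>y. u ((F ^^ n) y) \<partial>\<mu>Y) = (\<integral>y. u y \<partial>\<mu>Y)"
proof (induction n)
  case (Suc n)
  have "(\<integral>y. u ((F ^^ n) (F y)) \<partial>\<mu>Y) = (\<integral>y. u ((F ^^ n) y) \<partial>\<mu>Y)" by (rule integral_F) measurable
  then show ?case using Suc by (simp add: funpow_Suc_right del: funpow.simps)
qed simp

section \<open>Existence and regularity of the invariant density\<close>

lemma density_exists:
  "\<exists>\<rho>. (\<forall>x. 0 \<le> \<rho> x) \<and> \<rho> \<in> borel_measurable borel \<and> \<mu>Y = density m (\<lambda>x. ennreal (\<rho> x))"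
proof -
  have ac: "absolutely_continuous m \<mu>Y"
    unfolding absolutely_continuous_def
  proof
    fix A assume "A \<in> null_sets m"
    then have A: "A \<in> sets borel" "emeasure m A = 0" by auto
    then have "A \<inter> Y \<in> null_sets \<mu>0" using emeasure_m[OF A(1)] mu0_sets by (intro null_setsI) auto
    then have "A \<inter> Y \<in> null_sets \<mu>Y"
      using muY_ac unfolding absolutely_continuous_def by blast
    moreover have "UNIV - Y \<in> null_sets \<mu>Y" using muY_on_Y muY_sets by (intro null_setsI) auto
    then have "A - Y \<in> null_sets \<mu>Y" by (rule null_sets_subset[where B="UNIV - Y"]) (use A muY_sets in auto)
    ultimately have "(A \<inter> Y) \<union> (A - Y) \<in> null_sets \<mu>Y" by (rule null_sets.Un)
    then show "A \<in> null_sets \<mu>Y" by (simp add: Int_Diff_Un)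
  qed
  obtain D where D: "D \<in> borel_measurable m" "AE x in m. RN_deriv m \<mu>Y x = ennreal (D x)" "\<And>x. 0 \<le> D x"
    using finite_m.real_RN_deriv[OF Y.finite_measure_axioms ac] muY_sets by (metis sets_m)
  have "\<mu>Y = density m (RN_deriv m \<mu>Y)"
    using finite_m.density_RN_deriv[OF ac] muY_sets by simp
  also have "\<dots> = density m (\<lambda>x. ennreal (D x))" using D by (intro density_cong) auto
  finally have eq: "\<mu>Y = density m (\<lambda>x. ennreal (D x))" .
  show ?thesis using D by (intro exI[of _ D] conjI allI eq) auto
qed

definition \<rho> :: "'a \<Rightarrow> real" where
  "\<rho> = (SOME \<rho>. (\<forall>x. 0 \<le> \<rho> x) \<and> \<rho> \<in> borel_measurable borel \<and> \<mu>Y = density m (\<lambda>x. ennreal (\<rho> x)))"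

lemma rho: "0 \<le> \<rho> x" "\<rho> \<in> borel_measurable borel" "\<mu>Y = density m (\<lambda>x. ennreal (\<rho> x))"
  using someI_ex[OF density_exists] unfolding \<rho>_def by auto

declare rho(2) [measurable]

lemma integral_muY:
  fixes u :: "'a \<Rightarrow> real" assumes [measurable]: "u \<in> borel_measurable borel"
  shows "(\<integral>y. u y \<partial>\<mu>Y) = (\<integral>y. u y * \<rho> y \<partial>m)"
    and "integrable \<mu>Y u \<longleftrightarrow> integrable m (\<lambda>y. u y * \<rho> y)"
proof -
  show "(\<integral>y. u y \<partial>\<mu>Y) = (\<integral>y. u y * \<rho> y \<partial>m)"
    by (subst rho(3), subst integral_real_density) (auto simp: mult.commute rho(1))
  show "integrable \<mu>Y u \<longleftrightarrow> integrable m (\<lambda>y. u y * \<rho> y)"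
    by (subst rho(3), subst integrable_real_density) (auto simp: mult.commute rho(1))
qed

lemma dens_rho: "dens \<rho>"
  using rho integral_muY(2)[of "\<lambda>_. 1"] by (auto simp: dens_def)

lemma integral_rho: "(\<integral>y. \<rho> y \<partial>m) = 1"
  using integral_muY(1)[of "\<lambda>_. 1"] Y.prob_space by simp

lemma tr_rho: "tr \<rho> \<rho>"
  unfolding tr_def
proof (intro ballI allI impI)
  fix u :: "'a \<Rightarrow> real" and b assume [measurable]: "u \<in> borel_measurable borel"
  show "(\<integral>y. u (F y) * \<rho> y \<partial>m) = (\<integral>y. u y * \<rho> y \<partial>m)"
    using integral_F[of u] integral_muY(1)[of u] integral_muY(1)[of "\<lambda>y. u (F y)"] by simp
qed

text \<open>\<open>K0 / (1 - \<theta>)\<close> is the fixed point of the map sending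
  \<open>R\<close> to \<open>K0 + \<theta> * R\<close>, the effect of one transfer step on
  regularity; the added 1 leaves room for the transient \<open>\<theta> ^ n * R\<close>.\<close>

definition Rh :: real where "Rh = K0 / (1 - \<theta>) + 1"

lemma Rh_nonneg: "Rh \<ge> 0"
  using K0_nonneg constants by (simp add: Rh_def)

lemma iterate_towards_rho:
  assumes a: "dens a" "reg R a" "0 \<le> R"
  shows "\<exists>b. dens b \<and> reg (K0 / (1 - \<theta>) + \<theta> ^ n * R) b \<and> (\<integral>y. \<bar>\<rho> y - b y\<bar> \<partial>m) \<le> (\<integral>y. \<bar>\<rho> y - a y\<bar> \<partial>m)"
proof (induction n)
  case 0
  have "reg (K0 / (1 - \<theta>) + R) a" using a K0_nonneg constants by (intro reg_mono[OF a(2)]) (auto simp: dens_def)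
  then show ?case using a by auto
next
  case (Suc n)
  then obtain b where b: "dens b" "reg (K0 / (1 - \<theta>) + \<theta> ^ n * R) b"
    "(\<integral>y. \<bar>\<rho> y - b y\<bar> \<partial>m) \<le> (\<integral>y. \<bar>\<rho> y - a y\<bar> \<partial>m)" by auto
  obtain b' where b': "dens b'" "reg (K0 + \<theta> * (K0 / (1 - \<theta>) + \<theta> ^ n * R)) b'" "tr b b'"
    using transfer_exists[OF b(1) reg_imp_breg[OF b(2)]] by auto
  have "K0 + \<theta> * (K0 / (1 - \<theta>) + \<theta> ^ n * R) = K0 / (1 - \<theta>) + \<theta> ^ Suc n * R"
    using constants by (simp add: field_simps)
  moreover have "(\<integral>y. \<bar>\<rho> y - b' y\<bar> \<partial>m) \<le> (\<integral>y. \<bar>\<rho> y - b y\<bar> \<partial>m)"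
    using b(1) b'(1) dens_rho by (intro tr_L1_contraction[OF tr_rho b'(3)]) (auto simp: dens_def)
  ultimately show ?case using b b' by (intro exI[of _ b']) auto
qed

text \<open>Since \<open>\<rho>\<close> is fixed by the transfer operator, an \<open>L\<^sup>1\<close>-contraction, pushing a Lipschitz
  approximation forward keeps it close to \<open>\<rho>\<close> while making its regularity constant uniform.\<close>

lemma rho_approx:
  assumes "\<epsilon> > 0"
  shows "\<exists>b. dens b \<and> reg Rh b \<and> (\<integral>y. \<bar>\<rho> y - b y\<bar> \<partial>m) < \<epsilon>"
proof -
  have ri: "integrable m \<rho>" using dens_rho by (simp add: dens_def)
  have "lipschitz_approx m \<rho>"
    using ri by (intro lipschitz_approx_integrable) (auto intro: finite_m.finite_measure_axioms)
  then obtain a L b where a: "L-lipschitz_on UNIV a" "\<And>x. \<bar>a x\<bar> \<le> b" "(\<integral>x. \<bar>\<rho> x - a x\<bar> \<partial>m) < \<epsilon>/2"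
    unfolding lipschitz_approx_def using assms by (meson half_gt_zero)
  \<comment> \<open>Raising the approximant by \<open>\<delta>\<close> bounds it below, as
    \<open>lipschitz_reg\<close> needs, at an \<open>L\<^sup>1\<close> cost of
    \<open>\<epsilon> / 2\<close>.\<close>
  define \<delta> where "\<delta> = \<epsilon> / (2 * m1)"
  have \<delta>: "\<delta> > 0" using assms m1_pos by (simp add: \<delta>_def)
  define a' where "a' x = max 0 (a x) + \<delta>" for x
  have ai: "integrable m a" using lipschitz_bdd_integrable[OF finite_m.finite_measure_axioms sets_m a(1,2)] .
  have a'i: "integrable m a'" unfolding a'_def using ai by auto
  have L0: "0 \<le> L" using a(1) by (rule lipschitz_on_nonneg)
  have lip: "L-lipschitz_on UNIV a'"
  proof (rule lipschitz_onI[OF _ L0])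
    fix x y show "dist (a' x) (a' y) \<le> L * dist x y"
      using lipschitz_onD[OF a(1), of x y] unfolding a'_def dist_real_def by auto
  qed
  have "reg (L * D / \<delta>) a'" using \<delta> by (intro lipschitz_reg[OF lip]) (auto simp: a'_def)
  moreover have "dens a'" using a'i \<delta> by (auto simp: dens_def a'_def)
  moreover have LD: "0 \<le> L * D / \<delta>" using L0 D \<delta> by simp
  moreover obtain n where n: "\<theta> ^ n * (L * D / \<delta>) \<le> 1"
  proof -
    have "(\<lambda>n. \<theta> ^ n * (L * D / \<delta>)) \<longlonglongrightarrow> 0 * (L * D / \<delta>)"
      using constants by (intro tendsto_intros LIMSEQ_power_zero) auto
    then have "eventually (\<lambda>n. \<theta> ^ n * (L * D / \<delta>) < 1) sequentially"
      by (intro order_tendstoD) auto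
    then show ?thesis using that by (auto simp: eventually_sequentially intro: less_imp_le)
  qed
  ultimately obtain c where c: "dens c" "reg (K0 / (1 - \<theta>) + \<theta> ^ n * (L * D / \<delta>)) c"
    "(\<integral>y. \<bar>\<rho> y - c y\<bar> \<partial>m) \<le> (\<integral>y. \<bar>\<rho> y - a' y\<bar> \<partial>m)"
    using iterate_towards_rho[of a' "L * D / \<delta>" n] by auto
  have "reg Rh c" using c n by (intro reg_mono[OF c(2)]) (auto simp: Rh_def dens_def)
  moreover have "(\<integral>y. \<bar>\<rho> y - a' y\<bar> \<partial>m) \<le> (\<integral>y. \<bar>\<rho> y - a y\<bar> + \<delta> \<partial>m)"
  proof (rule integral_mono)
    show "\<bar>\<rho> y - a' y\<bar> \<le> \<bar>\<rho> y - a y\<bar> + \<delta>" for y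
      using rho(1)[of y] \<delta> unfolding a'_def by linarith
  qed (use ri ai a'i in auto)
  moreover have "(\<integral>y. \<bar>\<rho> y - a y\<bar> + \<delta> \<partial>m) = (\<integral>y. \<bar>\<rho> y - a y\<bar> \<partial>m) + \<epsilon> / 2"
    using ri ai m1_pos by (simp add: \<delta>_def m1_def)
  ultimately show ?thesis using c a(3) by (intro exI[of _ c]) auto
qed

text \<open>Approximants in the fixed cone \<open>Rh\<close> converge to \<open>\<rho>\<close> in
  \<open>L\<^sup>1\<close>, hence almost everywhere along a subsequence, and the defining inequality
  passes to pointwise limits.\<close>

lemma reg_rho: "reg Rh \<rho>"
proof -
  have "\<exists>b. dens b \<and> reg Rh b \<and> (\<integral>y. \<bar>\<rho> y - b y\<bar> \<partial>m) < 1 / real (Suc n)" for n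
    by (rule rho_approx) simp
  then obtain b where b: "\<And>n. dens (b n)" "\<And>n. reg Rh (b n)"
    "\<And>n. (\<integral>y. \<bar>\<rho> y - b n y\<bar> \<partial>m) < 1 / real (Suc n)" by metis
  have "(\<lambda>n. \<integral>y. norm (\<rho> y - b n y) \<partial>m) \<longlonglongrightarrow> 0"
  proof (rule tendsto_sandwich[of "\<lambda>_. 0" _ _ "\<lambda>n. 1 / real (Suc n)"])
    show "(\<lambda>n. 1 / real (Suc n)) \<longlonglongrightarrow> 0" by (rule lim_1_over_n[THEN LIMSEQ_Suc])
    show "\<forall>\<^sub>F n in sequentially. (\<integral>y. norm (\<rho> y - b n y) \<partial>m) \<le> 1 / real (Suc n)"
      using b(3)[THEN less_imp_le] by (auto simp del: of_nat_Suc)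
  qed auto
  moreover have "integrable m (\<lambda>y. \<rho> y - b n y)" for n using b(1)[of n] dens_rho by (auto simp: dens_def)
  ultimately obtain r where r: "strict_mono r" "AE y in m. (\<lambda>n. \<rho> y - b (r n) y) \<longlonglongrightarrow> 0"
    using tendsto_L1_AE_subseq[of m "\<lambda>n y. \<rho> y - b n y"] by auto
  obtain Z0 where Z0: "Z0 \<in> null_sets m" "\<And>y. y \<notin> Z0 \<Longrightarrow> (\<lambda>n. \<rho> y - b (r n) y) \<longlonglongrightarrow> 0"
    using r(2) by (rule AE_E3) auto
  have "\<forall>n. \<exists>Z\<in>null_sets m. \<forall>y\<in>Y - Z. \<forall>y'\<in>Y - Z. b n y \<le> exp (Rh * e y y') * b n y'"
    using b(2) unfolding reg_def by blast
  then obtain Z where Z: "\<And>n. Z n \<in> null_sets m"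
    and ZR: "\<And>n y y'. y \<in> Y - Z n \<Longrightarrow> y' \<in> Y - Z n \<Longrightarrow> b n y \<le> exp (Rh * e y y') * b n y'"
    by metis
  show ?thesis unfolding reg_def
  proof (intro bexI[of _ "Z0 \<union> (\<Union>n. Z n)"] ballI)
    fix y y' assume y: "y \<in> Y - (Z0 \<union> (\<Union>n. Z n))" "y' \<in> Y - (Z0 \<union> (\<Union>n. Z n))"
    have lim: "(\<lambda>n. b (r n) z) \<longlonglongrightarrow> \<rho> z" if "z \<notin> Z0" for z
      using tendsto_diff[OF tendsto_const Z0(2)[OF that], of "\<rho> z"] by simp
    show "\<rho> y \<le> exp (Rh * e y y') * \<rho> y'"
    proof (rule LIMSEQ_le)
      show "(\<lambda>n. b (r n) y) \<longlonglongrightarrow> \<rho> y" using y by (intro lim) auto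
      show "(\<lambda>n. exp (Rh * e y y') * b (r n) y') \<longlonglongrightarrow> exp (Rh * e y y') * \<rho> y'"
        using y by (intro tendsto_mult_left lim) auto
      show "\<exists>N. \<forall>n\<ge>N. b (r n) y \<le> exp (Rh * e y y') * b (r n) y'" using y ZR by auto
    qed
  qed (use Z0 Z in auto)
qed

text \<open>Compare \<open>U * \<rho>\<close> with \<open>I * \<rho>\<close>, where \<open>I\<close>
  is the mean of \<open>U\<close>: they have equal mass, and both are regular inside cells. The
  first application of \<open>F\<close> is spent on making their images regular on all of
  \<open>Y\<close>, hence \<open>Suc n\<close> in the statement; from then on
  \<open>decay_densities\<close> applies.\<close>

theorem decay_of_correlations:
  assumes R0: "R0 \<ge> 0"
  shows "\<exists>C \<gamma>. 0 \<le> C \<and> 0 \<le> \<gamma> \<and> \<gamma> < 1 \<and>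
    (\<forall>U u b n. (\<forall>y. 0 \<le> U y) \<and> U \<in> borel_measurable borel \<and> integrable \<mu>Y U
      \<and> (\<forall>j\<in>P. \<forall>y\<in>j. \<forall>y'\<in>j. U y \<le> exp (R0 * e y y') * U y')
      \<and> u \<in> borel_measurable borel \<and> (\<forall>y. \<bar>u y\<bar> \<le> b) \<longrightarrow>
      \<bar>(\<integral>y. u ((F ^^ Suc n) y) * U y \<partial>\<mu>Y) - (\<integral>y. U y \<partial>\<mu>Y) * (\<integral>y. u y \<partial>\<mu>Y)\<bar>
        \<le> C * \<gamma> ^ n * (\<integral>y. U y \<partial>\<mu>Y) * (\<integral>y. \<bar>u y\<bar> \<partial>\<mu>Y))"
proof -
  \<comment> \<open>The cone must contain the images after the first step and be strictly contracted
    afterwards; this \<open>R\<close> meets both demands.\<close>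
  define R where "R = (K0 + \<theta> * (R0 + Rh) + 1) / (1 - \<theta>)"
  have t: "0 < 1 - \<theta>" "\<theta> > 0" using constants by auto
  have RR: "(1 - \<theta>) * R = K0 + \<theta> * (R0 + Rh) + 1" using t by (simp add: R_def)
  have "0 \<le> \<theta> * (R0 + Rh)" using t R0 Rh_nonneg by simp
  then have gap: "K0 + \<theta> * R < R" using RR by (simp add: algebra_simps)
  note G = gap_bounds[OF gap]
  have "\<theta> * R \<ge> 0" using t G by simp
  then have R1: "K0 + \<theta> * (R0 + Rh) \<le> R" using RR by (simp add: algebra_simps)
  \<comment> \<open>The first factor comes from \<open>decay_densities\<close>; the second bounds
    the inverse of \<open>\<rho>\<close> and converts the integral of \<open>\<bar>u\<bar>\<close>
    from \<open>m\<close> to \<open>\<mu>Y\<close>.\<close>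
  define C where "C = exp R / m1 * (exp Rh * m1)"
  have C0: "0 \<le> C" using m1_pos by (simp add: C_def)
  have main: "\<bar>(\<integral>y. u ((F ^^ Suc n) y) * U y \<partial>\<mu>Y) - (\<integral>y. U y \<partial>\<mu>Y) * (\<integral>y. u y \<partial>\<mu>Y)\<bar>
        \<le> C * (1 - gap R) ^ n * (\<integral>y. U y \<partial>\<mu>Y) * (\<integral>y. \<bar>u y\<bar> \<partial>\<mu>Y)"
    if U0: "\<And>y. 0 \<le> U y" and U [measurable]: "U \<in> borel_measurable borel" and Ui: "integrable \<mu>Y U"
      and UR: "\<And>j y y'. j \<in> P \<Longrightarrow> y \<in> j \<Longrightarrow> y' \<in> j \<Longrightarrow> U y \<le> exp (R0 * e y y') * U y'"
      and u [measurable]: "u \<in> borel_measurable borel" and ub: "\<And>y. \<bar>u y\<bar> \<le> b" for U u b n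
  proof -
    define I where "I = (\<integral>y. U y \<partial>\<mu>Y)"
    have I0: "0 \<le> I" using U0 by (simp add: I_def)
    obtain Z where Z: "Z \<in> null_sets m"
      and ZR: "\<And>y y'. y \<in> Y - Z \<Longrightarrow> y' \<in> Y - Z \<Longrightarrow> \<rho> y \<le> exp (Rh * e y y') * \<rho> y'"
      using reg_rho unfolding reg_def by blast
    have d1: "dens (\<lambda>y. U y * \<rho> y)" using U0 rho Ui integral_muY(2)[OF U] by (simp add: dens_def)
    have b1: "breg (R0 + Rh) (\<lambda>y. U y * \<rho> y)"
      unfolding breg_def
    proof (intro bexI[OF _ Z] ballI)
      fix j y y' assume j: "j \<in> P" "y \<in> j - Z" "y' \<in> j - Z"
      then have "y \<in> Y - Z" "y' \<in> Y - Z" using P_cover by auto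
      then have "U y * \<rho> y \<le> (exp (R0 * e y y') * U y') * (exp (Rh * e y y') * \<rho> y')"
        using UR[of j y y'] j ZR U0 rho by (intro mult_mono) auto
      moreover have "exp ((R0 + Rh) * e y y') = exp (R0 * e y y') * exp (Rh * e y y')"
        by (simp add: distrib_right exp_add)
      ultimately show "U y * \<rho> y \<le> exp ((R0 + Rh) * e y y') * (U y' * \<rho> y')"
        by (simp only: ac_simps)
    qed
    have d2: "dens (\<lambda>y. I * \<rho> y)" using I0 dens_rho by (simp add: dens_def)
    have "reg (R0 + Rh) (\<lambda>y. I * \<rho> y)"
    proof -
      have "reg (R0 + Rh) \<rho>" using R0 rho by (intro reg_mono[OF reg_rho]) auto
      then show ?thesis unfolding reg_def using I0
        by (metis (no_types, lifting) mult.left_commute mult_left_mono)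
    qed
    then have b2: "breg (R0 + Rh) (\<lambda>y. I * \<rho> y)" by (rule reg_imp_breg)
    obtain g where g: "dens g" "reg (K0 + \<theta> * (R0 + Rh)) g" "tr (\<lambda>y. U y * \<rho> y) g"
      using transfer_exists[OF d1 b1] by auto
    obtain k where k: "dens k" "reg (K0 + \<theta> * (R0 + Rh)) k" "tr (\<lambda>y. I * \<rho> y) k"
      using transfer_exists[OF d2 b2] by auto
    have gr: "reg R g" "reg R k" using g k R1 by (auto intro!: reg_mono[of _ _ R] simp: dens_def)
    have gI: "(\<integral>y. g y \<partial>m) = I" "(\<integral>y. k y \<partial>m) = I"
      using tr_integral[OF g(3)] tr_integral[OF k(3)] integral_muY(1)[OF U] integral_rho by (auto simp: I_def)
    have un: "(\<lambda>y. u ((F ^^ n) y)) \<in> borel_measurable borel" by measurable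
    have J: "integrable m (\<lambda>y. u ((F ^^ n) y) * w y)" if "integrable m w" for w
      using that ub by (auto intro!: integrable_bdd_mult[where b=b])
    have "(\<integral>y. u ((F ^^ Suc n) y) * U y \<partial>\<mu>Y) = (\<integral>y. u ((F ^^ n) (F y)) * (U y * \<rho> y) \<partial>m)"
      by (subst integral_muY(1)) (auto simp: funpow_Suc_right ac_simps simp del: funpow.simps)
    also have "\<dots> = (\<integral>y. u ((F ^^ n) y) * g y \<partial>m)"
      using g(3)[unfolded tr_def, rule_format, OF un, of b] ub by simp
    finally have e1: "(\<integral>y. u ((F ^^ Suc n) y) * U y \<partial>\<mu>Y) = (\<integral>y. u ((F ^^ n) y) * g y \<partial>m)" .
    have "I * (\<integral>y. u y \<partial>\<mu>Y) = I * (\<integral>y. u ((F ^^ Suc n) y) \<partial>\<mu>Y)" by (subst integral_F_pow) auto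
    also have "\<dots> = (\<integral>y. u ((F ^^ n) (F y)) * (I * \<rho> y) \<partial>m)"
      by (subst integral_muY(1)) (auto simp: funpow_Suc_right ac_simps simp del: funpow.simps)
    also have "\<dots> = (\<integral>y. u ((F ^^ n) y) * k y \<partial>m)"
      using k(3)[unfolded tr_def, rule_format, OF un, of b] ub by simp
    finally have e2: "I * (\<integral>y. u y \<partial>\<mu>Y) = (\<integral>y. u ((F ^^ n) y) * k y \<partial>m)" .
    have "\<bar>(\<integral>y. u ((F ^^ Suc n) y) * U y \<partial>\<mu>Y) - I * (\<integral>y. u y \<partial>\<mu>Y)\<bar> = \<bar>\<integral>y. u ((F ^^ n) y) * (g y - k y) \<partial>m\<bar>"
      unfolding e1 e2 using J g(1) k(1) by (simp add: right_diff_distrib dens_def)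
    also have "\<dots> \<le> exp R / m1 * (1 - gap R) ^ n * I * (\<integral>y. \<bar>u y\<bar> \<partial>m)"
      using g k gr gI ub by (intro decay_densities[OF gap]) auto
    also have "\<dots> \<le> exp R / m1 * (1 - gap R) ^ n * I * (exp Rh * m1 * (\<integral>y. \<bar>u y\<bar> \<partial>\<mu>Y))"
    proof (intro mult_left_mono)
      have "(\<integral>y. \<bar>u y\<bar> \<partial>m) \<le> (\<integral>y. exp Rh * m1 * (\<bar>u y\<bar> * \<rho> y) \<partial>m)"
      proof (rule integral_mono_AE)
        show "integrable m (\<lambda>y. \<bar>u y\<bar>)" using ub by (intro finite_m.integrable_const_bound[of _ b]) auto
        show "integrable m (\<lambda>y. exp Rh * m1 * (\<bar>u y\<bar> * \<rho> y))"
          using ub dens_rho by (intro integrable_mult_right integrable_bdd_mult[where b=b]) (auto simp: dens_def)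
        show "AE y in m. \<bar>u y\<bar> \<le> exp Rh * m1 * (\<bar>u y\<bar> * \<rho> y)"
          using reg_bounds[OF dens_rho reg_rho Rh_nonneg]
        proof eventually_elim
          case (elim y)
          then have "1 \<le> exp Rh * m1 * \<rho> y" using m1_pos by (simp add: integral_rho field_simps)
          then have "\<bar>u y\<bar> * 1 \<le> \<bar>u y\<bar> * (exp Rh * m1 * \<rho> y)" by (intro mult_left_mono) auto
          then show ?case by (simp add: ac_simps)
        qed
      qed
      also have "\<dots> = exp Rh * m1 * (\<integral>y. \<bar>u y\<bar> \<partial>\<mu>Y)" by (subst integral_muY(1)) auto
      finally show "(\<integral>y. \<bar>u y\<bar> \<partial>m) \<le> exp Rh * m1 * (\<integral>y. \<bar>u y\<bar> \<partial>\<mu>Y)" .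
    qed (use I0 m1_pos G in auto)
    finally show ?thesis by (simp only: C_def I_def ac_simps)
  qed
  show ?thesis
  proof (rule exI[of _ C], rule exI[of _ "1 - gap R"], intro conjI allI impI)
    fix U u :: "'a \<Rightarrow> real" and b n
    assume "(\<forall>y. 0 \<le> U y) \<and> U \<in> borel_measurable borel \<and> integrable \<mu>Y U
      \<and> (\<forall>j\<in>P. \<forall>y\<in>j. \<forall>y'\<in>j. U y \<le> exp (R0 * e y y') * U y')
      \<and> u \<in> borel_measurable borel \<and> (\<forall>y. \<bar>u y\<bar> \<le> b)"
    then show "\<bar>(\<integral>y. u ((F ^^ Suc n) y) * U y \<partial>\<mu>Y) - (\<integral>y. U y \<partial>\<mu>Y) * (\<integral>y. u y \<partial>\<mu>Y)\<bar>
        \<le> C * (1 - gap R) ^ n * (\<integral>y. U y \<partial>\<mu>Y) * (\<integral>y. \<bar>u y\<bar> \<partial>\<mu>Y)"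
      by (elim conjE) (rule main, blast+)
  qed (use C0 G in auto)
qed

end

section \<open>Powers\<close>

lemma abs_powr_tendsto_0:
  fixes q :: real assumes "q > 0" shows "((\<lambda>h::real. \<bar>h\<bar> powr q) \<longlongrightarrow> 0) (at 0)"
proof -
  have "((\<lambda>h::real. \<bar>h\<bar> powr q) \<longlongrightarrow> \<bar>0\<bar> powr q) (at 0)"
    using assms by (intro tendsto_intros) auto
  then show ?thesis using assms by simp
qed

text \<open>Only 0 needs care: there the difference quotient is
  \<open>\<bar>h\<bar> powr (q - 1)\<close>, which tends to 0 because \<open>q > 1\<close>.\<close>

lemma sgn_powr_deriv:
  fixes q :: real assumes q: "q > 1"
  shows "((\<lambda>x. sgn x * \<bar>x\<bar> powr q) has_real_derivative q * \<bar>x\<bar> powr (q - 1)) (at x)"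
proof (cases x "0::real" rule: linorder_cases)
  case greater
  have "((\<lambda>x. x powr q) has_real_derivative q * \<bar>x\<bar> powr (q - 1)) (at x)"
    using has_real_derivative_powr[of x q] greater by simp
  then show ?thesis
    by (rule has_field_derivative_transform_within_open[where S="{0<..}"]) (use greater in auto)
next
  case less
  have "((\<lambda>x. - ((- x) powr q)) has_real_derivative q * \<bar>x\<bar> powr (q - 1)) (at x)"
    using less by (auto intro!: derivative_eq_intros)
  then show ?thesis
    by (rule has_field_derivative_transform_within_open[where S="{..<0}"]) (use less in auto)
next
  case equal
  have "((\<lambda>h::real. \<bar>h\<bar> powr (q - 1)) \<longlongrightarrow> 0) (at 0)" using q by (intro abs_powr_tendsto_0) simp
  then have "((\<lambda>h::real. (sgn (0 + h) * \<bar>0 + h\<bar> powr q - sgn 0 * \<bar>0\<bar> powr q) / h) \<longlongrightarrow> 0) (at 0)"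
  proof (rule Lim_transform_within[OF _ zero_less_one])
    fix h :: real assume "0 < dist h 0"
    then have h: "h \<noteq> 0" by simp
    have "\<bar>h\<bar> powr q = \<bar>h\<bar> powr (q - 1) * \<bar>h\<bar>"
      using h by (simp add: powr_diff)
    then show "\<bar>h\<bar> powr (q - 1) = (sgn (0 + h) * \<bar>0 + h\<bar> powr q - sgn 0 * \<bar>0\<bar> powr q) / h"
      using h by (simp add: sgn_mult_abs mult.assoc sgn_if)
  qed
  then show ?thesis using equal q by (simp add: DERIV_def)
qed

lemma abs_powr_deriv:
  fixes r :: real assumes r: "r > 1"
  shows "((\<lambda>x. \<bar>x\<bar> powr r) has_real_derivative r * (sgn x * \<bar>x\<bar> powr (r - 1))) (at x)"
proof (cases x "0::real" rule: linorder_cases)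
  case greater
  have "((\<lambda>x. x powr r) has_real_derivative r * (sgn x * \<bar>x\<bar> powr (r - 1))) (at x)"
    using has_real_derivative_powr[of x r] greater by simp
  then show ?thesis
    by (rule has_field_derivative_transform_within_open[where S="{0<..}"]) (use greater in auto)
next
  case less
  have "((\<lambda>x. (- x) powr r) has_real_derivative r * (sgn x * \<bar>x\<bar> powr (r - 1))) (at x)"
    using less by (auto intro!: derivative_eq_intros)
  then show ?thesis
    by (rule has_field_derivative_transform_within_open[where S="{..<0}"]) (use less in auto)
next
  case equal
  have "((\<lambda>h::real. \<bar>h\<bar> powr (r - 1)) \<longlongrightarrow> 0) (at 0)" using r by (intro abs_powr_tendsto_0) simp
  then have "((\<lambda>h::real. (\<bar>0 + h\<bar> powr r - \<bar>0\<bar> powr r) / h) \<longlongrightarrow> 0) (at 0)"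
  proof (rule Lim_null_comparison[rotated])
    show "\<forall>\<^sub>F h in at 0. norm ((\<bar>0 + h\<bar> powr r - \<bar>0\<bar> powr r) / h) \<le> \<bar>h\<bar> powr (r - 1)"
      by (intro always_eventually allI) (simp add: powr_diff)
  qed
  then show ?thesis using equal r by (simp add: DERIV_def)
qed

text \<open>Young's inequality; the second term is written so that no conjugate exponents occur.\<close>

lemma young_powr:
  fixes X Z \<delta> r k :: real
  assumes X: "0 \<le> X" and Z: "0 \<le> Z" and \<delta>: "0 < \<delta>" and k: "0 < k" "k \<le> r"
  shows "Z * X powr (r - k) \<le> \<delta> * X powr r + \<delta> * (Z / \<delta>) powr (r / k)"
\<comment> \<open>If \<open>Z\<close> is at most \<open>\<delta> * X powr k\<close>, the first term
  alone suffices; otherwise \<open>X powr k\<close> is at most \<open>Z / \<delta>\<close>, and the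
  second term alone suffices.\<close>
proof (cases "Z \<le> \<delta> * X powr k")
  case True
  have "Z * X powr (r - k) \<le> (\<delta> * X powr k) * X powr (r - k)" using True by (intro mult_right_mono) auto
  also have "\<dots> = \<delta> * X powr r" by (simp flip: powr_add)
  finally show ?thesis using \<delta> by (smt (verit) mult_nonneg_nonneg powr_ge_zero)
next
  case False
  then have Zp: "Z > 0" using \<delta> by (smt (verit) mult_nonneg_nonneg powr_ge_zero)
  have "X powr k \<le> Z / \<delta>" using False \<delta> by (simp add: field_simps)
  then have "(X powr k) powr ((r - k) / k) \<le> (Z / \<delta>) powr ((r - k) / k)" using k by (intro powr_mono2) auto
  then have "X powr (r - k) \<le> (Z / \<delta>) powr ((r - k) / k)" using k by (simp add: powr_powr)
  then have "Z * X powr (r - k) \<le> Z * (Z / \<delta>) powr ((r - k) / k)" using Z by (intro mult_left_mono)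
  also have "\<dots> = \<delta> * ((Z / \<delta>) powr 1 * (Z / \<delta>) powr ((r - k) / k))" using \<delta> Zp by simp
  also have "\<dots> = \<delta> * (Z / \<delta>) powr (1 + (r - k) / k)" by (simp only: powr_add)
  also have "1 + (r - k) / k = r / k" using k by (simp add: field_simps)
  finally show ?thesis using \<delta> by (smt (verit) mult_nonneg_nonneg powr_ge_zero)
qed

section \<open>The suspension and its invariant measure\<close>

text \<open>\<open>Cd\<close> and \<open>\<gamma>\<close> are parameters so that one pair of
  constants serves all observables. The measures and flow integrals below do not depend on them, and
  instances with both equal to 0 are used where only these matter.\<close>

locale suspension_flow =
  fixes T :: "real \<Rightarrow> 'a::metric_space \<Rightarrow> 'a" and Y :: "'a set" and F :: "'a \<Rightarrow> 'a"
    and H :: "'a \<Rightarrow> real" and \<mu>Y :: "'a measure" and Cd \<gamma> :: real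
  assumes T_meas: "(\<lambda>(t, x). T t x) \<in> borel_measurable (borel \<Otimes>\<^sub>M borel)"
    and T_zero: "\<And>x. T 0 x = x"
    and T_add: "\<And>s t x. s \<ge> 0 \<Longrightarrow> t \<ge> 0 \<Longrightarrow> T (s + t) x = T s (T t x)"
    and muY_prob: "prob_space \<mu>Y"
    and muY_sets [measurable_cong]: "sets \<mu>Y = sets borel"
    and AE_Y: "AE y in \<mu>Y. y \<in> Y"
    and H_meas [measurable]: "H \<in> borel_measurable borel"
    and H_nonneg: "\<And>y. y \<in> Y \<Longrightarrow> 0 \<le> H y"
    and F_meas [measurable]: "F \<in> borel_measurable borel"
    and F_eq: "\<And>y. y \<in> Y \<Longrightarrow> F y = T (H y) y"
    and distr_F: "distr \<mu>Y borel F = \<mu>Y"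
    and H_sq: "integrable \<mu>Y (\<lambda>y. (H y)\<^sup>2)"
    and decay_const: "0 \<le> Cd" "0 \<le> \<gamma>" "\<gamma> < 1"
begin

sublocale Y: prob_space \<mu>Y by (rule muY_prob)

lemma T_measurable [measurable (raw)]:
  assumes "f \<in> borel_measurable M" "g \<in> borel_measurable M"
  shows "(\<lambda>x. T (f x) (g x)) \<in> borel_measurable M"
  using measurable_compose[OF measurable_Pair[OF assms] T_meas] by simp

lemma space_muY [simp]: "space \<mu>Y = UNIV"
  using sets_eq_imp_space_eq[OF muY_sets] by simp

lemma H_int: "integrable \<mu>Y H"
proof (rule Bochner_Integration.integrable_bound)
  show "integrable \<mu>Y (\<lambda>y. 1 + (H y)\<^sup>2)" using H_sq by simp
  show "AE y in \<mu>Y. norm (H y) \<le> norm (1 + (H y)\<^sup>2)"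
  proof (intro AE_I2)
    fix y
    have "0 \<le> (\<bar>H y\<bar> - 1)\<^sup>2" by simp
    then show "norm (H y) \<le> norm (1 + (H y)\<^sup>2)" by (simp add: power2_eq_square algebra_simps)
  qed
qed measurable

text \<open>Fibres are half-open so that the pieces of an orbit between returns tile it without
  overlap.\<close>

definition QS :: "('a \<times> real) set" where "QS = {p. 0 \<le> snd p \<and> snd p < H (fst p)}"

text \<open>\<open>Q\<close> and \<open>MM\<close> are not normalised: their total mass is the mean of the roof.\<close>

definition Q :: "('a \<times> real) measure" where
  "Q = density (\<mu>Y \<Otimes>\<^sub>M lborel) (indicator QS)"

definition MM :: "'a measure" where "MM = distr Q borel (\<lambda>p. T (snd p) (fst p))"

lemma QS_meas [measurable]: "QS \<in> sets (borel \<Otimes>\<^sub>M borel)"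
proof -
  have "{p \<in> space (borel \<Otimes>\<^sub>M borel). 0 \<le> snd p \<and> snd p < H (fst p)} \<in> sets (borel \<Otimes>\<^sub>M borel)" by measurable
  then show ?thesis by (simp add: QS_def space_pair_measure)
qed

lemma sets_prod [measurable_cong, simp]: "sets (\<mu>Y \<Otimes>\<^sub>M lborel) = sets (borel \<Otimes>\<^sub>M borel)"
  using sets_pair_measure_cong[OF muY_sets sets_lborel] .

lemma sets_Q [measurable_cong, simp]: "sets Q = sets (borel \<Otimes>\<^sub>M borel)"
  unfolding Q_def sets_density by (rule sets_prod)

lemma space_Q [simp]: "space Q = UNIV"
  by (simp add: Q_def space_pair_measure)

lemma sets_MM [measurable_cong, simp]: "sets MM = sets borel" by (simp add: MM_def)
lemma space_MM [simp]: "space MM = UNIV" by (simp add: MM_def)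

lemma indicator_QS: "indicator QS (y, u) = indicator {0..<H y} u"
  by (simp add: QS_def indicator_def)

lemma nn_Q:
  assumes g [measurable]: "g \<in> borel_measurable (borel \<Otimes>\<^sub>M borel)"
  shows "(\<integral>\<^sup>+p. g p \<partial>Q) = (\<integral>\<^sup>+y. \<integral>\<^sup>+u. indicator {0..<H y} u * g (y, u) \<partial>lborel \<partial>\<mu>Y)"
proof -
  have "(\<integral>\<^sup>+p. g p \<partial>Q) = (\<integral>\<^sup>+p. indicator QS p * g p \<partial>(\<mu>Y \<Otimes>\<^sub>M lborel))"
    unfolding Q_def by (subst nn_integral_density) auto
  also have "\<dots> = (\<integral>\<^sup>+y. \<integral>\<^sup>+u. indicator QS (y, u) * g (y, u) \<partial>lborel \<partial>\<mu>Y)"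
    by (subst lborel.nn_integral_fst[symmetric]) auto
  finally show ?thesis by (simp add: indicator_QS)
qed

lemma nn_Q_fst:
  assumes g [measurable]: "g \<in> borel_measurable borel"
  shows "(\<integral>\<^sup>+p. g (fst p) \<partial>Q) = (\<integral>\<^sup>+y. ennreal (H y) * g y \<partial>\<mu>Y)"
proof -
  have "(\<integral>\<^sup>+p. g (fst p) \<partial>Q) = (\<integral>\<^sup>+y. \<integral>\<^sup>+u. g y * indicator {0..<H y} u \<partial>lborel \<partial>\<mu>Y)"
    by (subst nn_Q) (auto simp: mult.commute)
  also have "\<dots> = (\<integral>\<^sup>+y. g y * ennreal (H y) \<partial>\<mu>Y)"
  proof (rule nn_integral_cong)
    show "(\<integral>\<^sup>+u. g y * indicator {0..<H y} u \<partial>lborel) = g y * ennreal (H y)" for y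
      by (cases "0 \<le> H y") (auto simp: nn_integral_cmult_indicator ennreal_neg)
  qed
  finally show ?thesis by (simp add: mult.commute)
qed

lemma integrable_Q_fst:
  assumes g [measurable]: "g \<in> borel_measurable borel" and i: "integrable \<mu>Y (\<lambda>y. H y * g y)"
  shows "integrable Q (\<lambda>p. g (fst p))"
proof (rule integrableI_bounded)
  have "(\<integral>\<^sup>+p. ennreal (norm (g (fst p))) \<partial>Q) = (\<integral>\<^sup>+y. ennreal (H y) * ennreal (norm (g y)) \<partial>\<mu>Y)"
    by (rule nn_Q_fst) measurable
  also have "\<dots> \<le> (\<integral>\<^sup>+y. ennreal (norm (H y * g y)) \<partial>\<mu>Y)"
  proof (rule nn_integral_mono)
    show "ennreal (H y) * ennreal (norm (g y)) \<le> ennreal (norm (H y * g y))" for y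
      by (cases "0 \<le> H y") (auto simp: ennreal_neg abs_mult ennreal_mult)
  qed
  also have "\<dots> < \<infinity>" using i by (simp add: integrable_iff_bounded)
  finally show "(\<integral>\<^sup>+p. ennreal (norm (g (fst p))) \<partial>Q) < \<infinity>" .
qed measurable

sublocale Q: finite_measure Q
proof
  have "integrable Q (\<lambda>p. 1::real)" using integrable_Q_fst[of "\<lambda>_. 1"] H_int by simp
  then show "emeasure Q (space Q) \<noteq> \<infinity>" by (simp add: integrable_iff_bounded)
qed

sublocale MM: finite_measure MM
  unfolding MM_def by (rule Q.finite_measure_distr) measurable

lemma integral_Q:
  fixes g :: "'a \<times> real \<Rightarrow> real"
  assumes i: "integrable Q g"
  shows "(\<integral>p. g p \<partial>Q) = (\<integral>y. (\<integral>u. indicator {0..<H y} u * g (y, u) \<partial>lborel) \<partial>\<mu>Y)"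
    and "integrable \<mu>Y (\<lambda>y. \<integral>u. indicator {0..<H y} u * g (y, u) \<partial>lborel)"
proof -
  have g [measurable]: "g \<in> borel_measurable (borel \<Otimes>\<^sub>M borel)" using borel_measurable_integrable[OF i] by simp
  interpret PS: pair_sigma_finite \<mu>Y lborel ..
  have Q': "Q = density (\<mu>Y \<Otimes>\<^sub>M lborel) (\<lambda>p. ennreal (indicator QS p))"
    unfolding Q_def by (simp add: ennreal_indicator)
  have ii: "integrable (\<mu>Y \<Otimes>\<^sub>M lborel) (\<lambda>p. indicator QS p * g p)"
    using i unfolding Q' by (subst (asm) integrable_real_density) auto
  have "(\<integral>p. g p \<partial>Q) = (\<integral>p. indicator QS p * g p \<partial>(\<mu>Y \<Otimes>\<^sub>M lborel))"
    unfolding Q' by (subst integral_real_density) auto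
  also have "\<dots> = (\<integral>y. (\<integral>u. indicator QS (y, u) * g (y, u) \<partial>lborel) \<partial>\<mu>Y)"
    using PS.integral_fst'[OF ii] by simp
  finally show "(\<integral>p. g p \<partial>Q) = (\<integral>y. (\<integral>u. indicator {0..<H y} u * g (y, u) \<partial>lborel) \<partial>\<mu>Y)"
    by (simp add: indicator_QS)
  show "integrable \<mu>Y (\<lambda>y. \<integral>u. indicator {0..<H y} u * g (y, u) \<partial>lborel)"
    using PS.integrable_fst'[OF ii] by (simp add: indicator_QS)
qed

lemma integral_MM:
  fixes g :: "'a \<Rightarrow> real"
  assumes [measurable]: "g \<in> borel_measurable borel"
  shows "(\<integral>x. g x \<partial>MM) = (\<integral>p. g (T (snd p) (fst p)) \<partial>Q)"
  unfolding MM_def by (rule integral_distr) measurable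

lemma integrable_bdd:
  fixes g :: "'a \<Rightarrow> real"
  assumes [measurable]: "g \<in> borel_measurable borel" and b: "\<And>x. \<bar>g x\<bar> \<le> b"
  shows "integrable MM g" "integrable \<mu>Y g" "integrable Q (\<lambda>p. g (T (snd p) (fst p)))"
  using b by (auto intro!: MM.integrable_const_bound[of _ b] Y.integrable_const_bound[of _ b] Q.integrable_const_bound[of _ b])

lemma nn_MM:
  assumes [measurable]: "g \<in> borel_measurable borel"
  shows "(\<integral>\<^sup>+x. g x \<partial>MM) = (\<integral>\<^sup>+y. \<integral>\<^sup>+u. indicator {0..<H y} u * g (T u y) \<partial>lborel \<partial>\<mu>Y)"
  unfolding MM_def by (subst nn_integral_distr, measurable) (subst nn_Q, auto)

lemma nn_shift:
  fixes g :: "real \<Rightarrow> ennreal" assumes [measurable]: "g \<in> borel_measurable borel"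
  shows "(\<integral>\<^sup>+u. g u \<partial>lborel) = (\<integral>\<^sup>+u. g (c + u) \<partial>lborel)"
  using nn_integral_real_affine[of g 1 c] by simp

text \<open>Flowing for time \<open>s\<close> moves the fibre \<open>[0, H)\<close> to
  \<open>[s, s + H)\<close>. Cut \<open>[0, s + H)\<close> once at \<open>s\<close> and once at
  \<open>H\<close>: the pieces \<open>[0, s)\<close> and \<open>[H, s + H)\<close> have the same
  weight because \<open>F\<close> preserves \<open>\<mu>Y\<close>, and this weight is finite, so it
  can be cancelled.\<close>

lemma MM_invariant:
  assumes s: "0 \<le> s" shows "distr MM borel (T s) = MM"
proof (rule measure_eqI)
  fix A assume "A \<in> sets (distr MM borel (T s))"
  then have A [measurable]: "A \<in> sets borel" by simp
  define k where "k y u = (indicator A (T u y) :: ennreal)" for y u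
  have k [measurable]: "(\<lambda>p. k (f p) (g p)) \<in> borel_measurable N"
    if [measurable]: "f \<in> borel_measurable N" "g \<in> borel_measurable N" for f g and N :: "'z measure"
    unfolding k_def by measurable
  have k2 [measurable]: "(\<lambda>p. k (f p) (g p)) \<in> borel_measurable N"
    if [measurable]: "f \<in> borel_measurable N" "g \<in> borel_measurable N" for f g and N :: "('a \<times> real) measure"
    unfolding k_def by measurable
  define W where "W B = (\<integral>\<^sup>+y. \<integral>\<^sup>+u. indicator (B y) u * k y u \<partial>lborel \<partial>\<mu>Y)" for B :: "'a \<Rightarrow> real set"
  have mI: "(\<lambda>p. indicator {a p..<b p} (snd p) :: ennreal) \<in> borel_measurable (\<mu>Y \<Otimes>\<^sub>M lborel)"
    if [measurable]: "a \<in> borel_measurable (\<mu>Y \<Otimes>\<^sub>M lborel)" "b \<in> borel_measurable (\<mu>Y \<Otimes>\<^sub>M lborel)"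
    for a b :: "'a \<times> real \<Rightarrow> real"
    unfolding indicator_def by simp
  have Wadd: "W (\<lambda>y. {a y..<b y}) + W (\<lambda>y. {b y..<c y}) = W (\<lambda>y. {a y..<c y})"
    if [measurable]: "a \<in> borel_measurable borel" "b \<in> borel_measurable borel" "c \<in> borel_measurable borel"
      and le: "\<And>y. y \<in> Y \<Longrightarrow> a y \<le> b y \<and> b y \<le> c y" for a b c
  proof -
    have m: "(\<lambda>y. \<integral>\<^sup>+u. indicator {a' y..<b' y} u * k y u \<partial>lborel) \<in> borel_measurable \<mu>Y"
      if [measurable]: "a' \<in> borel_measurable borel" "b' \<in> borel_measurable borel" for a' b'
    proof -
      have "(\<lambda>p. indicator {a' (fst p)..<b' (fst p)} (snd p) * k (fst p) (snd p)) \<in> borel_measurable (\<mu>Y \<Otimes>\<^sub>M lborel)"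
        by (intro borel_measurable_times_ennreal mI k2) measurable
      then show ?thesis by (intro lborel.borel_measurable_nn_integral) (simp add: split_beta')
    qed
    have "W (\<lambda>y. {a y..<b y}) + W (\<lambda>y. {b y..<c y})
        = (\<integral>\<^sup>+y. (\<integral>\<^sup>+u. indicator {a y..<b y} u * k y u \<partial>lborel) + (\<integral>\<^sup>+u. indicator {b y..<c y} u * k y u \<partial>lborel) \<partial>\<mu>Y)"
      unfolding W_def by (rule nn_integral_add[symmetric]; rule m; measurable)
    also have "\<dots> = (\<integral>\<^sup>+y. \<integral>\<^sup>+u. indicator {a y..<b y} u * k y u + indicator {b y..<c y} u * k y u \<partial>lborel \<partial>\<mu>Y)"
      by (intro nn_integral_cong nn_integral_add[symmetric]) (auto simp: k_def)
    also have "\<dots> = W (\<lambda>y. {a y..<c y})"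
      unfolding W_def
    proof (intro nn_integral_cong_AE)
      show "AE y in \<mu>Y. (\<integral>\<^sup>+u. indicator {a y..<b y} u * k y u + indicator {b y..<c y} u * k y u \<partial>lborel)
          = (\<integral>\<^sup>+u. indicator {a y..<c y} u * k y u \<partial>lborel)"
        using AE_Y by eventually_elim (intro nn_integral_cong, use le in \<open>force simp: indicator_def\<close>)
    qed
    finally show ?thesis .
  qed
  have "emeasure (distr MM borel (T s)) A = (\<integral>\<^sup>+x. indicator A x \<partial>distr MM borel (T s))" by simp
  also have "\<dots> = (\<integral>\<^sup>+x. indicator A (T s x) \<partial>MM)" by (rule nn_integral_distr) measurable
  also have "\<dots> = (\<integral>\<^sup>+y. \<integral>\<^sup>+u. indicator {0..<H y} u * indicator A (T s (T u y)) \<partial>lborel \<partial>\<mu>Y)"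
    by (rule nn_MM) measurable
  also have "\<dots> = W (\<lambda>y. {s..<s + H y})"
    unfolding W_def
  proof (rule nn_integral_cong)
    fix y
    have "(\<integral>\<^sup>+u. indicator {s..<s + H y} u * k y u \<partial>lborel) = (\<integral>\<^sup>+u. indicator {s..<s + H y} (s + u) * k y (s + u) \<partial>lborel)"
      by (rule nn_shift) (auto simp: k_def)
    also have "\<dots> = (\<integral>\<^sup>+u. indicator {0..<H y} u * indicator A (T s (T u y)) \<partial>lborel)"
      by (intro nn_integral_cong) (auto simp: k_def indicator_def T_add s)
    finally show "(\<integral>\<^sup>+u. indicator {0..<H y} u * indicator A (T s (T u y)) \<partial>lborel)
      = (\<integral>\<^sup>+u. indicator {s..<s + H y} u * k y u \<partial>lborel)" by simp
  qed
  finally have e1: "emeasure (distr MM borel (T s)) A = W (\<lambda>y. {s..<s + H y})" .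
  have e2: "emeasure MM A = W (\<lambda>y. {0..<H y})"
    using nn_MM[of "indicator A"] by (simp add: W_def k_def)
  have "W (\<lambda>y. {H y..<s + H y}) = (\<integral>\<^sup>+y. \<integral>\<^sup>+u. indicator {0..<s} u * k (F y) u \<partial>lborel \<partial>\<mu>Y)"
    unfolding W_def
  proof (intro nn_integral_cong_AE)
    show "AE y in \<mu>Y. (\<integral>\<^sup>+u. indicator {H y..<s + H y} u * k y u \<partial>lborel) = (\<integral>\<^sup>+u. indicator {0..<s} u * k (F y) u \<partial>lborel)"
      using AE_Y
    proof eventually_elim
      case (elim y)
      have "(\<integral>\<^sup>+u. indicator {H y..<s + H y} u * k y u \<partial>lborel) = (\<integral>\<^sup>+u. indicator {H y..<s + H y} (H y + u) * k y (H y + u) \<partial>lborel)"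
        by (rule nn_shift) (auto simp: k_def)
      also have "\<dots> = (\<integral>\<^sup>+u. indicator {0..<s} u * k (F y) u \<partial>lborel)"
        using H_nonneg[OF elim] F_eq[OF elim]
        by (intro nn_integral_cong) (auto simp: k_def indicator_def T_add add.commute[of "H y"])
      finally show ?case .
    qed
  qed
  also have "\<dots> = (\<integral>\<^sup>+y. \<integral>\<^sup>+u. indicator {0..<s} u * k y u \<partial>lborel \<partial>distr \<mu>Y borel F)"
    by (subst nn_integral_distr) (auto simp: k_def)
  also have "\<dots> = W (\<lambda>y. {0..<s})" by (simp add: W_def distr_F)
  finally have e3: "W (\<lambda>y. {H y..<s + H y}) = W (\<lambda>y. {0..<s})" .
  have "W (\<lambda>y. {0..<s}) \<le> (\<integral>\<^sup>+y. \<integral>\<^sup>+u. indicator {0..<s} u \<partial>lborel \<partial>\<mu>Y)"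
    unfolding W_def by (intro nn_integral_mono) (auto simp: k_def indicator_def)
  also have "\<dots> < \<infinity>" using s Y.emeasure_space_1 by simp
  finally have fin: "W (\<lambda>y. {0..<s}) \<noteq> \<infinity>" by simp
  have "W (\<lambda>y. {0..<s}) + W (\<lambda>y. {s..<s + H y}) = W (\<lambda>y. {0..<s + H y})"
    using s H_nonneg by (intro Wadd) auto
  moreover have "W (\<lambda>y. {0..<H y}) + W (\<lambda>y. {H y..<s + H y}) = W (\<lambda>y. {0..<s + H y})"
    using s H_nonneg by (intro Wadd) auto
  ultimately have "W (\<lambda>y. {0..<s}) + W (\<lambda>y. {s..<s + H y}) = W (\<lambda>y. {0..<s}) + W (\<lambda>y. {0..<H y})"
    using e3 by (simp add: add.commute)
  then have "W (\<lambda>y. {s..<s + H y}) = W (\<lambda>y. {0..<H y})"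
    using fin by (simp add: ennreal_add_left_cancel)
  then show "emeasure (distr MM borel (T s)) A = emeasure MM A" using e1 e2 by simp
qed simp

lemma integral_MM_T:
  fixes g :: "'a \<Rightarrow> real"
  assumes s: "0 \<le> s" and [measurable]: "g \<in> borel_measurable borel"
  shows "(\<integral>x. g (T s x) \<partial>MM) = (\<integral>x. g x \<partial>MM)"
proof -
  have "(\<integral>x. g x \<partial>distr MM borel (T s)) = (\<integral>x. g (T s x) \<partial>MM)"
    by (rule integral_distr) measurable
  then show ?thesis using MM_invariant[OF s] by simp
qed

text \<open>Fubini, after which invariance replaces \<open>k s (T s x)\<close> by
  \<open>k s x\<close>; it remains to bound an integral over the space for each fixed time.\<close>

lemma flow_average:
  fixes k :: "real \<Rightarrow> 'a \<Rightarrow> real"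
  assumes k [measurable]: "(\<lambda>p. k (fst p) (snd p)) \<in> borel_measurable (borel \<Otimes>\<^sub>M borel)"
    and b: "\<And>s x. 0 \<le> s \<Longrightarrow> s \<le> t \<Longrightarrow> \<bar>k s x\<bar> \<le> b" and t: "0 \<le> t"
    and w: "\<And>x. w x = (\<integral>s. indicator {0..t} s * k s (T s x) \<partial>lborel)"
    and B: "\<And>s. 0 \<le> s \<Longrightarrow> s \<le> t \<Longrightarrow> (\<integral>x. k s x \<partial>MM) \<le> B"
  shows "(\<integral>x. w x \<partial>MM) \<le> t * B"
proof -
  interpret PS: pair_sigma_finite MM lborel ..
  define f where "f x s = indicator {0..t} s * k s (T s x)" for x s
  have km: "k s \<in> borel_measurable borel" for s
    using measurable_compose[OF measurable_Pair1'[of s borel borel] k] by (simp add: comp_def)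
  have kT: "(\<lambda>p. k (snd p) (T (snd p) (fst p))) \<in> borel_measurable (MM \<Otimes>\<^sub>M lborel)"
    using measurable_compose[OF _ k, of "\<lambda>p. (snd p, T (snd p) (fst p))" "MM \<Otimes>\<^sub>M lborel"] by simp
  have int: "integrable (MM \<Otimes>\<^sub>M lborel) (case_prod f)"
  proof (rule integrableI_bounded_set[where A="UNIV \<times> {0..t}" and B=b])
    show "UNIV \<times> {0..t} \<in> sets (MM \<Otimes>\<^sub>M lborel)" by (intro pair_measureI) auto
    have "emeasure (MM \<Otimes>\<^sub>M lborel) (UNIV \<times> {0..t}) = emeasure MM UNIV * emeasure lborel {0..t}"
      by (rule lborel.emeasure_pair_measure_Times) auto
    also have "\<dots> < \<infinity>" using t by (simp add: ennreal_mult_eq_top_iff less_top[symmetric])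
    finally show "emeasure (MM \<Otimes>\<^sub>M lborel) (UNIV \<times> {0..t}) < \<infinity>" .
    show "case_prod f \<in> borel_measurable (MM \<Otimes>\<^sub>M lborel)"
      using kT unfolding f_def split_beta' by measurable
    show "AE x in MM \<Otimes>\<^sub>M lborel. x \<in> UNIV \<times> {0..t} \<longrightarrow> norm (case x of (x, xa) \<Rightarrow> f x xa) \<le> b"
      using b by (auto simp: f_def)
    show "AE x in MM \<Otimes>\<^sub>M lborel. x \<notin> UNIV \<times> {0..t} \<longrightarrow> (case x of (x, xa) \<Rightarrow> f x xa) = 0"
      by (intro AE_I2) (auto simp: f_def indicator_def)
  qed
  have "(\<integral>x. w x \<partial>MM) = (\<integral>x. \<integral>s. f x s \<partial>lborel \<partial>MM)" by (simp add: w f_def)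
  also have "\<dots> = (\<integral>s. \<integral>x. f x s \<partial>MM \<partial>lborel)" using PS.Fubini_integral[OF int] by simp
  also have "\<dots> \<le> (\<integral>s. indicator {0..t} s * B \<partial>lborel)"
  proof (rule integral_mono)
    show "integrable lborel (\<lambda>s. \<integral>x. f x s \<partial>MM)" using PS.integrable_snd[OF int] .
    show "integrable lborel (\<lambda>s. indicator {0..t} s * B)" using t by simp
    show "(\<integral>x. f x s \<partial>MM) \<le> indicator {0..t} s * B" for s
      using B[of s] integral_MM_T[OF _ km, of s s] by (auto simp: f_def indicator_def)
  qed
  also have "\<dots> = t * B" using t by simp
  finally show ?thesis .
qed

end

section \<open>Integrals along the flow\<close>

lemma indicator_Icc_integrable:
  fixes f :: "real \<Rightarrow> real"
  assumes "continuous_on {0..} f"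
  shows "integrable lborel (\<lambda>s. indicator {0..t} s * f s)"
proof -
  have "continuous_on {0..t} f" using assms by (rule continuous_on_subset) auto
  then show ?thesis using borel_integrable_atLeastAtMost' unfolding set_integrable_def by force
qed

lemma integral_Icc_lborel:
  fixes f :: "real \<Rightarrow> real"
  assumes "continuous_on {0..} f"
  shows "integral {0..t} f = (\<integral>s. indicator {0..t} s * f s \<partial>lborel)"
proof -
  have "continuous_on {0..t} f" using assms by (rule continuous_on_subset) auto
  then have "set_integrable lborel {0..t} f" by (rule borel_integrable_atLeastAtMost')
  from set_borel_integral_eq_integral(2)[OF this] show ?thesis by (simp add: set_lebesgue_integral_def)
qed

text \<open>Derivatives along the flow are taken within \<open>{0..}\<close>, because the semiflow
  has no negative times; at 0 they are one-sided.\<close>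

lemma integral_Icc_deriv:
  fixes f :: "real \<Rightarrow> real"
  assumes f: "continuous_on {0..} f" and t: "0 \<le> t"
  shows "((\<lambda>t. integral {0..t} f) has_real_derivative f t) (at t within {0..})"
proof -
  have "continuous_on {0..t + 1} f" using f by (rule continuous_on_subset) auto
  then have "((\<lambda>t. integral {0..t} f) has_real_derivative f t) (at t within {0..t + 1})"
    by (rule integral_has_real_derivative) (use t in auto)
  moreover have "at t within {0..t + 1} = at t within {0..}"
    by (rule at_within_nhd[where S="{..<t + 1}"]) auto
  ultimately show ?thesis by simp
qed

lemma deriv_shift:
  fixes g :: "real \<Rightarrow> real"
  assumes "(g has_real_derivative d) (at (t + u) within {0..})" "0 \<le> t"
  shows "((\<lambda>u. g (t + u)) has_real_derivative d) (at u within {0..})"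
proof -
  have "(g has_real_derivative d) (at (t + u) within (\<lambda>u. t + u) ` {0..})"
    using assms by (intro DERIV_subset[OF assms(1)]) auto
  moreover have "((\<lambda>u. t + u) has_real_derivative 1) (at u within {0..})"
    by (auto intro!: derivative_eq_intros)
  ultimately show ?thesis using DERIV_image_chain[of g d "\<lambda>u. t + u" u "{0..}" 1] by (simp add: comp_def)
qed

lemma ftc_Ici:
  fixes g :: "real \<Rightarrow> real"
  assumes g: "\<And>u. 0 \<le> u \<Longrightarrow> (g has_real_derivative g' u) (at u within {0..})" and t: "0 \<le> t"
  shows "integral {0..t} g' = g t - g 0"
proof -
  have "(g' has_integral (g t - g 0)) {0..t}"
  proof (rule fundamental_theorem_of_calculus[OF t])
    fix x assume "x \<in> {0..t}"
    then show "(g has_vector_derivative g' x) (at x within {0..t})"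
      using DERIV_subset[OF g, of x "{0..t}"] by (auto simp: has_real_derivative_iff_has_vector_derivative)
  qed
  then show ?thesis by (rule integral_unique)
qed

lemma integral_Icc_shift:
  fixes f :: "real \<Rightarrow> real"
  assumes f: "continuous_on {0..} f" and t: "0 \<le> t" "0 \<le> u"
  shows "integral {0..t} (\<lambda>s. f (s + u)) = integral {0..t + u} f - integral {0..u} f"
proof -
  have "((\<lambda>t. integral {0..u + t} f - integral {0..u} f) has_real_derivative f (s + u)) (at s within {0..})"
    if "0 \<le> s" for s
    using deriv_shift[OF integral_Icc_deriv[OF f, of "u + s"] t(2)] that t
    by (auto intro!: derivative_eq_intros simp: add.commute)
  from ftc_Ici[OF this t(1)] show ?thesis by (simp add: add.commute)
qed

lemma deriv_transform_Ici:
  assumes "(f has_real_derivative d) (at u within {0..})" "0 \<le> u" "\<And>u. 0 \<le> u \<Longrightarrow> g u = f u"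
  shows "(g has_real_derivative d) (at u within {0..})"
  using assms has_derivative_transform[of u "{0..}" g f] unfolding has_field_derivative_def by auto

lemma integral_Ico_Icc:
  fixes f :: "real \<Rightarrow> real" assumes [measurable]: "f \<in> borel_measurable borel"
  shows "(\<integral>u. indicator {0..<c} u * f u \<partial>lborel) = (\<integral>u. indicator {0..c} u * f u \<partial>lborel)"
proof (rule integral_cong_AE)
  show "AE u in lborel. indicator {0..<c} u * f u = indicator {0..c} u * f u"
    using AE_lborel_singleton[of c] by eventually_elim (auto simp: indicator_def)
qed measurable

lemma integrable_Ico_bdd:
  fixes f :: "real \<Rightarrow> real"
  assumes [measurable]: "f \<in> borel_measurable borel" and b: "\<And>u. 0 \<le> u \<Longrightarrow> u < c \<Longrightarrow> \<bar>f u\<bar> \<le> b"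
  shows "integrable lborel (\<lambda>u. indicator {0..<c} u * f u)"
proof (rule integrableI_bounded_set[where A="{0..<c}" and B=b])
  show "emeasure lborel {0..<c} < \<infinity>" by (cases "0 \<le> c") auto
qed (use b in \<open>auto simp: indicator_def\<close>)

context suspension_flow
begin

section \<open>Observables, flow integrals and the decorrelation estimate\<close>

definition I :: "('a \<Rightarrow> real) \<Rightarrow> 'a \<Rightarrow> real \<Rightarrow> real" where
  "I a x t = integral {0..t} (\<lambda>s. a (T s x))"

definition ob :: "('a \<Rightarrow> real) \<Rightarrow> bool" where
  "ob a \<longleftrightarrow> a \<in> borel_measurable borel \<and> (\<forall>x. \<bar>a x\<bar> \<le> 1) \<and> (\<forall>x. continuous_on {0..} (\<lambda>t. a (T t x)))"

text \<open>The statistical information on \<open>a\<close> that the moment bounds use: its integral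
  over one return is uncorrelated, up to an exponentially small error, with functions of the future
  under \<open>F\<close>. No product of means appears, so mean zero is built in.\<close>

definition adm :: "('a \<Rightarrow> real) \<Rightarrow> bool" where
  "adm a \<longleftrightarrow> ob a \<and> (\<forall>n u b. u \<in> borel_measurable borel \<and> (\<forall>y. \<bar>u y\<bar> \<le> b) \<longrightarrow>
     \<bar>\<integral>y. u ((F ^^ Suc n) y) * I a y (H y) \<partial>\<mu>Y\<bar> \<le> Cd * \<gamma> ^ n * (\<integral>y. \<bar>u y\<bar> \<partial>\<mu>Y))"

text \<open>Differentiability is asked only along orbits. The bound \<open>b\<close> secures
  integrability and is absent from the bound in \<open>key_estimate\<close>.\<close>

definition fC1 :: "('a \<Rightarrow> real) \<Rightarrow> ('a \<Rightarrow> real) \<Rightarrow> real \<Rightarrow> bool" where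
  "fC1 G Gd b \<longleftrightarrow> G \<in> borel_measurable borel \<and> Gd \<in> borel_measurable borel
     \<and> (\<forall>x. \<bar>G x\<bar> \<le> b \<and> \<bar>Gd x\<bar> \<le> b)
     \<and> (\<forall>x u. 0 \<le> u \<longrightarrow> ((\<lambda>u. G (T u x)) has_real_derivative Gd (T u x)) (at u within {0..}))
     \<and> (\<forall>x. continuous_on {0..} (\<lambda>u. Gd (T u x)))"

lemma I_lborel: "ob a \<Longrightarrow> I a x t = (\<integral>s. indicator {0..t} s * a (T s x) \<partial>lborel)"
  unfolding I_def ob_def by (intro integral_Icc_lborel) auto

lemma I_measurable:
  assumes a: "ob a" and [measurable]: "f \<in> borel_measurable N" "g \<in> borel_measurable N"
  shows "(\<lambda>x. I a (f x) (g x)) \<in> borel_measurable N"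
proof -
  have [measurable]: "a \<in> borel_measurable borel" using a by (simp add: ob_def)
  have "(\<lambda>(x, s). indicator {0..g x} s * a (T s (f x))) \<in> borel_measurable (N \<Otimes>\<^sub>M lborel)"
    unfolding indicator_def split_beta' by simp
  then show ?thesis unfolding I_lborel[OF a] by (rule lborel.borel_measurable_lebesgue_integral)
qed

lemma I_bound: assumes a: "ob a" "0 \<le> t" shows "\<bar>I a x t\<bar> \<le> t"
proof -
  have "norm (integral {0..t} (\<lambda>s. a (T s x))) \<le> 1 * (t - 0)"
  proof (rule integral_bound)
    show "continuous_on {0..t} (\<lambda>s. a (T s x))"
      using a unfolding ob_def by (auto intro: continuous_on_subset[of "{0..}"])
  qed (use a in \<open>auto simp: ob_def\<close>)
  then show ?thesis by (simp add: I_def)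
qed

lemma I_neg: "t < 0 \<Longrightarrow> I a x t = 0" by (simp add: I_def)

lemma I_0 [simp]: "I a x 0 = 0" by (simp add: I_def)

lemma I_deriv:
  assumes "ob a" "0 \<le> t" shows "(I a x has_real_derivative a (T t x)) (at t within {0..})"
  using integral_Icc_deriv[of "\<lambda>s. a (T s x)" t] assms unfolding I_def[abs_def] ob_def by auto

lemma I_shift:
  assumes a: "ob a" "0 \<le> t" "0 \<le> u"
  shows "I a (T u x) t = I a x (t + u) - I a x u"
proof -
  have "I a (T u x) t = integral {0..t} (\<lambda>s. a (T (s + u) x))"
    unfolding I_def using a by (intro integral_cong) (simp add: T_add)
  also have "\<dots> = I a x (t + u) - I a x u"
    unfolding I_def using a by (intro integral_Icc_shift) (auto simp: ob_def)
  finally show ?thesis .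
qed

lemma I_cont: "ob a \<Longrightarrow> continuous_on {0..} (I a x)"
  using DERIV_continuous_on[OF I_deriv] by force

text \<open>The integral \<open>g y\<close> of \<open>\<bar>Gd\<bar>\<close> over the fibre bounds
  the variation of \<open>G\<close> on it, and freezing \<open>G\<close> at the base point costs
  \<open>H * g\<close>. In the telescoping sum, the term without an iterate of \<open>F\<close>
  admits no decay and costs \<open>H * g\<close> once more, since \<open>D\<close> is at most
  \<open>g\<close> and \<open>\<Phi>\<close> at most \<open>H\<close>; this accounts for the 2. The
  others sum geometrically to \<open>Cd / (1 - \<gamma>)\<close> times the mean of
  \<open>\<bar>D\<bar>\<close>, and the remainder dies out because \<open>G\<close> is
  bounded.\<close>

lemma key_estimate:
  assumes a: "adm a" and G: "fC1 G Gd b"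
  shows "\<bar>\<integral>x. G x * a x \<partial>MM\<bar>
    \<le> (2 + Cd / (1 - \<gamma>)) * (\<integral>p. (H (fst p) + 1) * \<bar>Gd (T (snd p) (fst p))\<bar> \<partial>Q)"
proof -
  have oa: "ob a" using a by (simp add: adm_def)
  have am [measurable]: "a \<in> borel_measurable borel" and a1: "\<And>x. \<bar>a x\<bar> \<le> 1"
    and ac: "\<And>x. continuous_on {0..} (\<lambda>t. a (T t x))" using oa by (auto simp: ob_def)
  have [measurable]: "G \<in> borel_measurable borel" "Gd \<in> borel_measurable borel"
    and Gb: "\<And>x. \<bar>G x\<bar> \<le> b" "\<And>x. \<bar>Gd x\<bar> \<le> b"
    and Gder: "\<And>x u. 0 \<le> u \<Longrightarrow> ((\<lambda>u. G (T u x)) has_real_derivative Gd (T u x)) (at u within {0..})"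
    and Gdc: "\<And>x. continuous_on {0..} (\<lambda>u. Gd (T u x))"
    using G by (auto simp: fC1_def)
  have b0: "0 \<le> b" using Gb(1) order_trans abs_ge_zero by blast
  note I_measurable[OF oa, measurable]
  define \<Phi> where "\<Phi> y = I a y (H y)" for y
  have \<Phi> [measurable]: "\<Phi> \<in> borel_measurable borel" unfolding \<Phi>_def by measurable
  have \<Phi>H: "\<bar>\<Phi> y\<bar> \<le> \<bar>H y\<bar>" for y
    using I_bound[OF oa, of "H y" y] I_neg[of "H y" a y] by (cases "0 \<le> H y") (auto simp: \<Phi>_def)
  have \<Phi>i: "integrable \<mu>Y \<Phi>"
    using H_int \<Phi>H by (intro Bochner_Integration.integrable_bound[OF H_int]) auto
  define g where "g y = (\<integral>u. indicator {0..<H y} u * \<bar>Gd (T u y)\<bar> \<partial>lborel)" for y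
  have g0: "0 \<le> g y" for y unfolding g_def by (intro integral_nonneg_AE) auto
  have iQ0: "integrable Q (\<lambda>p. \<bar>Gd (T (snd p) (fst p))\<bar>)"
    using Gb by (intro Q.integrable_const_bound[of _ b]) auto
  have gi: "integrable \<mu>Y g" unfolding g_def using integral_Q(2)[OF iQ0] by simp
  have g [measurable]: "g \<in> borel_measurable borel" using borel_measurable_integrable[OF gi] measurable_cong_sets[OF muY_sets refl] by blast
  have iQ1: "integrable Q (\<lambda>p. (H (fst p) + 1) * \<bar>Gd (T (snd p) (fst p))\<bar>)"
  proof (rule Bochner_Integration.integrable_bound)
    have "integrable \<mu>Y (\<lambda>y. H y * (b * (\<bar>H y\<bar> + 1)))"
    proof (rule Bochner_Integration.integrable_bound)
      show "integrable \<mu>Y (\<lambda>y. b * ((H y)\<^sup>2 + \<bar>H y\<bar>))" using H_sq H_int by simp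
      show "AE y in \<mu>Y. norm (H y * (b * (\<bar>H y\<bar> + 1))) \<le> norm (b * ((H y)\<^sup>2 + \<bar>H y\<bar>))"
        by (intro AE_I2) (auto simp: abs_mult power2_eq_square algebra_simps)
    qed measurable
    then show "integrable Q (\<lambda>p. b * (\<bar>H (fst p)\<bar> + 1))" by (intro integrable_Q_fst[of "\<lambda>y. b * (\<bar>H y\<bar> + 1)"]) measurable
    show "AE p in Q. norm ((H (fst p) + 1) * \<bar>Gd (T (snd p) (fst p))\<bar>) \<le> norm (b * (\<bar>H (fst p)\<bar> + 1))"
    proof (intro AE_I2)
      fix p
      have "\<bar>H (fst p) + 1\<bar> * \<bar>Gd (T (snd p) (fst p))\<bar> \<le> (\<bar>H (fst p)\<bar> + 1) * b"
        using Gb by (intro mult_mono) auto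
      then show "norm ((H (fst p) + 1) * \<bar>Gd (T (snd p) (fst p))\<bar>) \<le> norm (b * (\<bar>H (fst p)\<bar> + 1))"
        using b0 by (simp add: abs_mult mult.commute)
    qed
  qed measurable
  have eq1: "(\<integral>p. (H (fst p) + 1) * \<bar>Gd (T (snd p) (fst p))\<bar> \<partial>Q) = (\<integral>y. (H y + 1) * g y \<partial>\<mu>Y)"
    unfolding g_def by (subst integral_Q(1)[OF iQ1]) (simp add: mult.left_commute)
  have Hgi1: "integrable \<mu>Y (\<lambda>y. (H y + 1) * g y)"
    unfolding g_def using integral_Q(2)[OF iQ1] by (simp add: mult.left_commute)
  have Hgi: "integrable \<mu>Y (\<lambda>y. H y * g y)"
    using Bochner_Integration.integrable_diff[OF Hgi1 gi] by (simp add: algebra_simps)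
  have p1: "\<bar>G (T u y) - G y\<bar> \<le> g y" if u: "0 \<le> u" "u \<le> H y" for u y
  proof -
    have "G (T u y) - G y = integral {0..u} (\<lambda>s. Gd (T s y))"
      using ftc_Ici[OF Gder u(1), of y] T_zero by simp
    also have "\<dots> = (\<integral>s. indicator {0..u} s * Gd (T s y) \<partial>lborel)"
      by (rule integral_Icc_lborel[OF Gdc])
    also have "\<bar>\<dots>\<bar> \<le> (\<integral>s. \<bar>indicator {0..u} s * Gd (T s y)\<bar> \<partial>lborel)" by (rule integral_abs_bound)
    also have "\<dots> \<le> (\<integral>s. indicator {0..H y} s * \<bar>Gd (T s y)\<bar> \<partial>lborel)"
    proof (rule integral_mono)
      show "integrable lborel (\<lambda>s. \<bar>indicator {0..u} s * Gd (T s y)\<bar>)"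
        by (intro integrable_abs indicator_Icc_integrable[OF Gdc])
      show "integrable lborel (\<lambda>s. indicator {0..H y} s * \<bar>Gd (T s y)\<bar>)"
        using Gdc by (intro indicator_Icc_integrable continuous_intros)
      show "\<bar>indicator {0..u} s * Gd (T s y)\<bar> \<le> indicator {0..H y} s * \<bar>Gd (T s y)\<bar>" for s
        using u by (auto simp: indicator_def)
    qed
    also have "\<dots> = g y" unfolding g_def by (rule integral_Ico_Icc[symmetric]) measurable
    finally show ?thesis .
  qed
  define D where "D y = G y - G (F y)" for y
  have D [measurable]: "D \<in> borel_measurable borel" unfolding D_def by measurable
  have D2b: "\<bar>D y\<bar> \<le> 2 * b" for y using Gb(1)[of y] Gb(1)[of "F y"] unfolding D_def by linarith
  have p2: "\<bar>D y\<bar> \<le> g y" if "y \<in> Y" for y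
    using p1[of "H y" y] H_nonneg[OF that] F_eq[OF that] by (simp add: D_def abs_minus_commute)
  have p3: "\<bar>(\<integral>u. indicator {0..<H y} u * (G (T u y) * a (T u y)) \<partial>lborel) - G y * \<Phi> y\<bar> \<le> H y * g y"
    if y: "y \<in> Y" for y
  proof -
    have i1: "integrable lborel (\<lambda>u. indicator {0..<H y} u * (G (T u y) * a (T u y)))"
    proof (rule integrable_Ico_bdd[where b=b])
      show "\<bar>G (T u y) * a (T u y)\<bar> \<le> b" for u
        using mult_mono[OF Gb(1) a1, of "T u y" "T u y"] b0 by (simp add: abs_mult)
    qed measurable
    have i2: "integrable lborel (\<lambda>u. indicator {0..<H y} u * a (T u y))"
      by (rule integrable_Ico_bdd[where b=1]) (use a1 in auto)
    have "\<Phi> y = (\<integral>u. indicator {0..<H y} u * a (T u y) \<partial>lborel)"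
      unfolding \<Phi>_def I_lborel[OF oa] by (rule integral_Ico_Icc[symmetric]) measurable
    then have eq: "(\<integral>u. indicator {0..<H y} u * (G (T u y) * a (T u y)) \<partial>lborel) - G y * \<Phi> y
      = (\<integral>u. indicator {0..<H y} u * (G (T u y) * a (T u y)) - G y * (indicator {0..<H y} u * a (T u y)) \<partial>lborel)"
      using i1 i2 by simp
    have "\<bar>(\<integral>u. indicator {0..<H y} u * (G (T u y) * a (T u y)) \<partial>lborel) - G y * \<Phi> y\<bar>
      \<le> (\<integral>u. \<bar>indicator {0..<H y} u * (G (T u y) * a (T u y)) - G y * (indicator {0..<H y} u * a (T u y))\<bar> \<partial>lborel)"
      unfolding eq by (rule integral_abs_bound)
    also have "\<dots> \<le> (\<integral>u. indicator {0..<H y} u * g y \<partial>lborel)"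
    proof (rule integral_mono)
      show "integrable lborel (\<lambda>u. \<bar>indicator {0..<H y} u * (G (T u y) * a (T u y)) - G y * (indicator {0..<H y} u * a (T u y))\<bar>)"
        using i1 i2 by simp
      show "integrable lborel (\<lambda>u. indicator {0..<H y} u * g y)"
        by (rule integrable_Ico_bdd[where b="\<bar>g y\<bar>"]) auto
      fix u
      show "\<bar>indicator {0..<H y} u * (G (T u y) * a (T u y)) - G y * (indicator {0..<H y} u * a (T u y))\<bar> \<le> indicator {0..<H y} u * g y"
      proof (cases "u \<in> {0..<H y}")
        case True
        have "\<bar>(G (T u y) - G y) * a (T u y)\<bar> \<le> g y * 1"
          unfolding abs_mult using p1[of u y] True a1 g0 by (intro mult_mono) auto
        then show ?thesis using True by (simp add: algebra_simps)
      qed simp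
    qed
    also have "\<dots> = H y * g y" using H_nonneg[OF y] by simp
    finally show ?thesis .
  qed
  have funF [measurable]: "(F ^^ n) \<in> borel_measurable borel" for n by (induction n) auto
  have iu: "integrable \<mu>Y (\<lambda>y. u y * \<Phi> y)" if "u \<in> borel_measurable borel" "\<And>y. \<bar>u y\<bar> \<le> c" for u c
  proof (rule Bochner_Integration.integrable_bound)
    show "integrable \<mu>Y (\<lambda>y. c * \<Phi> y)" using \<Phi>i by simp
    have "0 \<le> c" using that(2) order_trans abs_ge_zero by blast
    then show "AE y in \<mu>Y. norm (u y * \<Phi> y) \<le> norm (c * \<Phi> y)"
      using that(2) by (auto simp: abs_mult intro!: mult_right_mono)
    show "(\<lambda>y. u y * \<Phi> y) \<in> borel_measurable \<mu>Y" using that(1) by measurable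
  qed
  define E where "E = (\<integral>y. \<bar>D y\<bar> \<partial>\<mu>Y)"
  have E0: "0 \<le> E" by (simp add: E_def)
  have dec: "\<bar>\<integral>y. u ((F ^^ Suc n) y) * \<Phi> y \<partial>\<mu>Y\<bar> \<le> Cd * \<gamma> ^ n * (\<integral>y. \<bar>u y\<bar> \<partial>\<mu>Y)"
    if "u \<in> borel_measurable borel" "\<And>y. \<bar>u y\<bar> \<le> c" for u c n
    using a that unfolding adm_def \<Phi>_def by blast
  \<comment> \<open>telescoping of \<open>G\<close> along \<open>F\<close>: every term but the first is controlled by the decay of correlations\<close>
  have tel: "(\<integral>y. G y * \<Phi> y \<partial>\<mu>Y) = (\<Sum>k<n. \<integral>y. D ((F ^^ k) y) * \<Phi> y \<partial>\<mu>Y) + (\<integral>y. G ((F ^^ n) y) * \<Phi> y \<partial>\<mu>Y)" for n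
  proof (induction n)
    case (Suc n)
    have "(\<integral>y. G ((F ^^ n) y) * \<Phi> y \<partial>\<mu>Y) = (\<integral>y. D ((F ^^ n) y) * \<Phi> y + G ((F ^^ Suc n) y) * \<Phi> y \<partial>\<mu>Y)"
      by (intro Bochner_Integration.integral_cong) (auto simp: D_def algebra_simps)
    also have "\<dots> = (\<integral>y. D ((F ^^ n) y) * \<Phi> y \<partial>\<mu>Y) + (\<integral>y. G ((F ^^ Suc n) y) * \<Phi> y \<partial>\<mu>Y)"
    proof (rule Bochner_Integration.integral_add)
      show "integrable \<mu>Y (\<lambda>y. D ((F ^^ n) y) * \<Phi> y)" by (rule iu[of _ "2 * b"]) (use D2b in auto)
      show "integrable \<mu>Y (\<lambda>y. G ((F ^^ Suc n) y) * \<Phi> y)" by (rule iu[of _ b]) (use Gb in auto)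
    qed
    finally show ?case using Suc by simp
  qed simp
  have bnd: "\<bar>\<integral>y. G y * \<Phi> y \<partial>\<mu>Y\<bar> \<le> (\<integral>y. H y * g y \<partial>\<mu>Y) + Cd / (1 - \<gamma>) * E + Cd * \<gamma> ^ n * (\<integral>y. \<bar>G y\<bar> \<partial>\<mu>Y)" for n
  proof -
    have "(\<Sum>k<Suc n. \<integral>y. D ((F ^^ k) y) * \<Phi> y \<partial>\<mu>Y) = (\<integral>y. D y * \<Phi> y \<partial>\<mu>Y) + (\<Sum>k<n. \<integral>y. D ((F ^^ Suc k) y) * \<Phi> y \<partial>\<mu>Y)"
      by (subst sum.lessThan_Suc_shift) simp
    then have "\<bar>\<integral>y. G y * \<Phi> y \<partial>\<mu>Y\<bar> \<le> \<bar>\<integral>y. D y * \<Phi> y \<partial>\<mu>Y\<bar> + \<bar>\<Sum>k<n. \<integral>y. D ((F ^^ Suc k) y) * \<Phi> y \<partial>\<mu>Y\<bar> + \<bar>\<integral>y. G ((F ^^ Suc n) y) * \<Phi> y \<partial>\<mu>Y\<bar>"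
      using tel[of "Suc n"] by linarith
    moreover have "\<bar>\<integral>y. D y * \<Phi> y \<partial>\<mu>Y\<bar> \<le> (\<integral>y. H y * g y \<partial>\<mu>Y)"
    proof -
      have "\<bar>\<integral>y. D y * \<Phi> y \<partial>\<mu>Y\<bar> \<le> (\<integral>y. \<bar>D y * \<Phi> y\<bar> \<partial>\<mu>Y)" by (rule integral_abs_bound)
      also have "\<dots> \<le> (\<integral>y. H y * g y \<partial>\<mu>Y)"
      proof (rule integral_mono_AE)
        show "integrable \<mu>Y (\<lambda>y. \<bar>D y * \<Phi> y\<bar>)" using iu[of D "2 * b"] D2b by simp
        show "AE y in \<mu>Y. \<bar>D y * \<Phi> y\<bar> \<le> H y * g y"
          using AE_Y
        proof eventually_elim
          case (elim y)
          have "\<bar>D y\<bar> * \<bar>\<Phi> y\<bar> \<le> g y * H y"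
            using p2[OF elim] \<Phi>H[of y] H_nonneg[OF elim] g0 by (intro mult_mono) auto
          then show ?case by (simp add: abs_mult mult.commute)
        qed
      qed (rule Hgi)
      finally show ?thesis .
    qed
    moreover have "\<bar>\<Sum>k<n. \<integral>y. D ((F ^^ Suc k) y) * \<Phi> y \<partial>\<mu>Y\<bar> \<le> Cd / (1 - \<gamma>) * E"
    proof -
      have "\<bar>\<Sum>k<n. \<integral>y. D ((F ^^ Suc k) y) * \<Phi> y \<partial>\<mu>Y\<bar> \<le> (\<Sum>k<n. \<bar>\<integral>y. D ((F ^^ Suc k) y) * \<Phi> y \<partial>\<mu>Y\<bar>)" by (rule sum_abs)
      also have "\<dots> \<le> (\<Sum>k<n. Cd * \<gamma> ^ k * E)" unfolding E_def by (intro sum_mono dec[OF D D2b])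
      also have "\<dots> = (\<Sum>k<n. \<gamma> ^ k) * (Cd * E)" by (simp add: sum_distrib_left sum_distrib_right ac_simps)
      also have "\<dots> \<le> (1 / (1 - \<gamma>)) * (Cd * E)"
      proof (rule mult_right_mono)
        have "(\<Sum>k<n. \<gamma> ^ k) = (1 - \<gamma> ^ n) / (1 - \<gamma>)" using sum_gp_strict[of \<gamma> n] decay_const by simp
        also have "\<dots> \<le> 1 / (1 - \<gamma>)" using decay_const by (intro divide_right_mono) auto
        finally show "(\<Sum>k<n. \<gamma> ^ k) \<le> 1 / (1 - \<gamma>)" .
      qed (use decay_const E0 in auto)
      finally show ?thesis by simp
    qed
    moreover have "\<bar>\<integral>y. G ((F ^^ Suc n) y) * \<Phi> y \<partial>\<mu>Y\<bar> \<le> Cd * \<gamma> ^ n * (\<integral>y. \<bar>G y\<bar> \<partial>\<mu>Y)"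
      by (rule dec[of G b]) (use Gb in auto)
    ultimately show ?thesis by linarith
  qed
  have "(\<lambda>n. (\<integral>y. H y * g y \<partial>\<mu>Y) + Cd / (1 - \<gamma>) * E + Cd * \<gamma> ^ n * (\<integral>y. \<bar>G y\<bar> \<partial>\<mu>Y))
      \<longlonglongrightarrow> (\<integral>y. H y * g y \<partial>\<mu>Y) + Cd / (1 - \<gamma>) * E + Cd * 0 * (\<integral>y. \<bar>G y\<bar> \<partial>\<mu>Y)"
    using decay_const by (intro tendsto_intros LIMSEQ_power_zero) auto
  then have "\<bar>\<integral>y. G y * \<Phi> y \<partial>\<mu>Y\<bar> \<le> (\<integral>y. H y * g y \<partial>\<mu>Y) + Cd / (1 - \<gamma>) * E + Cd * 0 * (\<integral>y. \<bar>G y\<bar> \<partial>\<mu>Y)"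
    by (rule LIMSEQ_le_const) (use bnd in auto)
  moreover have "E \<le> (\<integral>y. g y \<partial>\<mu>Y)"
    unfolding E_def
  proof (rule integral_mono_AE)
    show "integrable \<mu>Y (\<lambda>y. \<bar>D y\<bar>)" using D2b by (intro Y.integrable_const_bound[of _ "2 * b"]) auto
    show "AE y in \<mu>Y. \<bar>D y\<bar> \<le> g y" using AE_Y p2 by (auto elim: eventually_mono)
  qed (rule gi)
  then have "Cd / (1 - \<gamma>) * E \<le> Cd / (1 - \<gamma>) * (\<integral>y. g y \<partial>\<mu>Y)" using decay_const by (intro mult_left_mono) auto
  ultimately have A: "\<bar>\<integral>y. G y * \<Phi> y \<partial>\<mu>Y\<bar> \<le> (\<integral>y. H y * g y \<partial>\<mu>Y) + Cd / (1 - \<gamma>) * (\<integral>y. g y \<partial>\<mu>Y)" by simp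
  have Gab: "\<bar>G x * a x\<bar> \<le> b" for x
    using mult_mono[OF Gb(1) a1, of x x] b0 by (simp add: abs_mult)
  have iGa: "integrable Q (\<lambda>p. G (T (snd p) (fst p)) * a (T (snd p) (fst p)))"
    using Gab by (intro Q.integrable_const_bound[of _ b]) auto
  define k where "k y = (\<integral>u. indicator {0..<H y} u * (G (T u y) * a (T u y)) \<partial>lborel)" for y
  have ki: "integrable \<mu>Y k" unfolding k_def using integral_Q(2)[OF iGa] by simp
  have GPi: "integrable \<mu>Y (\<lambda>y. G y * \<Phi> y)" using iu[of G b] Gb by simp
  have "(\<integral>x. G x * a x \<partial>MM) = (\<integral>y. k y \<partial>\<mu>Y)"
    unfolding k_def by (subst integral_MM, measurable) (use integral_Q(1)[OF iGa] in simp)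
  moreover have "(\<integral>y. k y \<partial>\<mu>Y) = (\<integral>y. k y - G y * \<Phi> y \<partial>\<mu>Y) + (\<integral>y. G y * \<Phi> y \<partial>\<mu>Y)" using ki GPi by simp
  moreover have "\<bar>\<integral>y. k y - G y * \<Phi> y \<partial>\<mu>Y\<bar> \<le> (\<integral>y. \<bar>k y - G y * \<Phi> y\<bar> \<partial>\<mu>Y)" by (rule integral_abs_bound)
  moreover have "(\<integral>y. \<bar>k y - G y * \<Phi> y\<bar> \<partial>\<mu>Y) \<le> (\<integral>y. H y * g y \<partial>\<mu>Y)"
    using ki GPi Hgi AE_Y p3[folded k_def] by (intro integral_mono_AE) (auto elim: eventually_mono)
  ultimately have "\<bar>\<integral>x. G x * a x \<partial>MM\<bar> \<le> 2 * (\<integral>y. H y * g y \<partial>\<mu>Y) + Cd / (1 - \<gamma>) * (\<integral>y. g y \<partial>\<mu>Y)"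
    using A by linarith
  also have "\<dots> \<le> (2 + Cd / (1 - \<gamma>)) * ((\<integral>y. H y * g y \<partial>\<mu>Y) + (\<integral>y. g y \<partial>\<mu>Y))"
  proof -
    have "0 \<le> (\<integral>y. g y \<partial>\<mu>Y)" using g0 by simp
    moreover have "0 \<le> (\<integral>y. H y * g y \<partial>\<mu>Y)"
      using AE_Y H_nonneg g0 by (intro integral_nonneg_AE) (auto elim!: eventually_mono)
    moreover from this have "0 \<le> Cd / (1 - \<gamma>) * (\<integral>y. H y * g y \<partial>\<mu>Y)"
      using decay_const by (intro mult_nonneg_nonneg) auto
    ultimately show ?thesis by (simp add: distrib_left distrib_right)
  qed
  also have "(\<integral>y. H y * g y \<partial>\<mu>Y) + (\<integral>y. g y \<partial>\<mu>Y) = (\<integral>y. (H y + 1) * g y \<partial>\<mu>Y)"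
    using Hgi gi by (simp add: distrib_right)
  finally show ?thesis unfolding eq1 .
qed

section \<open>Iterated integrals along the flow\<close>

definition S :: "('a \<Rightarrow> real) \<Rightarrow> ('a \<Rightarrow> real) \<Rightarrow> 'a \<Rightarrow> real \<Rightarrow> real" where
  "S a b x t = integral {0..t} (\<lambda>s. I a x s * b (T s x))"

lemma S_cont: "ob a \<Longrightarrow> ob b \<Longrightarrow> continuous_on {0..} (\<lambda>s. I a x s * b (T s x))"
  using I_cont[of a x] by (intro continuous_on_mult) (auto simp: ob_def)

lemma S_measurable:
  assumes a: "ob a" and b: "ob b" and [measurable]: "f \<in> borel_measurable N" "g \<in> borel_measurable N"
  shows "(\<lambda>x. S a b (f x) (g x)) \<in> borel_measurable N"
proof -
  have [measurable]: "b \<in> borel_measurable borel" using b by (simp add: ob_def)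
  note I_measurable[OF a, measurable]
  have "(\<lambda>(x, s). indicator {0..g x} s * (I a (f x) s * b (T s (f x)))) \<in> borel_measurable (N \<Otimes>\<^sub>M lborel)"
    unfolding indicator_def split_beta' by simp
  then show ?thesis unfolding S_def integral_Icc_lborel[OF S_cont[OF a b]]
    by (rule lborel.borel_measurable_lebesgue_integral)
qed

lemma S_deriv:
  assumes "ob a" "ob b" "0 \<le> t"
  shows "(S a b x has_real_derivative I a x t * b (T t x)) (at t within {0..})"
  using integral_Icc_deriv[OF S_cont[of a b x] assms(3)] assms unfolding S_def[abs_def] by auto

lemma S_bound: assumes "ob a" "ob b" "0 \<le> t" shows "\<bar>S a b x t\<bar> \<le> t * t"
proof -
  have "norm (integral {0..t} (\<lambda>s. I a x s * b (T s x))) \<le> t * (t - 0)"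
  proof (rule integral_bound)
    show "continuous_on {0..t} (\<lambda>s. I a x s * b (T s x))"
      using S_cont[OF assms(1,2)] by (rule continuous_on_subset) auto
    fix s assume s: "s \<in> {0..t}"
    have "\<bar>I a x s\<bar> * \<bar>b (T s x)\<bar> \<le> t * 1"
      using I_bound[OF assms(1), of s x] s assms by (intro mult_mono) (auto simp: ob_def)
    then show "norm (I a x s * b (T s x)) \<le> t" by (simp add: abs_mult)
  qed (use assms in auto)
  then show ?thesis by (simp add: S_def)
qed

text \<open>Chen's relation for iterated integrals: inserting \<open>I_shift\<close> for the inner
  integral leaves the shifted outer integral and a product of increments.\<close>

lemma S_shift:
  assumes a: "ob a" and b: "ob b" and t: "0 \<le> t" "0 \<le> u"
  shows "S a b (T u x) t = S a b x (t + u) - S a b x u - I a x u * (I b x (t + u) - I b x u)"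
proof -
  have cb: "continuous_on {0..} (\<lambda>s. b (T s x))" using b by (simp add: ob_def)
  have c: "continuous_on {0..t} (\<lambda>s. f (s + u))" if "continuous_on {0..} f" for f :: "real \<Rightarrow> real"
    using t by (intro continuous_on_compose2[OF that]) (auto intro!: continuous_intros)
  have "S a b (T u x) t = integral {0..t} (\<lambda>s. I a x (s + u) * b (T (s + u) x) - I a x u * b (T (s + u) x))"
    unfolding S_def using a t by (intro integral_cong) (simp add: T_add I_shift algebra_simps)
  also have "\<dots> = integral {0..t} (\<lambda>s. I a x (s + u) * b (T (s + u) x)) - integral {0..t} (\<lambda>s. I a x u * b (T (s + u) x))"
    using c[OF S_cont[OF a b]] c[OF cb] by (intro Henstock_Kurzweil_Integration.integral_diff integrable_continuous_real continuous_on_mult_left)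
  also have "\<dots> = (S a b x (t + u) - S a b x u) - I a x u * (I b x (t + u) - I b x u)"
    unfolding integral_mult_right
    using integral_Icc_shift[OF S_cont[OF a b] t] integral_Icc_shift[OF cb t] by (simp add: S_def I_def)
  finally show ?thesis by simp
qed

text \<open>For \<open>q = r - 1\<close> this is the derivative of
  \<open>\<bar>x\<bar> powr r\<close> up to the factor \<open>r\<close>.\<close>

definition \<psi> :: "real \<Rightarrow> real \<Rightarrow> real" where "\<psi> q x = sgn x * \<bar>x\<bar> powr q"

lemma \<psi>_meas [measurable]: "\<psi> q \<in> borel_measurable borel"
  unfolding \<psi>_def by measurable

lemma abs_\<psi>: "\<bar>\<psi> q x\<bar> = \<bar>x\<bar> powr q"
  by (simp add: \<psi>_def abs_mult abs_sgn_eq)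

lemma \<psi>_deriv: "q > 1 \<Longrightarrow> (\<psi> q has_real_derivative q * \<bar>x\<bar> powr (q - 1)) (at x)"
  unfolding \<psi>_def[abs_def] by (rule sgn_powr_deriv)

lemma I_flow_deriv:
  assumes "ob a" "0 \<le> t" "0 \<le> u"
  shows "((\<lambda>u. I a (T u x) t) has_real_derivative a (T t (T u x)) - a (T u x)) (at u within {0..})"
proof (rule deriv_transform_Ici[OF _ assms(3)])
  show "I a (T u x) t = I a x (t + u) - I a x u" if "0 \<le> u" for u
    using I_shift[OF assms(1,2) that] .
  show "((\<lambda>u. I a x (t + u) - I a x u) has_real_derivative a (T t (T u x)) - a (T u x)) (at u within {0..})"
    using deriv_shift[OF I_deriv[of a "t + u" x], of] I_deriv[of a u x] assms
    by (auto intro!: DERIV_diff simp: T_add)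
qed

text \<open>After differentiating \<open>S_shift\<close>, the terms regroup into flow integrals
  started at \<open>T u x\<close>: the new end point contributes \<open>b * I a\<close>, and the
  lost starting point removes \<open>a * I b\<close>.\<close>

lemma S_flow_deriv:
  assumes a: "ob a" and b: "ob b" and t: "0 \<le> t" "0 \<le> u"
  shows "((\<lambda>u. S a b (T u x) t) has_real_derivative
     b (T t (T u x)) * I a (T u x) t - a (T u x) * I b (T u x) t) (at u within {0..})"
proof (rule deriv_transform_Ici[OF _ t(2)])
  show "S a b (T u x) t = S a b x (t + u) - S a b x u - I a x u * (I b x (t + u) - I b x u)" if "0 \<le> u" for u
    using S_shift[OF a b t(1) that] .
  have 1: "((\<lambda>u. S a b x (t + u)) has_real_derivative I a x (t + u) * b (T (t + u) x)) (at u within {0..})"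
    using S_deriv[OF a b, of "t + u" x] t by (intro deriv_shift) auto
  have 2: "((\<lambda>u. I b x (t + u)) has_real_derivative b (T (t + u) x)) (at u within {0..})"
    using I_deriv[OF b, of "t + u" x] t by (intro deriv_shift) auto
  show "((\<lambda>u. S a b x (t + u) - S a b x u - I a x u * (I b x (t + u) - I b x u)) has_real_derivative
     b (T t (T u x)) * I a (T u x) t - a (T u x) * I b (T u x) t) (at u within {0..})"
    using t by (rule_tac DERIV_cong[OF DERIV_diff[OF DERIV_diff[OF 1 S_deriv[OF a b t(2)]]
        DERIV_mult[OF I_deriv[OF a t(2)] DERIV_diff[OF 2 I_deriv[OF b t(2)]]]]])
      (simp add: T_add I_shift[OF a t] I_shift[OF b t] algebra_simps)
qed

lemma flow_cont_compose:
  "continuous_on {0..} (\<lambda>u. a (T u x)) \<Longrightarrow> 0 \<le> t \<Longrightarrow> continuous_on {0..} (\<lambda>u. a (T t (T u x)))"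
proof -
  assume c: "continuous_on {0..} (\<lambda>u. a (T u x))" and t: "0 \<le> t"
  have "continuous_on {0..} (\<lambda>u. a (T (t + u) x))"
    using t by (intro continuous_on_compose2[OF c]) (auto intro!: continuous_intros)
  then show ?thesis using t by (subst continuous_on_cong[OF refl, of _ _ "\<lambda>u. a (T (t + u) x)"]) (auto simp: T_add)
qed

lemma I_flow_cont: assumes "ob a" "0 \<le> t" shows "continuous_on {0..} (\<lambda>u. I a (T u x) t)"
  using DERIV_continuous_on[OF I_flow_deriv[OF assms]] by force

lemma S_flow_cont: assumes "ob a" "ob b" "0 \<le> t" shows "continuous_on {0..} (\<lambda>u. S a b (T u x) t)"
  using DERIV_continuous_on[OF S_flow_deriv[OF assms]] by force

end

section \<open>Moments of flow integrals\<close>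

text \<open>With \<open>B\<close> the supremum over \<open>[0, t0]\<close>, \<open>step\<close>
  gives \<open>B \<le> B / 2 + N\<close>. The crude bound \<open>B0\<close> matters only for the
  finiteness of \<open>B\<close>.\<close>

lemma sup_bootstrap:
  fixes f :: "real \<Rightarrow> real"
  assumes t0: "0 \<le> t0" and bd: "\<And>s. 0 \<le> s \<Longrightarrow> s \<le> t0 \<Longrightarrow> f s \<le> B0"
    and step: "\<And>t B. 0 \<le> t \<Longrightarrow> t \<le> t0 \<Longrightarrow> (\<And>s. 0 \<le> s \<Longrightarrow> s \<le> t0 \<Longrightarrow> f s \<le> B) \<Longrightarrow> f t \<le> B / 2 + N"
  shows "f t0 \<le> 2 * N"
proof -
  define B where "B = (SUP s\<in>{0..t0}. f s)"
  have bdd: "bdd_above (f ` {0..t0})" using bd by (intro bdd_aboveI[of _ B0]) auto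
  have fB: "f s \<le> B" if "0 \<le> s" "s \<le> t0" for s
    unfolding B_def using bdd that by (intro cSUP_upper) auto
  have "B \<le> B / 2 + N"
    unfolding B_def
  proof (rule cSUP_least)
    show "{0..t0} \<noteq> {}" using t0 by simp
    fix t assume "t \<in> {0..t0}"
    then show "f t \<le> (SUP s\<in>{0..t0}. f s) / 2 + N"
      using step[of t B] fB by (simp add: B_def)
  qed
  then show ?thesis using fB[OF t0 order_refl] by linarith
qed

lemma powr_sum_le:
  fixes x y r :: real assumes "0 \<le> x" "0 \<le> y" "0 \<le> r"
  shows "(x + y) powr r \<le> 2 powr r * (x powr r + y powr r)"
proof -
  have "(x + y) powr r \<le> (2 * max x y) powr r" using assms by (intro powr_mono2) auto
  also have "\<dots> = 2 powr r * max x y powr r" using assms by (simp add: powr_mult)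
  also have "max x y powr r \<le> x powr r + y powr r" by (auto simp: max_def)
  finally show ?thesis by simp
qed

text \<open>Trades a product for separate powers, so that roof and flow integral can be integrated
  apart. With \<open>z\<close> the maximum of 1, \<open>x\<close> and \<open>v\<close>, the product
  is at most the cube of \<open>z\<close>; including 1 in the maximum is what allows the step from
  square to cube.\<close>

lemma powr_third_le:
  fixes x v q :: real assumes "0 \<le> x" "0 \<le> v" "0 \<le> q"
  shows "(x * v) powr (q / 3) \<le> 1 + x powr q + v powr q"
proof -
  define z where "z = max 1 (max x v)"
  have z: "1 \<le> z" "x \<le> z" "v \<le> z" by (auto simp: z_def)
  have "x * v \<le> z * z" using z assms by (intro mult_mono) auto
  also have "\<dots> \<le> z * z * z" using z by (simp add: mult_le_cancel_left1)
  also have "\<dots> = z powr 3" using z by (simp add: powr_numeral power3_eq_cube)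
  finally have "(x * v) powr (q / 3) \<le> (z powr 3) powr (q / 3)" using assms by (intro powr_mono2) auto
  also have "\<dots> = z powr q" by (simp add: powr_powr)
  also have "\<dots> \<le> 1 + x powr q + v powr q" by (auto simp: z_def max_def)
  finally show ?thesis .
qed

context suspension_flow
begin

definition K :: real where "K = 2 + Cd / (1 - \<gamma>)"

lemma K_pos: "K > 0" using decay_const by (simp add: K_def add_pos_nonneg)

lemma AE_Q: "AE p in Q. 0 < H (fst p)"
proof -
  have "AE p in \<mu>Y \<Otimes>\<^sub>M lborel. 0 < (indicator QS p :: ennreal) \<longrightarrow> 0 < H (fst p)"
    by (intro AE_I2) (auto simp: QS_def indicator_def)
  then show ?thesis unfolding Q_def by (subst AE_density) auto
qed

text \<open>Moving the starting point changes a flow integral only through the two end values of the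
  observable; hence the derivative has size \<open>\<bar>I a x t\<bar> powr (r - 2)\<close> up to a
  constant free of \<open>t\<close>.\<close>

lemma fC1_I:
  assumes a: "ob a" and t: "0 \<le> t" and r: "r > 2"
  shows "fC1 (\<lambda>x. \<psi> (r - 1) (I a x t)) (\<lambda>x. (r - 1) * \<bar>I a x t\<bar> powr (r - 2) * (a (T t x) - a x))
     (t powr (r - 1) + (r - 1) * t powr (r - 2) * 2)"
proof -
  have am [measurable]: "a \<in> borel_measurable borel" and a1: "\<And>x. \<bar>a x\<bar> \<le> 1"
    and ac: "\<And>x. continuous_on {0..} (\<lambda>t. a (T t x))" using a by (auto simp: ob_def)
  note I_measurable[OF a, measurable]
  have b1: "\<bar>\<psi> (r - 1) (I a x t)\<bar> \<le> t powr (r - 1)" for x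
    unfolding abs_\<psi> using I_bound[OF a t] r t by (intro powr_mono2) auto
  have b2: "\<bar>(r - 1) * \<bar>I a x t\<bar> powr (r - 2) * (a (T t x) - a x)\<bar> \<le> (r - 1) * t powr (r - 2) * 2" for x
  proof -
    have "\<bar>I a x t\<bar> powr (r - 2) \<le> t powr (r - 2)" using I_bound[OF a t] r t by (intro powr_mono2) auto
    moreover have "\<bar>a (T t x) - a x\<bar> \<le> 2" using a1[of x] a1[of "T t x"] by linarith
    ultimately show ?thesis using r by (simp add: abs_mult mult_mono)
  qed
  have nn: "0 \<le> t powr (r - 1)" "0 \<le> (r - 1) * t powr (r - 2) * 2" using r by auto
  have bnd: "\<bar>\<psi> (r - 1) (I a x t)\<bar> \<le> t powr (r - 1) + (r - 1) * t powr (r - 2) * 2"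
    "\<bar>(r - 1) * \<bar>I a x t\<bar> powr (r - 2) * (a (T t x) - a x)\<bar> \<le> t powr (r - 1) + (r - 1) * t powr (r - 2) * 2" for x
    using b1[of x] b2[of x] nn by linarith+
  have der: "((\<lambda>u. \<psi> (r - 1) (I a (T u x) t)) has_real_derivative
      (r - 1) * \<bar>I a (T u x) t\<bar> powr (r - 2) * (a (T t (T u x)) - a (T u x))) (at u within {0..})"
    if "0 \<le> u" for x u
    using DERIV_chain2[OF \<psi>_deriv[of "r - 1"] I_flow_deriv[OF a t that, of x]] r by (simp add: algebra_simps)
  have cont: "continuous_on {0..} (\<lambda>u. (r - 1) * \<bar>I a (T u x) t\<bar> powr (r - 2) * (a (T t (T u x)) - a (T u x)))" for x
  proof -
    have "continuous_on {0..} (\<lambda>u. \<bar>I a (T u x) t\<bar> powr (r - 2))"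
      using r by (intro continuous_on_powr' continuous_on_rabs I_flow_cont[OF a t] continuous_on_const) auto
    then show ?thesis
      by (intro continuous_on_mult continuous_on_diff continuous_on_const flow_cont_compose[OF ac t] ac)
  qed
  have m: "(\<lambda>x. \<psi> (r - 1) (I a x t)) \<in> borel_measurable borel"
    "(\<lambda>x. (r - 1) * \<bar>I a x t\<bar> powr (r - 2) * (a (T t x) - a x)) \<in> borel_measurable borel"
    by measurable
  show ?thesis unfolding fC1_def by (intro conjI allI impI m bnd der cont)
qed

text \<open>Young's inequality, applied with \<open>k = 2\<close> to \<open>H + 1\<close> times the
  power \<open>r - 2\<close> of the flow integral, raises the weight to the power
  \<open>r / 2 = q\<close>, the integrable one, and turns the small parameter of order
  \<open>1 / t0\<close> into the growth \<open>t0 powr q\<close>.\<close>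

theorem moment_I:
  assumes q: "q > 1" and iH: "integrable Q (\<lambda>p. (H (fst p) + 1) powr q)" and a: "adm a" and t0: "t0 > 0"
  shows "(\<integral>x. \<bar>I a x t0\<bar> powr (2 * q) \<partial>MM)
    \<le> (2 * (4 * q * (2 * q - 1) * K)) powr q * (\<integral>p. (H (fst p) + 1) powr q \<partial>Q) * t0 powr q"
proof -
  define r where "r = 2 * q"
  have r: "r > 2" using q by (simp add: r_def)
  have oa: "ob a" using a by (simp add: adm_def)
  have am [measurable]: "a \<in> borel_measurable borel" and a1: "\<And>x. \<bar>a x\<bar> \<le> 1"
    and ac: "\<And>x. continuous_on {0..} (\<lambda>t. a (T t x))" using oa by (auto simp: ob_def)
  note Im [measurable] = I_measurable[OF oa]
  define W where "W = (\<integral>p. (H (fst p) + 1) powr q \<partial>Q)"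
  \<comment> \<open>\<open>r\<close> stems from differentiating the power, \<open>K\<close> from
    \<open>key_estimate\<close>, \<open>r - 1\<close> from the derivative of
    \<open>\<psi> (r - 1)\<close>, and 2 bounds the difference of two values of
    \<open>a\<close>.\<close>
  define c where "c = 2 * r * (r - 1) * K"
  have c0: "0 < c" using r K_pos by (simp add: c_def)
  \<comment> \<open>Integration over time multiplies by at most \<open>t0\<close>, so this value
    returns half of the supremum, as \<open>sup_bootstrap\<close> requires.\<close>
  define \<delta> where "\<delta> = 1 / (2 * t0)"
  have \<delta>: "\<delta> > 0" using t0 by (simp add: \<delta>_def)
  define f where "f t = (\<integral>x. \<bar>I a x t\<bar> powr r \<partial>MM)" for t
  have Ib: "\<bar>I a x s\<bar> powr r \<le> t0 powr r" if "0 \<le> s" "s \<le> t0" for x s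
    using I_bound[OF oa that(1), of x] that r by (intro powr_mono2) auto
  have "f t0 \<le> 2 * ((2 * c * t0) powr q * W / 2)"
  proof (rule sup_bootstrap[where f=f and ?t0.0=t0 and ?B0.0="t0 powr r * measure MM UNIV"])
    show "0 \<le> t0" using t0 by simp
    show "f s \<le> t0 powr r * measure MM UNIV" if s: "0 \<le> s" "s \<le> t0" for s
    proof -
      have "f s \<le> (\<integral>x. t0 powr r \<partial>MM)" unfolding f_def
        using Ib[OF s] by (intro integral_mono MM.integrable_const_bound[of _ "t0 powr r"]) auto
      then show ?thesis by (simp add: mult.commute)
    qed
    fix t B assume t: "0 \<le> t" "t \<le> t0" and fB: "\<And>s. 0 \<le> s \<Longrightarrow> s \<le> t0 \<Longrightarrow> f s \<le> B"
    define B' where "B' = \<delta> * B + \<delta> * ((2 * c * t0) powr q * W)"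
    have "f t \<le> t * B'"
      unfolding f_def
    proof (rule flow_average[where k="\<lambda>s x. r * \<psi> (r - 1) (I a x (t - s)) * a x" and b="r * t powr (r - 1)"])
      show "(\<lambda>p. r * \<psi> (r - 1) (I a (snd p) (t - fst p)) * a (snd p)) \<in> borel_measurable (borel \<Otimes>\<^sub>M borel)"
        by measurable
      show "\<bar>r * \<psi> (r - 1) (I a x (t - s)) * a x\<bar> \<le> r * t powr (r - 1)" if s: "0 \<le> s" "s \<le> t" for s x
      proof -
        have "\<bar>\<psi> (r - 1) (I a x (t - s))\<bar> \<le> t powr (r - 1)"
          unfolding abs_\<psi> using I_bound[OF oa, of "t - s" x] s r by (intro powr_mono2) auto
        then have "\<bar>\<psi> (r - 1) (I a x (t - s))\<bar> * \<bar>a x\<bar> \<le> t powr (r - 1) * 1" using a1 by (intro mult_mono) auto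
        then show ?thesis using r by (simp add: abs_mult)
      qed
      show "0 \<le> t" by (rule t)
      show "\<bar>I a x t\<bar> powr r = (\<integral>s. indicator {0..t} s * (r * \<psi> (r - 1) (I a (T s x) (t - s)) * a (T s x)) \<partial>lborel)" for x
      proof -
        let ?h = "\<lambda>s. r * \<psi> (r - 1) (I a x t - I a x s) * a (T s x)"
        \<comment> \<open>The power is written through the remaining integral over
          \<open>[s, t]\<close>, which is the flow integral of length \<open>t - s\<close> started
          at \<open>T s x\<close>; the integrand then has the form \<open>k s (T s x)\<close> that
          \<open>flow_average\<close> needs.\<close>
        have "((\<lambda>s. - (\<bar>I a x t - I a x s\<bar> powr r)) has_real_derivative ?h s) (at s within {0..})" if "0 \<le> s" for s
          using r by (rule_tac DERIV_cong[OF DERIV_minus[OF DERIV_chain2[OF abs_powr_deriv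
               DERIV_diff[OF DERIV_const I_deriv[OF oa that]]]]]) (auto simp: \<psi>_def)
        from ftc_Ici[OF this t(1)] have "integral {0..t} ?h = \<bar>I a x t\<bar> powr r" using r by simp
        moreover have "continuous_on {0..} ?h"
        proof -
          have "continuous_on UNIV (\<psi> (r - 1))"
            using \<psi>_deriv[of "r - 1"] r by (intro DERIV_continuous_on) (auto intro: DERIV_subset)
          then have "continuous_on {0..} (\<lambda>s. \<psi> (r - 1) (I a x t - I a x s))"
            by (rule continuous_on_compose2) (auto intro!: continuous_intros I_cont[OF oa])
          then show ?thesis using ac by (intro continuous_intros)
        qed
        ultimately have "\<bar>I a x t\<bar> powr r = (\<integral>s. indicator {0..t} s * ?h s \<partial>lborel)"
          by (simp add: integral_Icc_lborel)
        also have "\<dots> = (\<integral>s. indicator {0..t} s * (r * \<psi> (r - 1) (I a (T s x) (t - s)) * a (T s x)) \<partial>lborel)"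
          by (intro Bochner_Integration.integral_cong) (auto simp: indicator_def I_shift[OF oa])
        finally show ?thesis .
      qed
      fix s assume s: "0 \<le> s" "s \<le> t"
      define s' where "s' = t - s"
      have s': "0 \<le> s'" "s' \<le> t0" using s t by (auto simp: s'_def)
      let ?X = "\<lambda>p. \<bar>I a (T (snd p) (fst p)) s'\<bar>"
      let ?Gd = "\<lambda>x. (r - 1) * \<bar>I a x s'\<bar> powr (r - 2) * (a (T s' x) - a x)"
      note C1 = fC1_I[OF oa s'(1) r]
      have "(\<integral>x. r * \<psi> (r - 1) (I a x s') * a x \<partial>MM) = r * (\<integral>x. \<psi> (r - 1) (I a x s') * a x \<partial>MM)"
        by (simp add: mult.assoc)
      also have "\<dots> \<le> r * (K * (\<integral>p. (H (fst p) + 1) * \<bar>?Gd (T (snd p) (fst p))\<bar> \<partial>Q))"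
        using key_estimate[OF a C1] r unfolding K_def[symmetric] by (intro mult_left_mono) (auto dest: abs_le_D1)
      also have "\<dots> = (\<integral>p. r * (K * ((H (fst p) + 1) * \<bar>?Gd (T (snd p) (fst p))\<bar>)) \<partial>Q)" by simp
      also have "\<dots> \<le> (\<integral>p. \<delta> * ?X p powr r + \<delta> * ((2 * c * t0) powr q * (H (fst p) + 1) powr q) \<partial>Q)"
      proof (rule integral_mono_AE')
        show "integrable Q (\<lambda>p. \<delta> * ?X p powr r + \<delta> * ((2 * c * t0) powr q * (H (fst p) + 1) powr q))"
          using iH integrable_bdd(3)[of "\<lambda>x. \<bar>I a x s'\<bar> powr r" "t0 powr r"] Ib[OF s'] by simp
        show "AE p in Q. r * (K * ((H (fst p) + 1) * \<bar>?Gd (T (snd p) (fst p))\<bar>))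
            \<le> \<delta> * ?X p powr r + \<delta> * ((2 * c * t0) powr q * (H (fst p) + 1) powr q)"
          using AE_Q
        proof eventually_elim
          case (elim p)
          let ?x = "T (snd p) (fst p)"
          have "\<bar>a (T s' ?x) - a ?x\<bar> \<le> 2" using a1[of "T s' ?x"] a1[of ?x] by linarith
          then have "\<bar>?Gd ?x\<bar> \<le> (r - 1) * ?X p powr (r - 2) * 2" using r by (simp add: abs_mult mult_mono)
          then have "r * (K * ((H (fst p) + 1) * \<bar>?Gd ?x\<bar>)) \<le> r * (K * ((H (fst p) + 1) * ((r - 1) * ?X p powr (r - 2) * 2)))"
            using r K_pos elim by (intro mult_left_mono) auto
          also have "\<dots> = (c * (H (fst p) + 1)) * ?X p powr (r - 2)" by (simp add: c_def)
          also have "\<dots> \<le> \<delta> * ?X p powr r + \<delta> * (c * (H (fst p) + 1) / \<delta>) powr (r / 2)"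
            using c0 elim \<delta> r by (intro young_powr) auto
          also have "(c * (H (fst p) + 1) / \<delta>) powr (r / 2) = (2 * c * t0) powr q * (H (fst p) + 1) powr q"
            using c0 elim t0 by (simp add: \<delta>_def r_def powr_mult[symmetric] ac_simps)
          finally show ?case .
        qed
        show "AE p in Q. 0 \<le> \<delta> * ?X p powr r + \<delta> * ((2 * c * t0) powr q * (H (fst p) + 1) powr q)"
          using \<delta> by (intro AE_I2) auto
      qed
      also have "\<dots> = \<delta> * (\<integral>p. ?X p powr r \<partial>Q) + \<delta> * ((2 * c * t0) powr q * W)"
        unfolding W_def using iH integrable_bdd(3)[of "\<lambda>x. \<bar>I a x s'\<bar> powr r" "t0 powr r"] Ib[OF s']
        by simp
      also have "(\<integral>p. ?X p powr r \<partial>Q) = f s'" unfolding f_def by (subst integral_MM) auto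
      also have "\<delta> * f s' + \<delta> * ((2 * c * t0) powr q * W) \<le> B'"
        unfolding B'_def using fB[OF s'] \<delta> by simp
      finally show "(\<integral>x. r * \<psi> (r - 1) (I a x (t - s)) * a x \<partial>MM) \<le> B'" by (simp add: s'_def)
    qed
    also have "t * B' \<le> t0 * B'"
    proof (rule mult_right_mono)
      have "0 \<le> f 0" unfolding f_def by simp
      then have "0 \<le> B" using fB[of 0] t0 by simp
      moreover have "0 \<le> W" unfolding W_def by simp
      ultimately show "0 \<le> B'" using \<delta> by (simp add: B'_def)
    qed (rule t)
    also have "t0 * B' = B / 2 + (2 * c * t0) powr q * W / 2"
      using t0 by (simp add: B'_def \<delta>_def field_simps)
    finally show "f t \<le> B / 2 + (2 * c * t0) powr q * W / 2" .
  qed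
  then have "f t0 \<le> (2 * c * t0) powr q * W" by simp
  also have "\<dots> = (2 * c) powr q * W * t0 powr q" using c0 t0 by (simp add: powr_mult)
  also have "2 * c = 2 * (4 * q * (2 * q - 1) * K)" by (simp add: c_def r_def)
  finally show ?thesis by (simp add: f_def r_def W_def)
qed

section \<open>Moments of the iterated integral\<close>

definition Sd :: "('a \<Rightarrow> real) \<Rightarrow> ('a \<Rightarrow> real) \<Rightarrow> real \<Rightarrow> real \<Rightarrow> 'a \<Rightarrow> real" where
  "Sd a b r t x = (r - 1) * \<bar>S a b x t\<bar> powr (r - 2) * (b (T t x) * I a x t - a x * I b x t) * I b x t
     + \<psi> (r - 1) (S a b x t) * (b (T t x) - b x)"

lemma Sd_bound:
  assumes a: "ob a" and b: "ob b" and r: "r > 2"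
  shows "\<bar>Sd a b r t x\<bar> \<le> (r - 1) * \<bar>S a b x t\<bar> powr (r - 2) * (\<bar>I a x t\<bar> + \<bar>I b x t\<bar>)\<^sup>2 + \<bar>S a b x t\<bar> powr (r - 1) * 2"
proof -
  have a1: "\<bar>a x\<bar> \<le> 1" "\<bar>b x\<bar> \<le> 1" for x using a b by (auto simp: ob_def)
  have "\<bar>b (T t x) * I a x t - a x * I b x t\<bar> \<le> \<bar>b (T t x)\<bar> * \<bar>I a x t\<bar> + \<bar>a x\<bar> * \<bar>I b x t\<bar>"
    using abs_triangle_ineq4[of "b (T t x) * I a x t" "a x * I b x t"] by (simp add: abs_mult)
  also have "\<dots> \<le> 1 * \<bar>I a x t\<bar> + 1 * \<bar>I b x t\<bar>"
    using a1 by (intro add_mono mult_right_mono) auto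
  finally have 1: "\<bar>b (T t x) * I a x t - a x * I b x t\<bar> \<le> \<bar>I a x t\<bar> + \<bar>I b x t\<bar>" by simp
  have "\<bar>(b (T t x) * I a x t - a x * I b x t) * I b x t\<bar> \<le> (\<bar>I a x t\<bar> + \<bar>I b x t\<bar>)\<^sup>2"
    unfolding abs_mult power2_eq_square using 1 by (intro mult_mono) auto
  then have "\<bar>(r - 1) * \<bar>S a b x t\<bar> powr (r - 2) * ((b (T t x) * I a x t - a x * I b x t) * I b x t)\<bar>
      \<le> (r - 1) * \<bar>S a b x t\<bar> powr (r - 2) * (\<bar>I a x t\<bar> + \<bar>I b x t\<bar>)\<^sup>2"
    using r unfolding abs_mult[of "(r - 1) * \<bar>S a b x t\<bar> powr (r - 2)"] by (intro mult_mono) auto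
  moreover have "\<bar>b (T t x) - b x\<bar> \<le> 2" using a1(2)[of x] a1(2)[of "T t x"] by linarith
  then have "\<bar>\<psi> (r - 1) (S a b x t) * (b (T t x) - b x)\<bar> \<le> \<bar>S a b x t\<bar> powr (r - 1) * 2"
    unfolding abs_mult abs_\<psi> by (intro mult_left_mono) auto
  ultimately show ?thesis unfolding Sd_def mult.assoc by linarith
qed

lemma fC1_S:
  assumes a: "ob a" and b: "ob b" and t: "0 \<le> t" and r: "r > 2"
  shows "\<exists>B. fC1 (\<lambda>x. \<psi> (r - 1) (S a b x t) * I b x t) (Sd a b r t) B"
proof -
  have [measurable]: "a \<in> borel_measurable borel" "b \<in> borel_measurable borel"
    and ac: "\<And>x. continuous_on {0..} (\<lambda>t. a (T t x))" "\<And>x. continuous_on {0..} (\<lambda>t. b (T t x))"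
    using a b by (auto simp: ob_def)
  note [measurable] = I_measurable[OF a] I_measurable[OF b] S_measurable[OF a b]
  define B1 where "B1 = (t * t) powr (r - 1) * t"
  define B2 where "B2 = (r - 1) * (t * t) powr (r - 2) * (t + t)\<^sup>2 + (t * t) powr (r - 1) * 2"
  have B0: "0 \<le> B1" "0 \<le> B2" using t r by (auto simp: B1_def B2_def)
  have Sb: "\<bar>S a b x t\<bar> powr k \<le> (t * t) powr k" if "0 \<le> k" for x k
    using S_bound[OF a b t] that by (intro powr_mono2) auto
  have Ib: "\<bar>I a x t\<bar> \<le> t" "\<bar>I b x t\<bar> \<le> t" for x using I_bound[OF a t] I_bound[OF b t] by auto
  have 1: "\<bar>\<psi> (r - 1) (S a b x t) * I b x t\<bar> \<le> B1" for x
    unfolding abs_mult abs_\<psi> B1_def using Sb Ib r by (intro mult_mono) auto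
  have 2: "\<bar>Sd a b r t x\<bar> \<le> B2" for x
  proof -
    have "(r - 1) * \<bar>S a b x t\<bar> powr (r - 2) * (\<bar>I a x t\<bar> + \<bar>I b x t\<bar>)\<^sup>2 + \<bar>S a b x t\<bar> powr (r - 1) * 2 \<le> B2"
      unfolding B2_def using Sb Ib r by (intro add_mono mult_mono mult_nonneg_nonneg power_mono) auto
    then show ?thesis using Sd_bound[OF a b r, of t x] by linarith
  qed
  have der: "((\<lambda>u. \<psi> (r - 1) (S a b (T u x) t) * I b (T u x) t) has_real_derivative Sd a b r t (T u x)) (at u within {0..})"
    if u: "0 \<le> u" for x u
    using r by (rule_tac DERIV_cong[OF DERIV_mult[OF DERIV_chain2[OF \<psi>_deriv S_flow_deriv[OF a b t u]] I_flow_deriv[OF b t u]]])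
      (auto simp: Sd_def algebra_simps)
  have cont: "continuous_on {0..} (\<lambda>u. Sd a b r t (T u x))" for x
  proof -
    have "continuous_on {0..} (\<lambda>u. \<bar>S a b (T u x) t\<bar> powr (r - 2))"
      using r by (intro continuous_on_powr' continuous_on_rabs S_flow_cont[OF a b t] continuous_on_const) auto
    moreover have "continuous_on UNIV (\<psi> (r - 1))"
      using \<psi>_deriv[of "r - 1"] r by (intro DERIV_continuous_on) (auto intro: DERIV_subset)
    then have "continuous_on {0..} (\<lambda>u. \<psi> (r - 1) (S a b (T u x) t))"
      by (rule continuous_on_compose2) (auto intro!: S_flow_cont[OF a b t])
    ultimately show ?thesis unfolding Sd_def
      by (intro continuous_on_mult continuous_on_diff continuous_on_add continuous_on_const
          flow_cont_compose[OF ac(1) t] flow_cont_compose[OF ac(2) t] ac I_flow_cont[OF a t] I_flow_cont[OF b t])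
  qed
  have m: "(\<lambda>x. \<psi> (r - 1) (S a b x t) * I b x t) \<in> borel_measurable borel" "Sd a b r t \<in> borel_measurable borel"
    unfolding Sd_def by measurable
  have "fC1 (\<lambda>x. \<psi> (r - 1) (S a b x t) * I b x t) (Sd a b r t) (B1 + B2)"
    unfolding fC1_def
  proof (intro conjI allI impI m der cont)
    show "\<bar>\<psi> (r - 1) (S a b x t) * I b x t\<bar> \<le> B1 + B2" "\<bar>Sd a b r t x\<bar> \<le> B1 + B2" for x
      using 1[of x] 2[of x] B0 by linarith+
  qed
  then show ?thesis by blast
qed

text \<open>The iterated integral over the remaining time \<open>[s, t]\<close> changes at rate
  \<open>a (T s x)\<close> times an integral of \<open>b\<close>, so decorrelation is applied to
  \<open>a\<close>. The derivative of the smooth factor has one part with the power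
  \<open>r - 2\<close> of the iterated integral and a squared flow integral, and one part with the
  power \<open>r - 1\<close>; Young's inequality is used with \<open>k = 2\<close> and
  \<open>k = 1\<close>. The constant \<open>c\<close> dominates the coefficients
  \<open>r * (r - 1) * K\<close> and \<open>2 * r * K\<close> of the two parts.\<close>

theorem moment_S:
  assumes q: "q > 3" and iH: "integrable Q (\<lambda>p. (H (fst p) + 1) powr q)" and a: "adm a" and b: "ob b" and t0: "t0 > 0"
    and CA: "\<And>s. 0 \<le> s \<Longrightarrow> (\<integral>x. \<bar>I a x s\<bar> powr (2 * q) \<partial>MM) \<le> CA * s powr q"
    and CB: "\<And>s. 0 \<le> s \<Longrightarrow> (\<integral>x. \<bar>I b x s\<bar> powr (2 * q) \<partial>MM) \<le> CA * s powr q"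
  defines "r \<equiv> 2 * q / 3"
  defines "c \<equiv> r * (r + 1) * K"
  defines "W \<equiv> (\<integral>p. (H (fst p) + 1) powr q \<partial>Q)"
  shows "(\<integral>x. \<bar>S a b x t0\<bar> powr r \<partial>MM)
    \<le> ((4 * c) powr (q / 3) * (measure Q UNIV + W + 2 powr (2 * q) * (2 * CA)) + (4 * c) powr r * W) / 2 * t0 powr r"
proof -
  have r: "r > 2" using q by (simp add: r_def)
  have oa: "ob a" using a by (simp add: adm_def)
  have [measurable]: "a \<in> borel_measurable borel" "b \<in> borel_measurable borel"
    and a1: "\<And>x. \<bar>a x\<bar> \<le> 1" "\<And>x. \<bar>b x\<bar> \<le> 1"
    and ac: "\<And>x. continuous_on {0..} (\<lambda>t. a (T t x))" "\<And>x. continuous_on {0..} (\<lambda>t. b (T t x))"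
    using oa b by (auto simp: ob_def)
  note [measurable] = I_measurable[OF oa] I_measurable[OF b] S_measurable[OF oa b]
  have c0: "0 < c" using r K_pos by (simp add: c_def)
  define N where "N = (4 * c) powr (q / 3) * (measure Q UNIV + W + 2 powr (2 * q) * (2 * CA)) + (4 * c) powr r * W"
  have W0: "0 \<le> W" unfolding W_def by simp
  have "0 \<le> (\<integral>x. \<bar>I a x 1\<bar> powr (2 * q) \<partial>MM)" by simp
  moreover have "\<dots> \<le> CA" using CA[of 1] by simp
  ultimately have CA0: "0 \<le> CA" by linarith
  have N0: "0 \<le> N" unfolding N_def using W0 CA0 by auto
  \<comment> \<open>A quarter, since Young's inequality is used twice:
    \<open>2 * \<delta> * t0\<close> is one half.\<close>
  define \<delta> where "\<delta> = 1 / (4 * t0)"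
  have \<delta>: "\<delta> > 0" using t0 by (simp add: \<delta>_def)
  define f where "f t = (\<integral>x. \<bar>S a b x t\<bar> powr r \<partial>MM)" for t
  have Sb: "\<bar>S a b x s\<bar> powr k \<le> (t0 * t0) powr k" if s: "0 \<le> s" "s \<le> t0" and k: "0 \<le> k" for x s k
  proof -
    have "\<bar>S a b x s\<bar> \<le> s * s" by (rule S_bound[OF oa b s(1)])
    also have "\<dots> \<le> t0 * t0" using s by (intro mult_mono) auto
    finally show ?thesis using k by (intro powr_mono2) auto
  qed
  have "f t0 \<le> 2 * (N * t0 powr r / 4)"
  proof (rule sup_bootstrap[where f=f and ?t0.0=t0 and ?B0.0="(t0 * t0) powr r * measure MM UNIV"])
    show "0 \<le> t0" using t0 by simp
    show "f s \<le> (t0 * t0) powr r * measure MM UNIV" if s: "0 \<le> s" "s \<le> t0" for s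
    proof -
      have "f s \<le> (\<integral>x. (t0 * t0) powr r \<partial>MM)" unfolding f_def
        using Sb[OF s, of r] r by (intro integral_mono MM.integrable_const_bound[of _ "(t0 * t0) powr r"]) auto
      then show ?thesis by (simp add: mult.commute)
    qed
    fix t B assume t: "0 \<le> t" "t \<le> t0" and fB: "\<And>s. 0 \<le> s \<Longrightarrow> s \<le> t0 \<Longrightarrow> f s \<le> B"
    define B' where "B' = 2 * \<delta> * B + \<delta> * (N * t0 powr r)"
    have "f t \<le> t * B'"
      unfolding f_def
    proof (rule flow_average[where k="\<lambda>s x. r * (\<psi> (r - 1) (S a b x (t - s)) * I b x (t - s)) * a x" and b="r * ((t0 * t0) powr (r - 1) * t0)"])
      show "(\<lambda>p. r * (\<psi> (r - 1) (S a b (snd p) (t - fst p)) * I b (snd p) (t - fst p)) * a (snd p)) \<in> borel_measurable (borel \<Otimes>\<^sub>M borel)"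
        by measurable
      show "\<bar>r * (\<psi> (r - 1) (S a b x (t - s)) * I b x (t - s)) * a x\<bar> \<le> r * ((t0 * t0) powr (r - 1) * t0)" if s: "0 \<le> s" "s \<le> t" for s x
      proof -
        have "\<bar>\<psi> (r - 1) (S a b x (t - s))\<bar> * \<bar>I b x (t - s)\<bar> \<le> (t0 * t0) powr (r - 1) * t0"
          unfolding abs_\<psi> using Sb[of "t - s" "r - 1" x] I_bound[OF b, of "t - s" x] s t r by (intro mult_mono) auto
        then have "\<bar>\<psi> (r - 1) (S a b x (t - s))\<bar> * \<bar>I b x (t - s)\<bar> * \<bar>a x\<bar> \<le> (t0 * t0) powr (r - 1) * t0 * 1"
          by (rule mult_mono) (use a1 t0 in auto)
        then have "r * (\<bar>\<psi> (r - 1) (S a b x (t - s))\<bar> * \<bar>I b x (t - s)\<bar> * \<bar>a x\<bar>) \<le> r * ((t0 * t0) powr (r - 1) * t0)"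
          using r by (intro mult_left_mono) auto
        then show ?thesis using r by (simp add: abs_mult mult.assoc)
      qed
      show "0 \<le> t" by (rule t)
      show "\<bar>S a b x t\<bar> powr r = (\<integral>s. indicator {0..t} s * (r * (\<psi> (r - 1) (S a b (T s x) (t - s)) * I b (T s x) (t - s)) * a (T s x)) \<partial>lborel)" for x
      proof -
        \<comment> \<open>By \<open>S_shift\<close>, \<open>?R s\<close> is the iterated integral of
          length \<open>t - s\<close> started at \<open>T s x\<close>; in its derivative the terms
          with \<open>b (T s x)\<close> cancel.\<close>
        let ?R = "\<lambda>s. S a b x t - S a b x s - I a x s * (I b x t - I b x s)"
        let ?h = "\<lambda>s. r * (\<psi> (r - 1) (?R s) * (I b x t - I b x s)) * a (T s x)"
        have R: "(?R has_real_derivative - (a (T s x) * (I b x t - I b x s))) (at s within {0..})" if "0 \<le> s" for s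
          by (rule DERIV_cong[OF DERIV_diff[OF DERIV_diff[OF DERIV_const S_deriv[OF oa b that]]
              DERIV_mult[OF I_deriv[OF oa that] DERIV_diff[OF DERIV_const I_deriv[OF b that]]]]])
            (simp add: algebra_simps)
        have "((\<lambda>s. - (\<bar>?R s\<bar> powr r)) has_real_derivative ?h s) (at s within {0..})" if "0 \<le> s" for s
          using r by (rule_tac DERIV_cong[OF DERIV_minus[OF DERIV_chain2[OF abs_powr_deriv R[OF that]]]]) (auto simp: \<psi>_def)
        from ftc_Ici[OF this t(1)] have "integral {0..t} ?h = \<bar>S a b x t\<bar> powr r" using r by (simp add: S_def)
        moreover have "continuous_on {0..} ?h"
        proof -
          have "continuous_on UNIV (\<psi> (r - 1))"
            using \<psi>_deriv[of "r - 1"] r by (intro DERIV_continuous_on) (auto intro: DERIV_subset)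
          then have "continuous_on {0..} (\<lambda>s. \<psi> (r - 1) (?R s))"
            by (rule continuous_on_compose2) (auto intro!: DERIV_continuous_on[OF R])
          then show ?thesis using ac I_cont[OF b] by (intro continuous_on_mult continuous_on_diff continuous_on_const)
        qed
        ultimately have "\<bar>S a b x t\<bar> powr r = (\<integral>s. indicator {0..t} s * ?h s \<partial>lborel)"
          by (simp add: integral_Icc_lborel)
        also have "\<dots> = (\<integral>s. indicator {0..t} s * (r * (\<psi> (r - 1) (S a b (T s x) (t - s)) * I b (T s x) (t - s)) * a (T s x)) \<partial>lborel)"
          by (intro Bochner_Integration.integral_cong) (auto simp: indicator_def I_shift[OF b] S_shift[OF oa b])
        finally show ?thesis .
      qed
      fix s assume s: "0 \<le> s" "s \<le> t"
      define s' where "s' = t - s"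
      have s': "0 \<le> s'" "s' \<le> t0" using s t by (auto simp: s'_def)
      let ?x = "\<lambda>p. T (snd p) (fst p)"
      let ?X = "\<lambda>p. \<bar>S a b (?x p) s'\<bar>"
      let ?A = "\<lambda>p. \<bar>I a (?x p) s'\<bar> powr (2 * q)"
      let ?B = "\<lambda>p. \<bar>I b (?x p) s'\<bar> powr (2 * q)"
      let ?h = "\<lambda>p. (H (fst p) + 1) powr q"
      define n1 where "n1 = \<delta> * ((4 * c) powr (q / 3) * t0 powr r)"
      define n2 where "n2 = \<delta> * ((4 * c) powr r * t0 powr r)"
      \<comment> \<open>The division by \<open>t0 powr q\<close> will cancel against the growth
        \<open>CA * t0 powr q\<close> of the moments of the flow integrals.\<close>
      define n3 where "n3 = n1 * (2 powr (2 * q) / t0 powr q)"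
      have n: "0 \<le> n1" "0 \<le> n2" "0 \<le> n3" using \<delta> by (auto simp: n1_def n2_def n3_def)
      obtain B1 where C1: "fC1 (\<lambda>x. \<psi> (r - 1) (S a b x s') * I b x s') (Sd a b r s') B1"
        using fC1_S[OF oa b s'(1) r] by blast
      have iX: "integrable Q (\<lambda>p. ?X p powr r)"
        using Sb[OF s', of r] r by (intro integrable_bdd(3)[of "\<lambda>x. \<bar>S a b x s'\<bar> powr r" "(t0 * t0) powr r"]) auto
      have iA: "integrable Q ?A" "integrable Q ?B"
        using I_bound[OF oa s'(1)] I_bound[OF b s'(1)] q
        by (auto intro!: integrable_bdd(3)[of "\<lambda>x. \<bar>I a x s'\<bar> powr (2 * q)" "s' powr (2 * q)"]
            integrable_bdd(3)[of "\<lambda>x. \<bar>I b x s'\<bar> powr (2 * q)" "s' powr (2 * q)"] powr_mono2)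
      have "(\<integral>x. r * (\<psi> (r - 1) (S a b x s') * I b x s') * a x \<partial>MM) = r * (\<integral>x. (\<psi> (r - 1) (S a b x s') * I b x s') * a x \<partial>MM)"
        by (simp add: mult.assoc)
      also have "\<dots> \<le> r * (K * (\<integral>p. (H (fst p) + 1) * \<bar>Sd a b r s' (?x p)\<bar> \<partial>Q))"
        using key_estimate[OF a C1] r unfolding K_def[symmetric] by (intro mult_left_mono) (auto dest: abs_le_D1)
      also have "\<dots> = (\<integral>p. r * (K * ((H (fst p) + 1) * \<bar>Sd a b r s' (?x p)\<bar>)) \<partial>Q)" by simp
      also have "\<dots> \<le> (\<integral>p. 2 * \<delta> * ?X p powr r + (n1 * (1 + ?h p) + n3 * (?A p + ?B p) + n2 * ?h p) \<partial>Q)"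
      proof (rule integral_mono_AE')
        show "integrable Q (\<lambda>p. 2 * \<delta> * ?X p powr r + (n1 * (1 + ?h p) + n3 * (?A p + ?B p) + n2 * ?h p))"
          using iX iA iH by simp
        show "AE p in Q. 0 \<le> 2 * \<delta> * ?X p powr r + (n1 * (1 + ?h p) + n3 * (?A p + ?B p) + n2 * ?h p)"
          using \<delta> n by (intro AE_I2) auto
        show "AE p in Q. r * (K * ((H (fst p) + 1) * \<bar>Sd a b r s' (?x p)\<bar>))
            \<le> 2 * \<delta> * ?X p powr r + (n1 * (1 + ?h p) + n3 * (?A p + ?B p) + n2 * ?h p)"
          using AE_Q
        proof eventually_elim
          case (elim p)
          define X where "X = ?X p"
          define w where "w = \<bar>I a (?x p) s'\<bar> + \<bar>I b (?x p) s'\<bar>"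
          define h where "h = H (fst p) + 1"
          have X0: "0 \<le> X" and w0: "0 \<le> w" and h1: "1 \<le> h" using elim by (auto simp: X_def w_def h_def)
          have "\<bar>Sd a b r s' (?x p)\<bar> \<le> (r - 1) * X powr (r - 2) * w\<^sup>2 + X powr (r - 1) * 2"
            using Sd_bound[OF oa b r, of s' "?x p"] by (simp add: X_def w_def)
          then have "r * (K * (h * \<bar>Sd a b r s' (?x p)\<bar>)) \<le> r * (K * (h * ((r - 1) * X powr (r - 2) * w\<^sup>2 + X powr (r - 1) * 2)))"
            using r K_pos h1 by (intro mult_left_mono) auto
          also have "\<dots> = (r * (r - 1) * K * h * w\<^sup>2) * X powr (r - 2) + (r * 2 * K * h) * X powr (r - 1)"
            by (simp add: algebra_simps)
          also have "\<dots> \<le> (c * h * w\<^sup>2) * X powr (r - 2) + (c * h) * X powr (r - 1)"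
            unfolding c_def using r K_pos h1 by (intro add_mono mult_right_mono mult_left_mono) auto
          also have "\<dots> \<le> (\<delta> * X powr r + \<delta> * (c * h * w\<^sup>2 / \<delta>) powr (r / 2)) + (\<delta> * X powr r + \<delta> * (c * h / \<delta>) powr (r / 1))"
            using X0 c0 h1 \<delta> r by (intro add_mono young_powr) auto
          also have "(c * h / \<delta>) powr (r / 1) \<le> (4 * c) powr r * t0 powr r * h powr q"
          proof -
            have "(c * h / \<delta>) powr (r / 1) = ((4 * c) * t0 * h) powr r" by (simp add: \<delta>_def ac_simps)
            also have "\<dots> = (4 * c) powr r * t0 powr r * h powr r" using c0 t0 h1 by (simp add: powr_mult)
            also have "\<dots> \<le> (4 * c) powr r * t0 powr r * h powr q"
              using h1 q by (intro mult_left_mono powr_mono) (auto simp: r_def)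
            finally show ?thesis .
          qed
          also have "(c * h * w\<^sup>2 / \<delta>) powr (r / 2) \<le> (4 * c) powr (q / 3) * t0 powr r * (1 + h powr q + 2 powr (2 * q) * (?A p + ?B p) / t0 powr q)"
          proof -
            \<comment> \<open>The square of \<open>w\<close> divided by \<open>t0\<close> is the
              scale-free quantity, as flow integrals grow like the square root of time; the
              extracted \<open>(t0 * t0) powr (q / 3)\<close> is \<open>t0 powr r\<close>.\<close>
            have "(c * h * w\<^sup>2 / \<delta>) powr (r / 2) = ((4 * c) * (t0 * t0) * (h * (w\<^sup>2 / t0))) powr (q / 3)"
              using t0 by (simp add: \<delta>_def r_def ac_simps)
            also have "\<dots> = (4 * c) powr (q / 3) * (t0 * t0) powr (q / 3) * (h * (w\<^sup>2 / t0)) powr (q / 3)"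
            proof -
              have gen: "((4 * c) * (t0 * t0) * z) powr (q / 3) = (4 * c) powr (q / 3) * (t0 * t0) powr (q / 3) * z powr (q / 3)"
                if "0 \<le> z" for z using that c0 t0 by (simp add: powr_mult)
              show ?thesis by (rule gen) (use h1 t0 in auto)
            qed
            also have "(t0 * t0) powr (q / 3) = t0 powr r"
              using t0 by (simp add: powr_mult r_def flip: powr_add)
            also have "(h * (w\<^sup>2 / t0)) powr (q / 3) \<le> 1 + h powr q + (w\<^sup>2 / t0) powr q"
              using h1 t0 q by (intro powr_third_le) auto
            also have "(w\<^sup>2 / t0) powr q = w powr (2 * q) / t0 powr q"
            proof -
              have "(w\<^sup>2) powr q = w powr (2 * q)"
                using w0 by (cases "w = 0") (simp_all add: powr_powr flip: powr_numeral)
              then show ?thesis using t0 by (simp add: powr_divide)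
            qed
            also have "w powr (2 * q) \<le> 2 powr (2 * q) * (?A p + ?B p)"
              unfolding w_def using q by (intro powr_sum_le) auto
            finally show ?thesis by (simp add: mult_left_mono divide_right_mono)
          qed
          finally show ?case
            using \<delta> unfolding X_def[symmetric] h_def[symmetric] n1_def n2_def n3_def
            by (simp add: algebra_simps add_divide_distrib)
        qed
      qed
      also have "\<dots> = 2 * \<delta> * (\<integral>p. ?X p powr r \<partial>Q) + (n1 * (measure Q UNIV + W) + n3 * ((\<integral>p. ?A p \<partial>Q) + (\<integral>p. ?B p \<partial>Q)) + n2 * W)"
        unfolding W_def using iX iA iH by simp
      also have "(\<integral>p. ?X p powr r \<partial>Q) = f s'" unfolding f_def by (subst integral_MM) auto
      also have "(\<integral>p. ?A p \<partial>Q) = (\<integral>x. \<bar>I a x s'\<bar> powr (2 * q) \<partial>MM)" by (subst integral_MM) auto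
      also have "(\<integral>p. ?B p \<partial>Q) = (\<integral>x. \<bar>I b x s'\<bar> powr (2 * q) \<partial>MM)" by (subst integral_MM) auto
      also have "2 * \<delta> * f s' + (n1 * (measure Q UNIV + W) + n3 * ((\<integral>x. \<bar>I a x s'\<bar> powr (2 * q) \<partial>MM) + (\<integral>x. \<bar>I b x s'\<bar> powr (2 * q) \<partial>MM)) + n2 * W)
        \<le> 2 * \<delta> * B + (n1 * (measure Q UNIV + W) + n3 * (CA * t0 powr q + CA * t0 powr q) + n2 * W)"
      proof -
        have "CA * s' powr q \<le> CA * t0 powr q" using CA0 s' q by (intro mult_left_mono powr_mono2) auto
        then have "(\<integral>x. \<bar>I a x s'\<bar> powr (2 * q) \<partial>MM) \<le> CA * t0 powr q" "(\<integral>x. \<bar>I b x s'\<bar> powr (2 * q) \<partial>MM) \<le> CA * t0 powr q"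
          using CA[OF s'(1)] CB[OF s'(1)] by linarith+
        then show ?thesis using fB[OF s'] \<delta> n by (intro add_mono mult_left_mono) auto
      qed
      also have "\<dots> = B'"
        using t0 unfolding B'_def N_def n3_def n1_def n2_def by (simp add: algebra_simps)
      finally show "(\<integral>x. r * (\<psi> (r - 1) (S a b x (t - s)) * I b x (t - s)) * a x \<partial>MM) \<le> B'" by (simp add: s'_def)
    qed
    also have "t * B' \<le> t0 * B'"
    proof (rule mult_right_mono)
      have "0 \<le> f 0" unfolding f_def by simp
      then have "0 \<le> B" using fB[of 0] t0 by simp
      then show "0 \<le> B'" using \<delta> N0 by (simp add: B'_def)
    qed (rule t)
    also have "t0 * B' = B / 2 + N * t0 powr r / 4"
      using t0 by (simp add: B'_def \<delta>_def field_simps)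
    finally show "f t \<le> B / 2 + N * t0 powr r / 4" .
  qed
  then show ?thesis by (simp add: f_def N_def mult.commute)
qed

end

section \<open>Hoelder observables\<close>

text \<open>Transfers estimates in the metric of \<open>\<theta>0\<close>, also after raising to the
  power \<open>\<eta>\<close>, to the coarser metric of \<open>\<theta>\<close>; note that
  \<open>\<theta>0 \<le> \<theta>0 powr \<eta>\<close> because \<open>\<theta>0 < 1\<close> and
  \<open>\<eta> \<le> 1\<close>.\<close>

lemma d_theta_mono:
  assumes "0 < \<theta>0" "\<theta>0 < 1" "0 < \<eta>" "\<eta> \<le> 1" "\<theta>0 powr \<eta> \<le> \<theta>"
  shows "d_theta \<theta>0 P F y y' \<le> d_theta \<theta> P F y y'" "d_theta \<theta>0 P F y y' powr \<eta> \<le> d_theta \<theta> P F y y'"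
proof -
  have "\<theta>0 powr 1 \<le> \<theta>0 powr \<eta>" using assms by (intro powr_mono') auto
  then have le: "\<theta>0 \<le> \<theta>" using assms by simp
  show "d_theta \<theta>0 P F y y' \<le> d_theta \<theta> P F y y'"
    using le assms by (auto simp: d_theta_def split: enat.split intro!: power_mono)
  have "(\<theta>0 ^ n) powr \<eta> = (\<theta>0 powr \<eta>) ^ n" for n
    using assms by (simp add: powr_powr mult.commute flip: powr_realpow)
  then show "d_theta \<theta>0 P F y y' powr \<eta> \<le> d_theta \<theta> P F y y'"
    using assms by (auto simp: d_theta_def split: enat.split intro!: power_mono)
qed

text \<open>Two rates coexist: \<open>\<theta>0\<close> governs the hypotheses on roof and flow,
  while \<open>\<theta>\<close> is the rate of the transfer operator, which has to dominate both
  \<open>lam powr (- \<eta>)\<close> and \<open>\<theta>0 powr \<eta>\<close>.\<close>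

locale expanding_suspension = gibbs_markov_inv F Y P \<mu>0 \<zeta>0 lam C0 \<eta> \<theta> \<mu>Y
  for F :: "'a::metric_space \<Rightarrow> 'a" and Y P \<mu>0 \<zeta>0 lam C0 \<eta> \<theta> \<mu>Y +
  fixes T :: "real \<Rightarrow> 'a \<Rightarrow> 'a" and H :: "'a \<Rightarrow> real" and \<theta>0 C1 C2 :: real
  assumes T_meas: "(\<lambda>(t, x). T t x) \<in> borel_measurable (borel \<Otimes>\<^sub>M borel)"
    and T_zero: "\<And>x. T 0 x = x"
    and T_add: "\<And>s t x. s \<ge> 0 \<Longrightarrow> t \<ge> 0 \<Longrightarrow> T (s + t) x = T s (T t x)"
    and flow_holder: "C2 > 0" "\<And>t t' x. 0 \<le> t \<Longrightarrow> 0 \<le> t' \<Longrightarrow> dist (T t x) (T t' x) \<le> C2 * \<bar>t - t'\<bar> powr \<eta>"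
    and H_meas [measurable]: "H \<in> borel_measurable borel"
    and H_nonneg: "\<And>y. y \<in> Y \<Longrightarrow> 0 \<le> H y"
    and F_eq: "\<And>y. y \<in> Y \<Longrightarrow> F y = T (H y) y"
    and H_sq: "integrable \<mu>Y (\<lambda>y. (H y)\<^sup>2)"
    and theta0: "0 < \<theta>0" "\<theta>0 < 1" "C1 \<ge> 1" "\<theta>0 powr \<eta> \<le> \<theta>"
    and H_lip: "\<And>j y y'. j \<in> P \<Longrightarrow> y \<in> j \<Longrightarrow> y' \<in> j \<Longrightarrow> y \<noteq> y' \<Longrightarrow>
            \<bar>H y - H y'\<bar> \<le> C1 * (INF z\<in>j. H z) * d_theta \<theta>0 P F y y'"
    and flow_contr: "\<And>j y y' t. j \<in> P \<Longrightarrow> y \<in> j \<Longrightarrow> y' \<in> j \<Longrightarrow> 0 \<le> t \<Longrightarrow>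
            t \<le> H y \<Longrightarrow> t \<le> H y' \<Longrightarrow> dist (T t y) (T t y') \<le> C1 * d_theta \<theta>0 P F y y'"
begin

text \<open>Normalising both bounds to 1 makes the decay constants uniform; a general observable is
  divided by its norm.\<close>

definition unit_holder :: "('a \<Rightarrow> real) \<Rightarrow> bool" where
  "unit_holder a \<longleftrightarrow> a \<in> borel_measurable borel \<and> (\<forall>x. \<bar>a x\<bar> \<le> 1) \<and> (\<forall>x x'. \<bar>a x - a x'\<bar> \<le> dist x x' powr \<eta>)"

lemma suspension: "0 \<le> Cd \<Longrightarrow> 0 \<le> \<gamma> \<Longrightarrow> \<gamma> < 1 \<Longrightarrow> suspension_flow T Y F H \<mu>Y Cd \<gamma>"
  by unfold_locales (use T_meas T_zero T_add muY_sets AE_Y H_nonneg F_eq distr_F H_sq in auto)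

lemma unit_holder_flow_cont:
  assumes "unit_holder a" shows "continuous_on {0..} (\<lambda>t. a (T t x))"
  unfolding continuous_on_def
proof
  fix t :: real assume t: "t \<in> {0..}"
  have 1: "((\<lambda>s. \<bar>s - t\<bar> powr \<eta>) \<longlongrightarrow> \<bar>t - t\<bar> powr \<eta>) (at t within {0..})"
    using constants by (intro tendsto_intros) auto
  have "((\<lambda>s. (C2 * \<bar>s - t\<bar> powr \<eta>) powr \<eta>) \<longlongrightarrow> (C2 * \<bar>t - t\<bar> powr \<eta>) powr \<eta>) (at t within {0..})"
    using constants flow_holder(1) by (intro tendsto_powr' tendsto_mult tendsto_const 1) auto
  then have 2: "((\<lambda>s. (C2 * \<bar>s - t\<bar> powr \<eta>) powr \<eta>) \<longlongrightarrow> 0) (at t within {0..})" using constants by simp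
  have "((\<lambda>s. a (T s x) - a (T t x)) \<longlongrightarrow> 0) (at t within {0..})"
  proof (rule Lim_null_comparison[OF _ 2])
    show "\<forall>\<^sub>F s in at t within {0..}. norm (a (T s x) - a (T t x)) \<le> (C2 * \<bar>s - t\<bar> powr \<eta>) powr \<eta>"
      unfolding eventually_at_filter
    proof (intro always_eventually allI impI)
      fix s :: real assume s: "s \<in> {0..}"
      have "\<bar>a (T s x) - a (T t x)\<bar> \<le> dist (T s x) (T t x) powr \<eta>" using assms by (simp add: unit_holder_def)
      also have "\<dots> \<le> (C2 * \<bar>s - t\<bar> powr \<eta>) powr \<eta>"
        using flow_holder(2)[of s t x] s t constants by (intro powr_mono2) auto
      finally show "norm (a (T s x) - a (T t x)) \<le> (C2 * \<bar>s - t\<bar> powr \<eta>) powr \<eta>" by simp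
    qed
  qed
  then show "((\<lambda>s. a (T s x)) \<longlongrightarrow> a (T t x)) (at t within {0..})" by (rule LIM_zero_cancel)
qed

text \<open>The Lipschitz bound of the roof is relative to its infimum on the cell, and the symbolic
  distance is at most 1; so on each cell the roof is comparable to that infimum, however large it
  is.\<close>

lemma INF_H:
  assumes j: "j \<in> P" and y: "y \<in> j"
  shows "0 \<le> (INF z\<in>j. H z)" "(INF z\<in>j. H z) \<le> H y" "H y \<le> (1 + C1) * (INF z\<in>j. H z)"
proof -
  have jY: "j \<subseteq> Y" using j P_cover by auto
  have bdd: "bdd_below (H ` j)" using jY H_nonneg by (intro bdd_belowI[of _ 0]) auto
  show i0: "0 \<le> (INF z\<in>j. H z)" using y jY H_nonneg by (intro cINF_greatest) auto
  show "(INF z\<in>j. H z) \<le> H y" using bdd y by (rule cINF_lower)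
  have "H y - C1 * (INF z\<in>j. H z) \<le> (INF z\<in>j. H z)"
  proof (rule cINF_greatest)
    show "j \<noteq> {}" using y by auto
    fix z assume z: "z \<in> j"
    show "H y - C1 * (INF z\<in>j. H z) \<le> H z"
    proof (cases "y = z")
      case True then show ?thesis using i0 theta0 by simp
    next
      case False
      have "d_theta \<theta>0 P F y z \<le> 1"
        using d_theta_mono(1)[OF theta0(1,2) constants(3,4) theta0(4), of P F y z] e_le_1[of y z] by simp
      then have "C1 * (INF z\<in>j. H z) * d_theta \<theta>0 P F y z \<le> C1 * (INF z\<in>j. H z) * 1"
        using i0 theta0 by (intro mult_left_mono) auto
      then show ?thesis using H_lip[OF j y z False] by linarith
    qed
  qed
  then show "H y \<le> (1 + C1) * (INF z\<in>j. H z)" by (simp add: algebra_simps)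
qed

lemma H_lip_e:
  assumes j: "j \<in> P" "y \<in> j" "y' \<in> j"
  shows "\<bar>H y - H y'\<bar> \<le> C1 * (INF z\<in>j. H z) * e y y'"
proof (cases "y = y'")
  case True then show ?thesis using INF_H[OF j(1,2)] theta0 e_nonneg by simp
next
  case False
  have "C1 * (INF z\<in>j. H z) * d_theta \<theta>0 P F y y' \<le> C1 * (INF z\<in>j. H z) * e y y'"
    using d_theta_mono(1)[OF theta0(1,2) constants(3,4) theta0(4), of P F y y'] INF_H[OF j(1,2)] theta0
    by (intro mult_left_mono) auto
  then show ?thesis using H_lip[OF j False] by linarith
qed

text \<open>Let \<open>H y\<close> be the smaller roof. Up to time \<open>H y\<close> the two orbits
  stay close, and \<open>INF_H\<close> bounds this duration by \<open>1 + C1\<close> times the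
  infimum; the remaining stretch of the longer orbit has length \<open>H y' - H y\<close>, bounded
  by \<open>H_lip_e\<close>. The contributions \<open>C1 * (1 + C1)\<close> and \<open>C1\<close>
  add up to the stated factor.\<close>

lemma flow_integral_lip:
  assumes a: "unit_holder a" and j: "j \<in> P" "y \<in> j" "y' \<in> j"
  shows "\<bar>integral {0..H y} (\<lambda>s. a (T s y)) - integral {0..H y'} (\<lambda>s. a (T s y'))\<bar>
    \<le> C1 * (2 + C1) * (INF z\<in>j. H z) * e y y'"
proof -
  interpret SF: suspension_flow T Y F H \<mu>Y 0 0 by (rule suspension) auto
  have oa: "SF.ob a" using a unit_holder_flow_cont[OF a] by (simp add: SF.ob_def unit_holder_def)
  have *: "\<bar>SF.I a y (H y) - SF.I a y' (H y')\<bar> \<le> C1 * (2 + C1) * (INF z\<in>j. H z) * e y y'"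
    if j: "j \<in> P" "y \<in> j" "y' \<in> j" and le: "H y \<le> H y'" for y y'
  proof -
    let ?d = "d_theta \<theta>0 P F y y'"
    define i where "i = (INF z\<in>j. H z)"
    have Hy: "0 \<le> H y" using j P_cover H_nonneg by auto
    have "SF.I a (T (H y) y') (H y' - H y) = SF.I a y' (H y') - SF.I a y' (H y)"
      using SF.I_shift[OF oa, of "H y' - H y" "H y" y'] le Hy by simp
    then have 1: "\<bar>SF.I a y' (H y') - SF.I a y' (H y)\<bar> \<le> C1 * i * e y y'"
      using SF.I_bound[OF oa, of "H y' - H y" "T (H y) y'"] le H_lip_e[OF j] unfolding i_def by linarith
    have c: "continuous_on {0..H y} (\<lambda>s. a (T s z))" for z
      using unit_holder_flow_cont[OF a] by (rule continuous_on_subset) auto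
    have "SF.I a y (H y) - SF.I a y' (H y) = integral {0..H y} (\<lambda>s. a (T s y) - a (T s y'))"
      unfolding SF.I_def using c
      by (intro Henstock_Kurzweil_Integration.integral_diff[symmetric] integrable_continuous_real)
    also have "norm \<dots> \<le> (C1 * e y y') * (H y - 0)"
    proof (rule integral_bound)
      show "continuous_on {0..H y} (\<lambda>s. a (T s y) - a (T s y'))" by (intro continuous_on_diff c)
      fix s assume s: "s \<in> {0..H y}"
      have d0: "0 \<le> ?d" using theta0 by (auto simp: d_theta_def split: enat.split)
      have "\<bar>a (T s y) - a (T s y')\<bar> \<le> dist (T s y) (T s y') powr \<eta>" using a by (simp add: unit_holder_def)
      also have "\<dots> \<le> (C1 * ?d) powr \<eta>"
        using flow_contr[OF j, of s] s le constants by (intro powr_mono2) auto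
      also have "\<dots> = C1 powr \<eta> * ?d powr \<eta>" using theta0 d0 by (simp add: powr_mult)
      also have "\<dots> \<le> C1 * e y y'"
        using d_theta_mono(2)[OF theta0(1,2) constants(3,4) theta0(4), of P F y y'] theta0 constants
          powr_mono[of \<eta> 1 C1] by (intro mult_mono) auto
      finally show "norm (a (T s y) - a (T s y')) \<le> C1 * e y y'" by simp
    qed (rule Hy)
    finally have "\<bar>SF.I a y (H y) - SF.I a y' (H y)\<bar> \<le> C1 * e y y' * H y" by simp
    also have "\<dots> \<le> C1 * e y y' * ((1 + C1) * i)"
      using INF_H(3)[OF j(1,2)] theta0 e_nonneg unfolding i_def by (intro mult_left_mono) auto
    finally have 2: "\<bar>SF.I a y (H y) - SF.I a y' (H y)\<bar> \<le> C1 * e y y' * ((1 + C1) * i)" .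
    have "\<bar>SF.I a y (H y) - SF.I a y' (H y')\<bar> \<le> C1 * e y y' * ((1 + C1) * i) + C1 * i * e y y'"
      using 1 2 by linarith
    also have "\<dots> = C1 * (2 + C1) * i * e y y'" by (simp add: algebra_simps)
    finally show ?thesis by (simp add: i_def)
  qed
  have sym: "e y y' = e y' y"
  proof -
    have "(\<lambda>n. \<exists>j\<in>P. (F ^^ n) y \<in> j \<and> (F ^^ n) y' \<in> j) = (\<lambda>n. \<exists>j\<in>P. (F ^^ n) y' \<in> j \<and> (F ^^ n) y \<in> j)"
      by (intro ext) blast
    from arg_cong[OF this, of "\<lambda>B. if \<exists>n. \<not> B n then enat (LEAST n. \<not> B n) else \<infinity>"]
    have "sep_time P F y y' = sep_time P F y' y" by (simp only: sep_time_def)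
    then show ?thesis by (simp only: d_theta_def)
  qed
  show ?thesis
    using *[OF j] *[OF j(1,3,2)] sym unfolding SF.I_def
    by (cases "H y \<le> H y'") (auto simp: abs_minus_commute)
qed

text \<open>\<open>decay_of_correlations\<close> wants nonnegative functions that are log-Lipschitz
  on cells, and the return integral \<open>\<Phi>\<close> is signed. But
  \<open>\<bar>\<Phi>\<bar> \<le> H\<close> on \<open>Y\<close>, so \<open>\<Phi> + 2 * H\<close>
  lies above \<open>H\<close>, and its variation on a cell is controlled by the infimum of
  \<open>H\<close>. Both it and \<open>H\<close> qualify, and in the combination of the two
  estimates the means cancel since \<open>\<Phi>\<close> has mean zero.\<close>

lemma holder_decay:
  "\<exists>Cd \<gamma>. 0 \<le> Cd \<and> 0 \<le> \<gamma> \<and> \<gamma> < 1 \<and> (\<forall>a. unit_holder a \<and>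
      (\<integral>y. integral {0..H y} (\<lambda>s. a (T s y)) \<partial>\<mu>Y) = 0 \<longrightarrow> suspension_flow.adm T F H \<mu>Y Cd \<gamma> a)"
proof -
  interpret SF: suspension_flow T Y F H \<mu>Y 0 0 by (rule suspension) auto
  \<comment> \<open>Lipschitz constant of \<open>\<Phi> + 2 * H\<close> on a cell relative to the
    infimum of \<open>H\<close>: the first summand belongs to \<open>\<Phi>\<close>, the second to
    \<open>2 * H\<close>.\<close>
  define R0 where "R0 = C1 * (2 + C1) + 2 * C1"
  have R0: "R0 \<ge> 0" "C1 \<le> R0" using theta0 by (auto simp: R0_def)
  obtain C \<gamma> where C: "0 \<le> C" "0 \<le> \<gamma>" "\<gamma> < 1"
    and dec: "\<forall>U u b n. (\<forall>y. 0 \<le> U y) \<and> U \<in> borel_measurable borel \<and> integrable \<mu>Y U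
      \<and> (\<forall>j\<in>P. \<forall>y\<in>j. \<forall>y'\<in>j. U y \<le> exp (R0 * e y y') * U y')
      \<and> u \<in> borel_measurable borel \<and> (\<forall>y. \<bar>u y\<bar> \<le> b) \<longrightarrow>
      \<bar>(\<integral>y. u ((F ^^ Suc n) y) * U y \<partial>\<mu>Y) - (\<integral>y. U y \<partial>\<mu>Y) * (\<integral>y. u y \<partial>\<mu>Y)\<bar>
        \<le> C * \<gamma> ^ n * (\<integral>y. U y \<partial>\<mu>Y) * (\<integral>y. \<bar>u y\<bar> \<partial>\<mu>Y)"
    using decay_of_correlations[OF R0(1)] by (elim exE conjE) (rule that)
  define Hb where "Hb = (\<integral>y. H y \<partial>\<mu>Y)"
  have Hb0: "0 \<le> Hb" unfolding Hb_def using AE_Y H_nonneg by (intro integral_nonneg_AE) (auto elim: eventually_mono)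
  have Hi: "integrable \<mu>Y H" by (rule SF.H_int)
  \<comment> \<open>The mean of \<open>\<Phi> + 2 * H\<close> is \<open>2 * Hb\<close>, and twice
    the estimate for \<open>H\<close> adds another \<open>2 * Hb\<close>.\<close>
  define Cd where "Cd = 4 * C * Hb"
  have Cd0: "0 \<le> Cd" using C Hb0 by (simp add: Cd_def)
  interpret SG: suspension_flow T Y F H \<mu>Y Cd \<gamma> by (rule suspension) (use C Cd0 in auto)
  have reg: "U y \<le> exp (R0 * e y y') * U y'"
    if "U y - U y' \<le> R0 * i * e y y'" "i \<le> U y'" "0 \<le> i" for U :: "'a \<Rightarrow> real" and y y' i
  proof -
    have "R0 * i * e y y' \<le> R0 * U y' * e y y'"
      using that R0 e_nonneg by (intro mult_right_mono mult_left_mono) auto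
    then have "U y \<le> (1 + R0 * e y y') * U y'" using that by (simp add: algebra_simps)
    also have "\<dots> \<le> exp (R0 * e y y') * U y'"
      using that by (intro mult_right_mono exp_ge_add_one_self) auto
    finally show ?thesis .
  qed
  have "SG.adm a" if a: "unit_holder a" and z: "(\<integral>y. integral {0..H y} (\<lambda>s. a (T s y)) \<partial>\<mu>Y) = 0" for a
  proof -
    have oa: "SG.ob a" "SF.ob a" using a unit_holder_flow_cont[OF a]
      by (auto simp: SG.ob_def SF.ob_def unit_holder_def)
    define \<Phi> where "\<Phi> y = SG.I a y (H y)" for y
    have [measurable]: "\<Phi> \<in> borel_measurable borel"
      unfolding \<Phi>_def by (rule SG.I_measurable[OF oa(1)]) measurable
    have \<Phi>H: "\<bar>\<Phi> y\<bar> \<le> \<bar>H y\<bar>" for y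
      using SG.I_bound[OF oa(1), of "H y" y] SG.I_neg[of "H y" a y] by (cases "0 \<le> H y") (auto simp: \<Phi>_def)
    have \<Phi>i: "integrable \<mu>Y \<Phi>"
      using \<Phi>H by (intro Bochner_Integration.integrable_bound[OF Hi]) auto
    have \<Phi>0: "(\<integral>y. \<Phi> y \<partial>\<mu>Y) = 0" using z by (simp add: \<Phi>_def SG.I_def)
    \<comment> \<open>The indicator makes the function nonnegative at every point, not only on
      \<open>Y\<close>.\<close>
    define U where "U y = indicator Y y * (\<Phi> y + 2 * H y)" for y
    define V where "V y = indicator Y y * H y" for y
    have [measurable]: "U \<in> borel_measurable borel" "V \<in> borel_measurable borel"
      unfolding U_def V_def by measurable
    have AEU: "AE y in \<mu>Y. U y = \<Phi> y + 2 * H y" and AEV: "AE y in \<mu>Y. V y = H y"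
      using AE_Y by (eventually_elim, simp add: U_def V_def)+
    have U0: "0 \<le> U y" "0 \<le> V y" for y
      using \<Phi>H[of y] H_nonneg[of y] by (auto simp: U_def V_def indicator_def)
    have UVi: "integrable \<mu>Y U" "integrable \<mu>Y V"
    proof -
      show "integrable \<mu>Y U" using \<Phi>i Hi by (subst integrable_cong_AE[OF _ _ AEU]) auto
      show "integrable \<mu>Y V" using Hi by (subst integrable_cong_AE[OF _ _ AEV]) auto
    qed
    have intUV: "(\<integral>y. U y \<partial>\<mu>Y) = 2 * Hb" "(\<integral>y. V y \<partial>\<mu>Y) = Hb"
    proof -
      have "(\<integral>y. U y \<partial>\<mu>Y) = (\<integral>y. \<Phi> y + 2 * H y \<partial>\<mu>Y)" using AEU by (intro integral_cong_AE) auto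
      then show "(\<integral>y. U y \<partial>\<mu>Y) = 2 * Hb" using \<Phi>i Hi \<Phi>0 by (simp add: Hb_def)
      show "(\<integral>y. V y \<partial>\<mu>Y) = Hb" unfolding Hb_def using AEV by (intro integral_cong_AE) auto
    qed
    have Ureg: "U y \<le> exp (R0 * e y y') * U y'" and Vreg: "V y \<le> exp (R0 * e y y') * V y'"
      if j: "j \<in> P" "y \<in> j" "y' \<in> j" for j y y'
    proof -
      define i where "i = (INF z\<in>j. H z)"
      have yY: "y \<in> Y" "y' \<in> Y" using j P_cover by auto
      have i0: "0 \<le> i" "i \<le> H y'" using INF_H[OF j(1,3)] by (auto simp: i_def)
      have l1: "\<bar>H y - H y'\<bar> \<le> C1 * i * e y y'" using H_lip_e[OF j] by (simp add: i_def)
      have l2: "\<bar>\<Phi> y - \<Phi> y'\<bar> \<le> C1 * (2 + C1) * i * e y y'"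
        using flow_integral_lip[OF a j] by (simp add: i_def \<Phi>_def SG.I_def)
      have "(\<Phi> y + 2 * H y) - (\<Phi> y' + 2 * H y') \<le> C1 * (2 + C1) * i * e y y' + 2 * (C1 * i * e y y')"
        using l1 l2 by linarith
      also have "\<dots> = R0 * i * e y y'" by (simp add: R0_def algebra_simps)
      finally show "U y \<le> exp (R0 * e y y') * U y'"
        using i0 \<Phi>H[of y'] H_nonneg[OF yY(2)] yY by (intro reg[of U y y' i]) (auto simp: U_def)
      have "C1 * i * e y y' \<le> R0 * i * e y y'" using R0 i0 e_nonneg by (intro mult_right_mono) auto
      then show "V y \<le> exp (R0 * e y y') * V y'"
        using i0 l1 yY by (intro reg[of V y y' i]) (auto simp: V_def)
    qed
    have "\<bar>\<integral>y. u ((F ^^ Suc n) y) * \<Phi> y \<partial>\<mu>Y\<bar> \<le> Cd * \<gamma> ^ n * (\<integral>y. \<bar>u y\<bar> \<partial>\<mu>Y)"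
      if u [measurable]: "u \<in> borel_measurable borel" and b: "\<And>y. \<bar>u y\<bar> \<le> b" for u b n
    proof -
      let ?u = "\<lambda>y. u ((F ^^ Suc n) y)"
      have um: "?u \<in> borel_measurable borel" by measurable
      have dU: "\<bar>(\<integral>y. ?u y * U y \<partial>\<mu>Y) - 2 * Hb * (\<integral>y. u y \<partial>\<mu>Y)\<bar> \<le> C * \<gamma> ^ n * (2 * Hb) * (\<integral>y. \<bar>u y\<bar> \<partial>\<mu>Y)"
        by (rule dec[THEN spec[of _ U], THEN spec[of _ u], THEN spec[of _ b], THEN spec[of _ n], THEN mp, unfolded intUV],
            intro conjI ballI allI) (use U0 UVi Ureg u b in auto)
      have dV: "\<bar>(\<integral>y. ?u y * V y \<partial>\<mu>Y) - Hb * (\<integral>y. u y \<partial>\<mu>Y)\<bar> \<le> C * \<gamma> ^ n * Hb * (\<integral>y. \<bar>u y\<bar> \<partial>\<mu>Y)"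
        by (rule dec[THEN spec[of _ V], THEN spec[of _ u], THEN spec[of _ b], THEN spec[of _ n], THEN mp, unfolded intUV],
            intro conjI ballI allI) (use U0 UVi Vreg u b in auto)
      have iUV: "integrable \<mu>Y (\<lambda>y. ?u y * U y)" "integrable \<mu>Y (\<lambda>y. ?u y * V y)"
        by (rule integrable_bdd_mult[OF um b]; use UVi muY_sets in auto)+
      have "(\<integral>y. ?u y * \<Phi> y \<partial>\<mu>Y) = (\<integral>y. ?u y * U y - 2 * (?u y * V y) \<partial>\<mu>Y)"
      proof (rule integral_cong_AE)
        show "AE y in \<mu>Y. ?u y * \<Phi> y = ?u y * U y - 2 * (?u y * V y)"
          using AEU AEV by eventually_elim (simp add: algebra_simps)
      qed measurable
      also have "\<dots> = (\<integral>y. ?u y * U y \<partial>\<mu>Y) - 2 * (\<integral>y. ?u y * V y \<partial>\<mu>Y)" using iUV by simp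
      finally have "\<bar>\<integral>y. ?u y * \<Phi> y \<partial>\<mu>Y\<bar> \<le> C * \<gamma> ^ n * (2 * Hb) * (\<integral>y. \<bar>u y\<bar> \<partial>\<mu>Y) + 2 * (C * \<gamma> ^ n * Hb * (\<integral>y. \<bar>u y\<bar> \<partial>\<mu>Y))"
        using dU dV by linarith
      also have "\<dots> = Cd * \<gamma> ^ n * (\<integral>y. \<bar>u y\<bar> \<partial>\<mu>Y)" by (simp add: Cd_def)
      finally show ?thesis .
    qed
    then show ?thesis unfolding SG.adm_def using oa by (auto simp: \<Phi>_def simp del: funpow.simps)
  qed
  then show ?thesis using C Cd0 by blast
qed

text \<open>Unfolding the fibres turns mean zero for \<open>MM\<close> into mean zero of the return
  integral on the base, the form in which \<open>holder_decay\<close> yields \<open>adm\<close>. The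
  decay constants are fixed before the observable, so the moment constants are uniform.\<close>

lemma flow_moments:
  assumes q: "q > 1" and iH: "integrable \<mu>Y (\<lambda>y. H y * (H y + 1) powr q)"
  shows "\<exists>C. \<forall>a t. unit_holder a \<and> (\<integral>x. a x \<partial>suspension_flow.MM T H \<mu>Y) = 0 \<and> 0 < t \<longrightarrow>
      (\<integral>x. \<bar>integral {0..t} (\<lambda>s. a (T s x))\<bar> powr (2 * q) \<partial>suspension_flow.MM T H \<mu>Y) \<le> C * t powr q"
    and "q > 3 \<Longrightarrow> \<exists>C. \<forall>a b t. unit_holder a \<and> (\<integral>x. a x \<partial>suspension_flow.MM T H \<mu>Y) = 0
      \<and> unit_holder b \<and> (\<integral>x. b x \<partial>suspension_flow.MM T H \<mu>Y) = 0 \<and> 0 < t \<longrightarrow>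
      (\<integral>x. \<bar>integral {0..t} (\<lambda>s. integral {0..s} (\<lambda>r. a (T r x)) * b (T s x))\<bar> powr (2 * q / 3) \<partial>suspension_flow.MM T H \<mu>Y)
        \<le> C * t powr (2 * q / 3)"
proof -
  obtain Cd \<gamma> where C: "0 \<le> Cd" "0 \<le> \<gamma>" "\<gamma> < 1" and
    dec: "\<And>a. unit_holder a \<Longrightarrow> (\<integral>y. integral {0..H y} (\<lambda>s. a (T s y)) \<partial>\<mu>Y) = 0 \<Longrightarrow> suspension_flow.adm T F H \<mu>Y Cd \<gamma> a"
    using holder_decay by auto
  interpret SG: suspension_flow T Y F H \<mu>Y Cd \<gamma> by (rule suspension[OF C])
  have ob: "SG.ob a" if "unit_holder a" for a
    using that unit_holder_flow_cont[OF that] by (auto simp: SG.ob_def unit_holder_def)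
  have adm: "SG.adm a" if a: "unit_holder a" and z: "(\<integral>x. a x \<partial>SG.MM) = 0" for a
  proof (rule dec[OF a])
    have [measurable]: "a \<in> borel_measurable borel" and a1: "\<And>x. \<bar>a x\<bar> \<le> 1" using a by (auto simp: unit_holder_def)
    have "(\<integral>x. a x \<partial>SG.MM) = (\<integral>y. (\<integral>u. indicator {0..<H y} u * a (T u y) \<partial>lborel) \<partial>\<mu>Y)"
      using SG.integral_Q(1)[OF SG.integrable_bdd(3)[of a 1]] a1 by (subst SG.integral_MM) auto
    also have "\<dots> = (\<integral>y. integral {0..H y} (\<lambda>s. a (T s y)) \<partial>\<mu>Y)"
    proof (rule Bochner_Integration.integral_cong[OF refl])
      fix y
      have "(\<integral>u. indicator {0..<H y} u * a (T u y) \<partial>lborel) = (\<integral>u. indicator {0..H y} u * a (T u y) \<partial>lborel)"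
        by (rule integral_Ico_Icc) measurable
      then show "(\<integral>u. indicator {0..<H y} u * a (T u y) \<partial>lborel) = integral {0..H y} (\<lambda>s. a (T s y))"
        using SG.I_lborel[OF ob[OF a], of y "H y"] by (simp add: SG.I_def)
    qed
    finally show "(\<integral>y. integral {0..H y} (\<lambda>s. a (T s y)) \<partial>\<mu>Y) = 0" using z by simp
  qed
  have iQ: "integrable SG.Q (\<lambda>p. (H (fst p) + 1) powr q)"
    using SG.integrable_Q_fst[OF _ iH] by simp
  define CA where "CA = (2 * (4 * q * (2 * q - 1) * SG.K)) powr q * (\<integral>p. (H (fst p) + 1) powr q \<partial>SG.Q)"
  have A: "(\<integral>x. \<bar>SG.I a x t\<bar> powr (2 * q) \<partial>SG.MM) \<le> CA * t powr q"
    if "unit_holder a" "(\<integral>x. a x \<partial>SG.MM) = 0" "0 < t" for a t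
    using SG.moment_I[OF q iQ adm[OF that(1,2)] that(3)] by (simp add: CA_def)
  then show "\<exists>C. \<forall>a t. unit_holder a \<and> (\<integral>x. a x \<partial>SG.MM) = 0 \<and> 0 < t \<longrightarrow>
      (\<integral>x. \<bar>integral {0..t} (\<lambda>s. a (T s x))\<bar> powr (2 * q) \<partial>SG.MM) \<le> C * t powr q"
    unfolding SG.I_def by blast
  have A': "(\<integral>x. \<bar>SG.I a x s\<bar> powr (2 * q) \<partial>SG.MM) \<le> CA * s powr q"
    if "unit_holder a" "(\<integral>x. a x \<partial>SG.MM) = 0" "0 \<le> s" for a s
    using A[OF that(1,2), of s] that(3) by (cases "s = 0") auto
  show "\<exists>C. \<forall>a b t. unit_holder a \<and> (\<integral>x. a x \<partial>SG.MM) = 0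
      \<and> unit_holder b \<and> (\<integral>x. b x \<partial>SG.MM) = 0 \<and> 0 < t \<longrightarrow>
      (\<integral>x. \<bar>integral {0..t} (\<lambda>s. integral {0..s} (\<lambda>r. a (T r x)) * b (T s x))\<bar> powr (2 * q / 3) \<partial>SG.MM)
        \<le> C * t powr (2 * q / 3)" if q3: "q > 3"
    using SG.moment_S[OF q3 iQ adm ob _ A' A'] unfolding SG.S_def SG.I_def by blast
qed

end

section \<open>Tower and suspension measures\<close>

text \<open>\<open>measure_of\<close> has the prescribed values only when the set function is a
  measure; displaying a measure \<open>N\<close> with these values spares a direct proof of
  countable additivity.\<close>

lemma measure_of_borel_eqI:
  assumes "space N = UNIV" "sets N = sets borel" "\<And>A. A \<in> sets borel \<Longrightarrow> \<mu> A = emeasure N A"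
  shows "measure_of UNIV (sets borel) \<mu> = N"
proof -
  have "measure_of UNIV (sets borel) \<mu> = measure_of UNIV (sets borel) (emeasure N)"
    using assms(3) sets.sigma_sets_eq[of borel] by (intro measure_of_eq) auto
  also have "\<dots> = measure_of (space N) (sets N) (emeasure N)" by (simp only: assms(1,2))
  finally show ?thesis by (simp add: measure_of_of_measure)
qed

text \<open>The tower measure is realised as a rescaled image of the product with counting measure,
  cut off at levels below \<open>\<tau>\<close>; integrals then follow from Tonelli.\<close>

lemma tower_measure_nn_integral:
  fixes f :: "'a::topological_space \<Rightarrow> 'a"
  assumes sets [measurable_cong]: "sets \<mu>Y = sets borel"
    and \<tau> [measurable]: "\<tau> \<in> measurable borel (count_space UNIV)"
    and f [measurable]: "f \<in> borel_measurable borel"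
  shows "sets (tower_measure \<mu>Y \<tau> f) = sets borel"
    and "g \<in> borel_measurable borel \<Longrightarrow> (\<integral>\<^sup>+x. g x \<partial>tower_measure \<mu>Y \<tau> f)
      = (\<integral>\<^sup>+y. (\<Sum>l<\<tau> y. g ((f ^^ l) y)) \<partial>\<mu>Y) / (\<integral>\<^sup>+y. ennreal (real (\<tau> y)) \<partial>\<mu>Y)"
proof -
  have fl [measurable]: "(f ^^ l) \<in> borel_measurable borel" for l by (induction l) auto
  define \<tau>b where "\<tau>b = (\<integral>\<^sup>+y. ennreal (real (\<tau> y)) \<partial>\<mu>Y)"
  let ?B = "\<mu>Y \<Otimes>\<^sub>M count_space (UNIV :: nat set)"
  interpret C: sigma_finite_measure "count_space (UNIV :: nat set)"
    by (rule sigma_finite_measure_count_space)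
  define w where "w p = (if snd p < \<tau> (fst p) then 1 else 0 :: ennreal)" for p
  have w [measurable]: "w \<in> borel_measurable ?B"
    unfolding w_def
  proof (rule measurable_compose_countable[where f="\<lambda>n p. if snd p < n then 1 else 0" and g="\<lambda>p. \<tau> (fst p)"])
    show "(\<lambda>p. \<tau> (fst p)) \<in> measurable ?B (count_space UNIV)"
      by (rule measurable_compose[OF measurable_fst]) measurable
  qed measurable
  have ff [measurable]: "(\<lambda>p. (f ^^ snd p) (fst p)) \<in> borel_measurable ?B"
    by (rule measurable_compose_countable[where g=snd]) measurable
  define N0 where "N0 = distr (density ?B w) borel (\<lambda>p. (f ^^ snd p) (fst p))"
  have nn: "(\<integral>\<^sup>+x. g x \<partial>N0) = (\<integral>\<^sup>+y. (\<Sum>l<\<tau> y. g ((f ^^ l) y)) \<partial>\<mu>Y)"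
    if [measurable]: "g \<in> borel_measurable borel" for g
  proof -
    have "(\<integral>\<^sup>+x. g x \<partial>N0) = (\<integral>\<^sup>+p. g ((f ^^ snd p) (fst p)) \<partial>density ?B w)"
      unfolding N0_def by (rule nn_integral_distr) measurable
    also have "\<dots> = (\<integral>\<^sup>+p. w p * g ((f ^^ snd p) (fst p)) \<partial>?B)"
      by (rule nn_integral_density) measurable
    also have "\<dots> = (\<integral>\<^sup>+y. \<integral>\<^sup>+l. w (y, l) * g ((f ^^ l) y) \<partial>count_space UNIV \<partial>\<mu>Y)"
      by (subst C.nn_integral_fst[symmetric]) auto
    also have "\<dots> = (\<integral>\<^sup>+y. (\<Sum>l<\<tau> y. g ((f ^^ l) y)) \<partial>\<mu>Y)"
    proof (rule nn_integral_cong)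
      fix y
      have "(\<integral>\<^sup>+l. w (y, l) * g ((f ^^ l) y) \<partial>count_space UNIV) = (\<Sum>l<\<tau> y. w (y, l) * g ((f ^^ l) y))"
        by (rule nn_integral_count_space') (auto simp: w_def)
      also have "\<dots> = (\<Sum>l<\<tau> y. g ((f ^^ l) y))" by (rule sum.cong) (auto simp: w_def)
      finally show "(\<integral>\<^sup>+l. w (y, l) * g ((f ^^ l) y) \<partial>count_space UNIV) = (\<Sum>l<\<tau> y. g ((f ^^ l) y))" .
    qed
    finally show ?thesis .
  qed
  have eq: "tower_measure \<mu>Y \<tau> f = scale_measure (1 / \<tau>b) N0"
    unfolding tower_measure_def
  proof (rule measure_of_borel_eqI)
    fix A :: "'a set" assume A [measurable]: "A \<in> sets borel"
    have "emeasure N0 A = (\<integral>\<^sup>+x. indicator A x \<partial>N0)"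
      by (simp add: N0_def)
    also have "\<dots> = (\<integral>\<^sup>+y. (\<Sum>l<\<tau> y. indicator A ((f ^^ l) y)) \<partial>\<mu>Y)" by (rule nn) measurable
    also have "\<dots> = (\<integral>\<^sup>+y. ennreal (\<Sum>l<\<tau> y. indicator A ((f ^^ l) y)) \<partial>\<mu>Y)"
      by (intro nn_integral_cong) (simp add: ennreal_indicator flip: sum_ennreal)
    finally show "(\<integral>\<^sup>+y. ennreal (\<Sum>l<\<tau> y. indicator A ((f ^^ l) y)) \<partial>\<mu>Y) / (\<integral>\<^sup>+y. ennreal (real (\<tau> y)) \<partial>\<mu>Y)
        = emeasure (scale_measure (1 / \<tau>b) N0) A"
      by (simp add: \<tau>b_def divide_ennreal_def mult.commute)
  qed (simp_all add: N0_def space_scale_measure)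
  show "sets (tower_measure \<mu>Y \<tau> f) = sets borel" unfolding eq by (simp add: N0_def)
  show "(\<integral>\<^sup>+x. g x \<partial>tower_measure \<mu>Y \<tau> f)
      = (\<integral>\<^sup>+y. (\<Sum>l<\<tau> y. g ((f ^^ l) y)) \<partial>\<mu>Y) / (\<integral>\<^sup>+y. ennreal (real (\<tau> y)) \<partial>\<mu>Y)"
    if g: "g \<in> borel_measurable borel"
  proof -
    have "g \<in> borel_measurable N0" using g by (simp add: N0_def)
    then show ?thesis unfolding eq using nn[OF g]
      by (simp add: nn_integral_scale_measure \<tau>b_def divide_ennreal_def mult.commute)
  qed
qed

lemma suspension_measure_nn_integral:
  fixes T :: "real \<Rightarrow> 'a::topological_space \<Rightarrow> 'a"
  assumes sets [measurable_cong]: "sets \<mu>X = sets borel"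
    and T: "(\<lambda>(t, x). T t x) \<in> borel_measurable (borel \<Otimes>\<^sub>M borel)"
    and h [measurable]: "h \<in> borel_measurable borel"
  shows "sets (suspension_measure \<mu>X h T) = sets borel"
    and "g \<in> borel_measurable borel \<Longrightarrow> (\<integral>\<^sup>+x. g x \<partial>suspension_measure \<mu>X h T)
      = (\<integral>\<^sup>+x. (\<integral>\<^sup>+u. indicator {0..h x} u * g (T u x) \<partial>lborel) \<partial>\<mu>X) / (\<integral>\<^sup>+x. ennreal (h x) \<partial>\<mu>X)"
proof -
  define hb where "hb = (\<integral>\<^sup>+x. ennreal (h x) \<partial>\<mu>X)"
  let ?B = "\<mu>X \<Otimes>\<^sub>M lborel"
  define w where "w p = (if 0 \<le> snd p \<and> snd p \<le> h (fst p) then 1 else 0 :: ennreal)" for p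
  have w [measurable]: "w \<in> borel_measurable ?B" unfolding w_def by measurable
  have TT [measurable]: "(\<lambda>p. T (snd p) (fst p)) \<in> borel_measurable ?B"
    using measurable_compose[OF _ T, of "\<lambda>p. (snd p, fst p)" ?B] by simp
  define N0 where "N0 = distr (density ?B w) borel (\<lambda>p. T (snd p) (fst p))"
  have nn: "(\<integral>\<^sup>+x. g x \<partial>N0) = (\<integral>\<^sup>+x. (\<integral>\<^sup>+u. indicator {0..h x} u * g (T u x) \<partial>lborel) \<partial>\<mu>X)"
    if [measurable]: "g \<in> borel_measurable borel" for g
  proof -
    have "(\<integral>\<^sup>+x. g x \<partial>N0) = (\<integral>\<^sup>+p. g (T (snd p) (fst p)) \<partial>density ?B w)"
      unfolding N0_def by (rule nn_integral_distr) measurable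
    also have "\<dots> = (\<integral>\<^sup>+p. w p * g (T (snd p) (fst p)) \<partial>?B)"
      by (rule nn_integral_density) measurable
    also have "\<dots> = (\<integral>\<^sup>+x. \<integral>\<^sup>+u. w (x, u) * g (T u x) \<partial>lborel \<partial>\<mu>X)"
      by (subst lborel.nn_integral_fst[symmetric]) auto
    also have "\<dots> = (\<integral>\<^sup>+x. (\<integral>\<^sup>+u. indicator {0..h x} u * g (T u x) \<partial>lborel) \<partial>\<mu>X)"
      by (intro nn_integral_cong) (auto simp: w_def indicator_def intro!: nn_integral_cong)
    finally show ?thesis .
  qed
  have eq: "suspension_measure \<mu>X h T = scale_measure (1 / hb) N0"
    unfolding suspension_measure_def
  proof (rule measure_of_borel_eqI)
    fix A :: "'a set" assume A [measurable]: "A \<in> sets borel"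
    have "emeasure N0 A = (\<integral>\<^sup>+x. indicator A x \<partial>N0)"
      by (simp add: N0_def)
    also have "\<dots> = (\<integral>\<^sup>+x. (\<integral>\<^sup>+u. indicator {0..h x} u * indicator A (T u x) \<partial>lborel) \<partial>\<mu>X)" by (rule nn) measurable
    finally show "(\<integral>\<^sup>+x. (\<integral>\<^sup>+u\<in>{0..h x}. indicator A (T u x) \<partial>lborel) \<partial>\<mu>X) / (\<integral>\<^sup>+x. ennreal (h x) \<partial>\<mu>X)
        = emeasure (scale_measure (1 / hb) N0) A"
      by (simp add: hb_def divide_ennreal_def mult.commute)
  qed (simp_all add: N0_def space_scale_measure)
  show "sets (suspension_measure \<mu>X h T) = sets borel" unfolding eq by (simp add: N0_def)
  show "(\<integral>\<^sup>+x. g x \<partial>suspension_measure \<mu>X h T)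
      = (\<integral>\<^sup>+x. (\<integral>\<^sup>+u. indicator {0..h x} u * g (T u x) \<partial>lborel) \<partial>\<mu>X) / (\<integral>\<^sup>+x. ennreal (h x) \<partial>\<mu>X)"
    if g: "g \<in> borel_measurable borel"
  proof -
    have "g \<in> borel_measurable N0" using g by (simp add: N0_def)
    then show ?thesis unfolding eq using nn[OF g]
      by (simp add: nn_integral_scale_measure hb_def divide_ennreal_def mult.commute)
  qed
qed

text \<open>Dyadic layers: where \<open>H\<close> lies between \<open>2 ^ n\<close> and
  \<open>2 ^ Suc n\<close>, its power is at most \<open>c n\<close>, and the tail bound at the
  integer \<open>2 ^ n\<close> makes the contribution of the layer geometric with ratio
  \<open>2 powr (p - \<beta>)\<close>, which is below 1.\<close>

lemma tail_imp_moment: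
  fixes H :: "'a \<Rightarrow> real"
  assumes M: "prob_space M" and H [measurable]: "H \<in> borel_measurable M" and Y [measurable]: "Y \<in> sets M"
    and AE: "AE y in M. y \<in> Y" and H0: "\<And>y. y \<in> Y \<Longrightarrow> 0 \<le> H y"
    and p: "0 < p" "p < \<beta>"
    and tail: "\<And>n::nat. n \<ge> 1 \<Longrightarrow> measure M {y \<in> Y. H y > real n} \<le> K * real n powr (- \<beta>)"
  shows "integrable M (\<lambda>y. H y powr p)"
proof (rule integrableI_bounded)
  interpret prob_space M by (rule M)
  define A where "A n = {y \<in> Y. H y > real (2 ^ n)}" for n :: nat
  have A [measurable]: "A n \<in> sets M" for n
  proof -
    have "A n = Y \<inter> {y \<in> space M. H y > real (2 ^ n)}" using sets.sets_into_space[OF Y] by (auto simp: A_def)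
    then show ?thesis by simp
  qed
  define c where "c n = 2 powr (real (Suc n) * p)" for n
  have pt: "ennreal (H y powr p) \<le> 1 + (\<Sum>n. ennreal (c n) * indicator (A n) y)" if y: "y \<in> Y" for y
  proof (cases "H y \<le> 1")
    case True
    have "H y powr p \<le> 1 powr p" using True H0[OF y] p by (intro powr_mono2) auto
    then have "ennreal (H y powr p) \<le> 1" by (simp add: ennreal_le_1)
    then show ?thesis using add_increasing2[of "\<Sum>n. ennreal (c n) * indicator (A n) y"] by simp
  next
    case False
    define k where "k = (LEAST k. H y \<le> 2 ^ k)"
    obtain k0 where "H y < 2 ^ k0" using real_arch_pow[of 2 "H y"] by auto
    then have Hk: "H y \<le> 2 ^ k" unfolding k_def by (intro LeastI[of "\<lambda>k. H y \<le> 2 ^ k" k0]) simp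
    have "k \<noteq> 0" using Hk False by (metis power_0)
    then obtain n where n: "k = Suc n" using not0_implies_Suc by blast
    have "\<not> H y \<le> 2 ^ n" using not_less_Least[of n "\<lambda>k. H y \<le> 2 ^ k"] n unfolding k_def by simp
    then have yA: "y \<in> A n" using y by (simp add: A_def)
    have "H y powr p \<le> (2 ^ Suc n) powr p" using Hk n H0[OF y] p by (intro powr_mono2) auto
    also have "(2 ^ Suc n :: real) powr p = c n"
      unfolding c_def powr_powr[symmetric] by (simp only: powr_realpow[of 2] zero_less_numeral)
    finally have "ennreal (H y powr p) \<le> ennreal (c n) * indicator (A n) y" using yA by (simp add: ennreal_leI)
    also have "\<dots> \<le> (\<Sum>n. ennreal (c n) * indicator (A n) y)"
    proof -
      define z where "z n = ennreal (c n) * indicator (A n) y" for n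
      have "z n \<le> suminf z" using sum_le_suminf[of z "{n}"] by simp
      then show ?thesis by (simp add: z_def[abs_def])
    qed
    also have "\<dots> \<le> 1 + \<dots>" by (rule add_increasing) auto
    finally show ?thesis .
  qed
  define d where "d n = \<bar>K\<bar> * 2 powr p * (2 powr (p - \<beta>)) ^ n" for n :: nat
  have cd: "ennreal (c n) * emeasure M (A n) \<le> ennreal (d n)" for n
  proof -
    have "c n * measure M (A n) \<le> c n * (\<bar>K\<bar> * (2 ^ n) powr (- \<beta>))"
    proof (rule mult_left_mono)
      have "measure M (A n) \<le> K * real (2 ^ n) powr (- \<beta>)" unfolding A_def by (rule tail) simp
      also have "\<dots> \<le> \<bar>K\<bar> * real (2 ^ n) powr (- \<beta>)" by (intro mult_right_mono) auto
      finally show "measure M (A n) \<le> \<bar>K\<bar> * (2 ^ n) powr (- \<beta>)" by simp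
    qed (simp add: c_def)
    also have "\<dots> = d n"
    proof -
      have "(2 ^ n :: real) powr (- \<beta>) = 2 powr (real n * (- \<beta>))"
        unfolding powr_powr[symmetric] by (simp add: powr_realpow)
      moreover have "(2 powr (p - \<beta>)) ^ n = 2 powr (real n * (p - \<beta>))"
        by (simp add: powr_powr mult.commute flip: powr_realpow)
      ultimately show ?thesis unfolding c_def d_def
        by (simp add: algebra_simps flip: powr_add)
    qed
    finally show ?thesis by (simp add: emeasure_eq_measure ennreal_mult[symmetric] c_def ennreal_leI)
  qed
  have "(\<integral>\<^sup>+y. ennreal (norm (H y powr p)) \<partial>M) \<le> (\<integral>\<^sup>+y. 1 + (\<Sum>n. ennreal (c n) * indicator (A n) y) \<partial>M)"
    using AE pt by (intro nn_integral_mono_AE) (auto elim!: eventually_mono)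
  also have "\<dots> = 1 + (\<Sum>n. ennreal (c n) * emeasure M (A n))"
    by (subst nn_integral_add) (auto simp: nn_integral_suminf nn_integral_cmult_indicator emeasure_space_1)
  also have "\<dots> \<le> 1 + (\<Sum>n. ennreal (d n))"
    by (intro add_left_mono suminf_le cd) auto
  also have "\<dots> < \<infinity>"
  proof -
    have "2 powr (p - \<beta>) < 2 powr (0::real)" using p by (intro powr_less_mono) auto
    also have "\<dots> = 1" by simp
    finally have lt: "norm (2 powr (p - \<beta>)) < 1" by simp
    have "summable d" unfolding d_def by (intro summable_mult summable_geometric lt)
    moreover have "0 \<le> d n" for n by (simp add: d_def)
    ultimately have "(\<Sum>n. ennreal (d n)) \<noteq> top" by (rule ennreal_suminf_neq_top)
    then show ?thesis by (simp add: less_top[symmetric])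
  qed
  finally show "(\<integral>\<^sup>+y. ennreal (norm (H y powr p)) \<partial>M) < \<infinity>" .
qed measurable

section \<open>From scalar moments to norms of vectors and matrices\<close>

lemma Lq_norm_le:
  assumes q: "q > 0" and B: "0 \<le> B" and le: "(\<integral>\<^sup>+x. ennreal (norm (g x) powr q) \<partial>M) \<le> ennreal B"
  shows "Lq_norm M q g \<le> ereal (B powr (1 / q))"
proof -
  have fin: "(\<integral>\<^sup>+x. ennreal (norm (g x) powr q) \<partial>M) \<noteq> \<infinity>" using le by (auto simp: top_unique)
  have "enn2real (\<integral>\<^sup>+x. ennreal (norm (g x) powr q) \<partial>M) \<le> B" using le B by (simp add: enn2real_leI)
  then have "enn2real (\<integral>\<^sup>+x. ennreal (norm (g x) powr q) \<partial>M) powr (1 / q) \<le> B powr (1 / q)"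
    using q by (intro powr_mono2) auto
  then show ?thesis using fin by (simp add: Lq_norm_def Let_def)
qed

lemma powr_sum_card_le:
  fixes x :: "'i \<Rightarrow> real"
  assumes A: "finite A" and x: "\<And>i. i \<in> A \<Longrightarrow> 0 \<le> x i" and r: "0 \<le> r"
  shows "(\<Sum>i\<in>A. x i) powr r \<le> real (card A) powr r * (\<Sum>i\<in>A. x i powr r)"
proof (cases "A = {}")
  case False
  define z where "z = Max (x ` A)"
  have z: "x i \<le> z" if "i \<in> A" for i using A that by (simp add: z_def)
  have "z \<in> x ` A" unfolding z_def using A False by (intro Max_in) auto
  then obtain i0 where i0: "i0 \<in> A" "z = x i0" by blast
  have "(\<Sum>i\<in>A. x i) \<le> real (card A) * z" using z by (intro sum_bounded_above) auto
  then have "(\<Sum>i\<in>A. x i) powr r \<le> (real (card A) * z) powr r" using r x by (intro powr_mono2) (auto intro: sum_nonneg)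
  also have "\<dots> = real (card A) powr r * z powr r" using x[OF i0(1)] i0 by (simp add: powr_mult)
  also have "z powr r \<le> (\<Sum>i\<in>A. x i powr r)" unfolding i0(2) using A i0 by (intro member_le_sum) auto
  finally show ?thesis by (simp add: mult_left_mono)
qed simp

text \<open>Membership in \<open>holder0\<close> bounds the two sets whose suprema make up
  \<open>holder_norm\<close>; without boundedness these suprema would carry no information.\<close>

lemma holder0_bounds:
  assumes v: "v \<in> holder0 \<eta> \<mu>"
  shows "norm (v x) \<le> holder_norm \<eta> v" "norm (v x - v x') \<le> holder_norm \<eta> v * dist x x' powr \<eta>"
    "0 \<le> holder_norm \<eta> v"
proof -
  obtain K where K: "\<And>x x'. norm (v x - v x') \<le> K * dist x x' powr \<eta>" using v by (auto simp: holder0_def)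
  let ?S = "insert 0 {norm (v x - v x') / dist x x' powr \<eta> | x x'. x \<noteq> x'}"
  obtain b where "\<And>x. norm (v x) \<le> b" using v by (auto simp: holder0_def bounded_iff)
  then have "bdd_above (range (\<lambda>x. norm (v x)))" by (intro bdd_aboveI2[of _ _ b])
  then have 1: "norm (v x) \<le> (SUP x. norm (v x))" for x by (intro cSUP_upper) auto
  have bS: "bdd_above ?S"
  proof (rule bdd_aboveI[of _ "max K 0"])
    fix z assume "z \<in> ?S"
    then show "z \<le> max K 0" using K by (auto simp: divide_le_eq le_max_iff_disj)
  qed
  have S0: "0 \<le> Sup ?S" using bS by (intro cSup_upper) auto
  have 0: "0 \<le> (SUP x. norm (v x))" using 1[of undefined] norm_ge_zero order_trans by blast
  show "0 \<le> holder_norm \<eta> v" using S0 0 by (simp add: holder_norm_def)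
  show "norm (v x) \<le> holder_norm \<eta> v" using 1[of x] S0 by (simp add: holder_norm_def)
  show "norm (v x - v x') \<le> holder_norm \<eta> v * dist x x' powr \<eta>"
  proof (cases "x = x'")
    case False
    then have p: "0 < dist x x' powr \<eta>" by simp
    have "norm (v x - v x') / dist x x' powr \<eta> \<le> Sup ?S" using bS False by (intro cSup_upper) auto
    also have "\<dots> \<le> holder_norm \<eta> v" using 0 by (simp add: holder_norm_def)
    finally show ?thesis using p by (simp add: divide_le_eq)
  qed simp
qed

lemma norm_matrix_le: "norm (A :: real^'n^'m) \<le> (\<Sum>(i, j)\<in>UNIV. \<bar>A $ i $ j\<bar>)"
proof -
  have "norm A \<le> (\<Sum>i\<in>UNIV. norm (A $ i))" unfolding norm_vec_def by (rule L2_set_le_sum) auto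
  also have "\<dots> \<le> (\<Sum>i\<in>UNIV. \<Sum>j\<in>UNIV. \<bar>A $ i $ j\<bar>)" by (intro sum_mono norm_le_l1_cart)
  finally show ?thesis by (simp add: sum.cartesian_product)
qed

lemma integral_matrix_nth:
  fixes f :: "real \<Rightarrow> real^'n^'m"
  assumes "f integrable_on A" shows "integral A f $ i $ j = integral A (\<lambda>s. f s $ i $ j)"
proof -
  have "bounded_linear (\<lambda>A :: real^'n^'m. A $ i $ j)"
    by (rule bounded_linear_compose[OF bounded_linear_vec_nth bounded_linear_vec_nth])
  from integral_linear[OF assms this] show ?thesis by (simp add: comp_def)
qed

text \<open>Reduces vectors and matrices to finitely many scalar components: the power
  \<open>r\<close> of a sum of \<open>n\<close> terms costs the factor \<open>n powr r\<close>, and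
  the constant density \<open>c\<close> passes from the unnormalised measure to
  \<open>\<mu>\<close>.\<close>

lemma Lq_norm_le_components:
  fixes w :: "'k::finite \<Rightarrow> 'a::topological_space \<Rightarrow> real"
  assumes M: "finite_measure M" "sets M = sets borel" and r: "r > 0"
    and c: "\<mu> = density M (\<lambda>_. ennreal c)" "c \<ge> 0"
    and w: "\<And>k. w k \<in> borel_measurable borel" and b: "\<And>k x. \<bar>w k x\<bar> \<le> b"
    and B: "\<And>k. (\<integral>x. \<bar>w k x\<bar> powr r \<partial>M) \<le> B" and L: "L \<ge> 0"
    and g: "\<And>x. norm (g x) \<le> L * (\<Sum>k\<in>UNIV. \<bar>w k x\<bar>)"
  shows "Lq_norm \<mu> r g \<le> ereal ((c * (real CARD('k) powr r * (real CARD('k) * B))) powr (1 / r) * L)"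
proof -
  define n where "n = real CARD('k)"
  have wm [measurable]: "w k \<in> borel_measurable M" for k using w M(2) measurable_cong_sets by blast
  have "0 \<le> (\<integral>x. \<bar>w undefined x\<bar> powr r \<partial>M)" by simp
  then have B0: "0 \<le> B" using B[of undefined] by linarith
  let ?g = "\<lambda>x. L powr r * (n powr r * (\<Sum>k\<in>UNIV. \<bar>w k x\<bar> powr r))"
  have ii: "integrable M (\<lambda>x. \<bar>w k x\<bar> powr r)" for k
    using b r by (intro finite_measure.integrable_const_bound[OF M(1), of _ "b powr r"]) (auto intro!: powr_mono2)
  have pt: "norm (g x) powr r \<le> ?g x" for x
  proof -
    have "norm (g x) powr r \<le> (L * (\<Sum>k\<in>UNIV. \<bar>w k x\<bar>)) powr r" using g r by (intro powr_mono2) auto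
    also have "\<dots> = L powr r * (\<Sum>k\<in>UNIV. \<bar>w k x\<bar>) powr r" using L by (simp add: powr_mult sum_nonneg)
    also have "\<dots> \<le> ?g x" unfolding n_def using r by (intro mult_left_mono powr_sum_card_le) auto
    finally show ?thesis .
  qed
  have "(\<integral>\<^sup>+x. ennreal (norm (g x) powr r) \<partial>\<mu>) \<le> (\<integral>\<^sup>+x. ennreal (?g x) \<partial>\<mu>)"
    using pt by (intro nn_integral_mono ennreal_leI)
  also have "\<dots> = (\<integral>\<^sup>+x. ennreal c * ennreal (?g x) \<partial>M)"
    unfolding c(1) by (rule nn_integral_density) measurable
  also have "\<dots> = ennreal c * (\<integral>\<^sup>+x. ennreal (?g x) \<partial>M)" by (rule nn_integral_cmult) measurable
  also have "(\<integral>\<^sup>+x. ennreal (?g x) \<partial>M) = ennreal (\<integral>x. ?g x \<partial>M)"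
    using ii by (intro nn_integral_eq_integral AE_I2 mult_nonneg_nonneg sum_nonneg) auto
  also have "ennreal c * \<dots> = ennreal (c * (\<integral>x. ?g x \<partial>M))" using c by (simp add: ennreal_mult')
  also have "c * (\<integral>x. ?g x \<partial>M) = c * (L powr r * (n powr r * (\<Sum>k\<in>UNIV. (\<integral>x. \<bar>w k x\<bar> powr r \<partial>M))))"
    using ii by simp
  also have "ennreal \<dots> \<le> ennreal (c * (L powr r * (n powr r * (\<Sum>k\<in>(UNIV :: 'k set). B))))"
    using c B by (intro ennreal_leI mult_left_mono sum_mono) auto
  also have "c * (L powr r * (n powr r * (\<Sum>k\<in>(UNIV :: 'k set). B))) = (c * (n powr r * (n * B))) * L powr r"
    by (simp add: n_def)
  finally have "Lq_norm \<mu> r g \<le> ereal (((c * (n powr r * (n * B))) * L powr r) powr (1 / r))"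
    using r c B0 by (intro Lq_norm_le) (auto simp: n_def)
  also have "((c * (n powr r * (n * B))) * L powr r) powr (1 / r) = (c * (n powr r * (n * B))) powr (1 / r) * L"
    using r c B0 L by (simp add: powr_mult powr_powr n_def)
  finally show ?thesis by (simp add: n_def)
qed

context expanding_suspension
begin

text \<open>Positivity of \<open>c\<close> transports mean zero from \<open>\<mu>\<close> back to
  the unnormalised measure \<open>MM\<close>, where the moment bounds live.\<close>

lemma scaled_component:
  fixes v :: "'a \<Rightarrow> real^'d"
  assumes v: "v \<in> holder0 \<eta> \<mu>" and A: "holder_norm \<eta> v > 0"
  defines "a \<equiv> \<lambda>i x. v x $ i / holder_norm \<eta> v"
  shows "unit_holder (a i)"
    and "\<mu> = density (suspension_flow.MM T H \<mu>Y) (\<lambda>_. ennreal c) \<Longrightarrow> c > 0 \<Longrightarrow>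
      (\<integral>x. a i x \<partial>suspension_flow.MM T H \<mu>Y) = 0"
proof -
  interpret SF: suspension_flow T Y F H \<mu>Y 0 0 by (rule suspension) auto
  note B = holder0_bounds[OF v]
  have vm [measurable]: "v \<in> borel_measurable borel" using v by (simp add: holder0_def)
  have vi [measurable]: "(\<lambda>x. v x $ i) \<in> borel_measurable borel"
    by (rule measurable_compose[OF vm]) (simp add: borel_measurable_continuous_onI continuous_on_component)
  have "\<bar>v x $ i\<bar> \<le> holder_norm \<eta> v" for x using component_le_norm_cart[of "v x" i] B(1)[of x] by linarith
  moreover have "\<bar>v x $ i - v x' $ i\<bar> \<le> holder_norm \<eta> v * dist x x' powr \<eta>" for x x'
    using component_le_norm_cart[of "v x - v x'" i] B(2)[of x x'] by simp
  ultimately show "unit_holder (a i)"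
    using A by (auto simp: unit_holder_def a_def divide_le_eq mult.commute simp flip: diff_divide_distrib)
  have int: "integrable SF.MM v" using B(1) by (intro SF.MM.integrable_const_bound[of _ "holder_norm \<eta> v"]) auto
  assume c: "\<mu> = density SF.MM (\<lambda>_. ennreal c)" "c > 0"
  have "(\<integral>x. v x \<partial>\<mu>) = (\<integral>x. c *\<^sub>R v x \<partial>SF.MM)" unfolding c(1) using c(2) by (subst integral_density) auto
  then have "c *\<^sub>R (\<integral>x. v x \<partial>SF.MM) = 0" using v by (simp add: holder0_def)
  then have "(\<integral>x. v x \<partial>SF.MM) = 0" using c(2) by simp
  moreover have "(\<integral>x. v x $ i \<partial>SF.MM) = (\<integral>x. v x \<partial>SF.MM) $ i"
    using integral_bounded_linear[OF bounded_linear_vec_nth int] by simp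
  ultimately show "(\<integral>x. a i x \<partial>SF.MM) = 0" by (simp add: a_def)
qed

lemma Lq_norm_flow_integral:
  assumes q: "q > 1" and iH: "integrable \<mu>Y (\<lambda>y. H y * (H y + 1) powr q)"
    and c: "\<mu> = density (suspension_flow.MM T H \<mu>Y) (\<lambda>_. ennreal c)" "c \<ge> 0"
  shows "\<exists>C>0. \<forall>v \<in> (holder0 \<eta> \<mu> :: ('a \<Rightarrow> real^'d) set). \<forall>t>0.
      Lq_norm \<mu> (2 * q) (\<lambda>x. integral {0..t} (\<lambda>s. v (T s x))) \<le> ereal (C * t powr (1/2) * holder_norm \<eta> v)"
proof -
  interpret SF: suspension_flow T Y F H \<mu>Y 0 0 by (rule suspension) auto
  note Lq = Lq_norm_le_components[OF SF.MM.finite_measure_axioms SF.sets_MM _ c]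
  obtain C' where C': "\<And>a t. unit_holder a \<Longrightarrow> (\<integral>x. a x \<partial>SF.MM) = 0 \<Longrightarrow> 0 < t \<Longrightarrow>
      (\<integral>x. \<bar>SF.I a x t\<bar> powr (2 * q) \<partial>SF.MM) \<le> C' * t powr q"
    using flow_moments(1)[OF q iH] unfolding SF.I_def by blast
  define d where "d = real CARD('d)"
  define E where "E = c * (d powr (2 * q) * (d * \<bar>C'\<bar>))"
  have E0: "0 \<le> E" using c by (simp add: E_def d_def)
  \<comment> \<open>The \<open>+ 1\<close> makes the constant strictly positive even if
    \<open>E\<close> vanishes.\<close>
  have "Lq_norm \<mu> (2 * q) (\<lambda>x. integral {0..t} (\<lambda>s. v (T s x))) \<le> ereal ((E powr (1 / (2 * q)) + 1) * t powr (1/2) * holder_norm \<eta> v)"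
    if v: "v \<in> holder0 \<eta> \<mu>" and t: "0 < t" for v :: "'a \<Rightarrow> real^'d" and t
  proof (cases "holder_norm \<eta> v = 0")
    case True
    then have "v x = 0" for x using holder0_bounds(1)[OF v, of x] by simp
    then show ?thesis
      using Lq[of "2 * q" "\<lambda>(_::'d) _. 0" 0 0 0 "\<lambda>x. integral {0..t} (\<lambda>s. v (T s x))"] q True by simp
  next
    case False
    define A where "A = holder_norm \<eta> v"
    have A0: "A > 0" using False holder0_bounds(3)[OF v] by (simp add: A_def)
    define a where "a i x = v x $ i / A" for i x
    have a: "unit_holder (a i)" for i
      using scaled_component(1)[OF v] A0 by (simp add: a_def[abs_def] A_def)
    have oa: "SF.ob (a i)" for i
      using a[of i] unit_holder_flow_cont[OF a[of i]] by (auto simp: SF.ob_def unit_holder_def)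
    have ac: "continuous_on {0..s} (\<lambda>u. a i (T u x))" for i s x
      by (rule continuous_on_subset[OF unit_holder_flow_cont[OF a]]) auto
    have va: "v x = (\<chi> i. A * a i x)" for x using A0 by (simp add: a_def vec_eq_iff)
    have comp: "integral {0..t} (\<lambda>s. v (T s x)) $ i = A * SF.I (a i) x t" for x i
    proof -
      have "continuous_on {0..t} (\<lambda>s. v (T s x))"
        unfolding va by (intro continuous_on_vec_lambda continuous_on_mult_left ac)
      then have "integral {0..t} (\<lambda>s. v (T s x)) $ i = integral {0..t} (\<lambda>s. v (T s x) $ i)"
        by (intro integral_component_eq_cart[symmetric] integrable_continuous_real)
      then show ?thesis by (simp add: va SF.I_def)
    qed
    have nrm: "norm (integral {0..t} (\<lambda>s. v (T s x))) \<le> A * (\<Sum>i\<in>UNIV. \<bar>SF.I (a i) x t\<bar>)" for x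
      using norm_le_l1_cart[of "integral {0..t} (\<lambda>s. v (T s x))"] A0 by (simp add: comp abs_mult sum_distrib_left)
    have Im: "(\<lambda>x. SF.I (a i) x t) \<in> borel_measurable borel" for i
      by (rule SF.I_measurable[OF oa]) auto
    \<comment> \<open>For \<open>c = 0\<close> the measure \<open>\<mu>\<close> is null, and mean
      zero under it says nothing about \<open>MM\<close>; the trivial bound from
      \<open>I_bound\<close> serves there, and the factor \<open>c\<close> erases it.\<close>
    define B where "B = (if c = 0 then \<bar>t\<bar> powr (2 * q) * measure SF.MM UNIV else \<bar>C'\<bar> * t powr q)"
    have Ib: "(\<integral>x. \<bar>SF.I (a i) x t\<bar> powr (2 * q) \<partial>SF.MM) \<le> B" for i
    proof (cases "c = 0")
      case True
      have "\<bar>SF.I (a i) x t\<bar> powr (2 * q) \<le> \<bar>t\<bar> powr (2 * q)" for x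
        using SF.I_bound[OF oa[of i], of t x] t q by (intro powr_mono2) auto
      then have "(\<integral>x. \<bar>SF.I (a i) x t\<bar> powr (2 * q) \<partial>SF.MM) \<le> (\<integral>x. \<bar>t\<bar> powr (2 * q) \<partial>SF.MM)"
        by (intro integral_mono_AE') auto
      then show ?thesis using True by (simp add: B_def mult.commute)
    next
      case False
      then have "(\<integral>x. a i x \<partial>SF.MM) = 0"
        using scaled_component(2)[OF v _ c(1)] c(2) A0 by (simp add: a_def[abs_def] A_def)
      from C'[OF a this t] have "(\<integral>x. \<bar>SF.I (a i) x t\<bar> powr (2 * q) \<partial>SF.MM) \<le> C' * t powr q" .
      also have "\<dots> \<le> \<bar>C'\<bar> * t powr q" by (intro mult_right_mono) auto
      finally show ?thesis using False by (simp add: B_def)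
    qed
    have "Lq_norm \<mu> (2 * q) (\<lambda>x. integral {0..t} (\<lambda>s. v (T s x))) \<le> ereal ((c * (d powr (2 * q) * (d * B))) powr (1 / (2 * q)) * A)"
      unfolding d_def using q SF.I_bound[OF oa, of t] t A0 by (intro Lq[OF _ Im _ Ib _ nrm]) auto
    also have "c * (d powr (2 * q) * (d * B)) = E * t powr q" by (simp add: B_def E_def)
    also have "(E * t powr q) powr (1 / (2 * q)) * A = E powr (1 / (2 * q)) * t powr (1/2) * A"
      using q E0 by (simp add: powr_mult powr_powr)
    also have "ereal \<dots> \<le> ereal ((E powr (1 / (2 * q)) + 1) * t powr (1/2) * A)"
      using A0 by (simp add: mult_right_mono)
    finally show ?thesis by (simp add: A_def)
  qed
  then show ?thesis by (intro exI[of _ "E powr (1 / (2 * q)) + 1"]) (auto simp: add_nonneg_pos)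
qed

lemma Lq_norm_flow_iterated_integral:
  assumes q: "q > 3" and iH: "integrable \<mu>Y (\<lambda>y. H y * (H y + 1) powr q)"
    and c: "\<mu> = density (suspension_flow.MM T H \<mu>Y) (\<lambda>_. ennreal c)" "c \<ge> 0"
  shows "\<exists>C>0. \<forall>v \<in> (holder0 \<eta> \<mu> :: ('a \<Rightarrow> real^'d) set). \<forall>t>0.
      Lq_norm \<mu> (2 * q / 3) (\<lambda>x. integral {0..t} (\<lambda>s. integral {0..s} (\<lambda>r. outer (v (T r x)) (v (T s x)))))
        \<le> ereal (C * t * (holder_norm \<eta> v)\<^sup>2)"
proof -
  interpret SF: suspension_flow T Y F H \<mu>Y 0 0 by (rule suspension) auto
  note Lq = Lq_norm_le_components[OF SF.MM.finite_measure_axioms SF.sets_MM _ c]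
  define r where "r = 2 * q / 3"
  have r: "r > 0" and q1: "q > 1" using q by (auto simp: r_def)
  obtain C' where C': "\<And>a b t. unit_holder a \<Longrightarrow> (\<integral>x. a x \<partial>SF.MM) = 0 \<Longrightarrow> unit_holder b \<Longrightarrow> (\<integral>x. b x \<partial>SF.MM) = 0 \<Longrightarrow> 0 < t \<Longrightarrow>
      (\<integral>x. \<bar>SF.S a b x t\<bar> powr r \<partial>SF.MM) \<le> C' * t powr r"
    using flow_moments(2)[OF q1 iH q] unfolding SF.S_def SF.I_def r_def by blast
  define d where "d = real CARD('d \<times> 'd)"
  define E where "E = c * (d powr r * (d * \<bar>C'\<bar>))"
  have E0: "0 \<le> E" using c by (simp add: E_def d_def)
  have "Lq_norm \<mu> r (\<lambda>x. integral {0..t} (\<lambda>s. integral {0..s} (\<lambda>r. outer (v (T r x)) (v (T s x))))) \<le> ereal ((E powr (1 / r) + 1) * t * (holder_norm \<eta> v)\<^sup>2)"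
    if v: "v \<in> holder0 \<eta> \<mu>" and t: "0 < t" for v :: "'a \<Rightarrow> real^'d" and t
  proof (cases "holder_norm \<eta> v = 0")
    case True
    then have "v x = 0" for x using holder0_bounds(1)[OF v, of x] by simp
    then have z: "outer (v (T r x)) (v (T s x)) = 0" for r s x by (simp add: outer_def vec_eq_iff)
    show ?thesis
      using Lq[of r "\<lambda>(_::'d) _. 0" 0 0 0 "\<lambda>x. integral {0..t} (\<lambda>s. integral {0..s} (\<lambda>r. outer (v (T r x)) (v (T s x))))"] r True by (simp add: z)
  next
    case False
    define A where "A = holder_norm \<eta> v"
    have A0: "A > 0" using False holder0_bounds(3)[OF v] by (simp add: A_def)
    define a where "a i x = v x $ i / A" for i x
    have a: "unit_holder (a i)" for i
      using scaled_component(1)[OF v] A0 by (simp add: a_def[abs_def] A_def)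
    have oa: "SF.ob (a i)" for i
      using a[of i] unit_holder_flow_cont[OF a[of i]] by (auto simp: SF.ob_def unit_holder_def)
    have ac: "continuous_on {0..s} (\<lambda>u. a i (T u x))" for i s x
      by (rule continuous_on_subset[OF unit_holder_flow_cont[OF a]]) auto
    have va: "v x $ i = A * a i x" for x i using A0 by (simp add: a_def)
    \<comment> \<open>The inner integral is computed with the outer vector \<open>w\<close> frozen,
      so that the double integral splits into the entries \<open>S (a i) (a j)\<close>.\<close>
    have inner: "integral {0..s} (\<lambda>r. outer (v (T r x)) w) = (\<chi> i j. A * SF.I (a i) x s * w $ j)" for s x w
    proof -
      have "(\<lambda>r. outer (v (T r x)) w) integrable_on {0..s}"
        unfolding outer_def va
        by (intro integrable_continuous_real continuous_on_vec_lambda continuous_on_mult_left continuous_on_mult_right ac)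
      from integral_matrix_nth[OF this] show ?thesis
        by (simp add: vec_eq_iff outer_def va SF.I_def)
    qed
    have comp: "integral {0..t} (\<lambda>s. integral {0..s} (\<lambda>r. outer (v (T r x)) (v (T s x)))) $ i $ j = A\<^sup>2 * SF.S (a i) (a j) x t" for x i j
    proof -
      have "(\<lambda>s. \<chi> i j. A * SF.I (a i) x s * v (T s x) $ j) integrable_on {0..t}"
      proof (intro integrable_continuous_real continuous_on_vec_lambda)
        fix i j
        have "continuous_on {0..t} (\<lambda>s. A * A * (SF.I (a i) x s * a j (T s x)))"
          by (intro continuous_on_mult_left continuous_on_subset[OF SF.S_cont[OF oa oa]]) auto
        then show "continuous_on {0..t} (\<lambda>s. A * SF.I (a i) x s * v (T s x) $ j)" by (simp add: va ac_simps)
      qed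
      from integral_matrix_nth[OF this, of i j]
      have "integral {0..t} (\<lambda>s. integral {0..s} (\<lambda>r. outer (v (T r x)) (v (T s x)))) $ i $ j
          = integral {0..t} (\<lambda>s. A * SF.I (a i) x s * v (T s x) $ j)"
        unfolding inner by simp
      also have "\<dots> = integral {0..t} (\<lambda>s. A\<^sup>2 * (SF.I (a i) x s * a j (T s x)))"
        by (rule Henstock_Kurzweil_Integration.integral_cong) (simp add: va power2_eq_square)
      finally show ?thesis by (simp add: SF.S_def)
    qed
    have nrm: "norm (integral {0..t} (\<lambda>s. integral {0..s} (\<lambda>r. outer (v (T r x)) (v (T s x))))) \<le> A\<^sup>2 * (\<Sum>k\<in>UNIV. \<bar>SF.S (a (fst k)) (a (snd k)) x t\<bar>)" for x
      using norm_matrix_le[of "integral {0..t} (\<lambda>s. integral {0..s} (\<lambda>r. outer (v (T r x)) (v (T s x))))"]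
      by (simp add: comp abs_mult sum_distrib_left split_beta')
    have Sm: "(\<lambda>x. SF.S (a (fst k)) (a (snd k)) x t) \<in> borel_measurable borel" for k
      by (rule SF.S_measurable[OF oa oa]) auto
    define B where "B = (if c = 0 then (t * t) powr r * measure SF.MM UNIV else \<bar>C'\<bar> * t powr r)"
    have Sb: "(\<integral>x. \<bar>SF.S (a (fst k)) (a (snd k)) x t\<bar> powr r \<partial>SF.MM) \<le> B" for k
    proof (cases "c = 0")
      case True
      have "\<bar>SF.S (a (fst k)) (a (snd k)) x t\<bar> powr r \<le> (t * t) powr r" for x
        using SF.S_bound[OF oa oa, of t] t r by (intro powr_mono2) auto
      then have "(\<integral>x. \<bar>SF.S (a (fst k)) (a (snd k)) x t\<bar> powr r \<partial>SF.MM) \<le> (\<integral>x. (t * t) powr r \<partial>SF.MM)"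
        by (intro integral_mono_AE') auto
      then show ?thesis using True by (simp add: B_def mult.commute)
    next
      case False
      then have z: "(\<integral>x. a i x \<partial>SF.MM) = 0" for i
        using scaled_component(2)[OF v _ c(1)] c(2) A0 by (simp add: a_def[abs_def] A_def)
      from C'[OF a z a z t] have "(\<integral>x. \<bar>SF.S (a (fst k)) (a (snd k)) x t\<bar> powr r \<partial>SF.MM) \<le> C' * t powr r" .
      also have "\<dots> \<le> \<bar>C'\<bar> * t powr r" by (intro mult_right_mono) auto
      finally show ?thesis using False by (simp add: B_def)
    qed
    have "Lq_norm \<mu> r (\<lambda>x. integral {0..t} (\<lambda>s. integral {0..s} (\<lambda>r. outer (v (T r x)) (v (T s x))))) \<le> ereal ((c * (d powr r * (d * B))) powr (1 / r) * A\<^sup>2)"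
      unfolding d_def using r SF.S_bound[OF oa oa, of t] t by (intro Lq[OF _ Sm _ Sb _ nrm]) auto
    also have "c * (d powr r * (d * B)) = E * t powr r" by (simp add: B_def E_def)
    also have "(E * t powr r) powr (1 / r) * A\<^sup>2 = E powr (1 / r) * t * A\<^sup>2"
      using r E0 t by (simp add: powr_mult powr_powr)
    also have "ereal \<dots> \<le> ereal ((E powr (1 / r) + 1) * t * A\<^sup>2)"
      using t by (simp add: mult_right_mono)
    finally show ?thesis by (simp add: A_def)
  qed
  then show ?thesis unfolding r_def by (intro exI[of _ "E powr (1 / (2 * q / 3)) + 1"]) (auto simp: add_nonneg_pos)
qed

end

section \<open>The suspension over the tower as a suspension over the base\<close>

lemma iterate_eq_flow:
  fixes T :: "real \<Rightarrow> 'a \<Rightarrow> 'a"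
  assumes T_zero: "\<And>x. T 0 x = x" and T_add: "\<And>s t x. s \<ge> 0 \<Longrightarrow> t \<ge> 0 \<Longrightarrow> T (s + t) x = T s (T t x)"
    and h_pos: "\<And>x. x \<in> X \<Longrightarrow> h x > 0" and f_def: "\<And>x. f x = T (h x) x" and f_X: "f ` X \<subseteq> X"
    and x: "x \<in> X"
  shows "(f ^^ n) x \<in> X \<and> (f ^^ n) x = T (\<Sum>l<n. h ((f ^^ l) x)) x \<and> 0 \<le> (\<Sum>l<n. h ((f ^^ l) x))"
proof (induction n)
  case 0 then show ?case using x by (auto simp: T_zero)
next
  case (Suc n)
  let ?s = "\<Sum>l<n. h ((f ^^ l) x)"
  have p: "0 < h ((f ^^ n) x)" and e: "(f ^^ n) x = T ?s x" and s: "0 \<le> ?s" using Suc h_pos by blast+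
  have "(f ^^ Suc n) x = T (h ((f ^^ n) x)) ((f ^^ n) x)" using f_def by simp
  also have "\<dots> = T (h ((f ^^ n) x)) (T ?s x)" by (rule arg_cong[OF e])
  also have "\<dots> = T (h ((f ^^ n) x) + ?s) x" using T_add s p by simp
  finally show ?case using Suc f_X p by (auto simp: add.commute)
qed

text \<open>Along the tower above \<open>y\<close>, the flow segments of lengths \<open>h\<close> at
  successive levels concatenate to the segment over \<open>[0, H y)\<close>, end points being null,
  so both measures integrate alike over fibres. For a finite mean return time \<open>tb\<close>,
  dividing by \<open>tb\<close> and then by \<open>hb = Hb / tb\<close> leaves
  \<open>1 / Hb\<close>.\<close>

lemma suspension_tower_measure_eq:
  fixes T :: "real \<Rightarrow> 'a::metric_space \<Rightarrow> 'a"
  assumes SF: "suspension_flow T Y F (induced_roof h f \<tau>) \<mu>Y 0 0"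
    and YX: "Y \<subseteq> X" and h [measurable]: "h \<in> borel_measurable borel" and h_pos: "\<And>x. x \<in> X \<Longrightarrow> h x > 0"
    and f_def: "\<And>x. f x = T (h x) x" and f_X: "f ` X \<subseteq> X"
    and \<tau> [measurable]: "\<tau> \<in> measurable borel (count_space UNIV)" and \<tau>1: "\<And>y. y \<in> Y \<Longrightarrow> \<tau> y \<ge> 1"
    and low: "\<epsilon> > 0" "\<And>y. y \<in> Y \<Longrightarrow> \<epsilon> \<le> induced_roof h f \<tau> y"
  shows "\<exists>c\<ge>0. suspension_measure (tower_measure \<mu>Y \<tau> f) h T
    = density (suspension_flow.MM T (induced_roof h f \<tau>) \<mu>Y) (\<lambda>_. ennreal c)"
proof -
  define H where "H = induced_roof h f \<tau>"
  interpret SF: suspension_flow T Y F H \<mu>Y 0 0 using SF by (simp add: H_def)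
  have f [measurable]: "f \<in> borel_measurable borel" unfolding f_def[abs_def] by measurable
  define X' where "X' = tower_measure \<mu>Y \<tau> f"
  note X'nn = tower_measure_nn_integral[OF SF.muY_sets \<tau> f, folded X'_def]
  note Mnn = suspension_measure_nn_integral[OF X'nn(1) SF.T_meas h]
  define tb where "tb = (\<integral>\<^sup>+y. ennreal (real (\<tau> y)) \<partial>\<mu>Y)"
  define hb where "hb = (\<integral>\<^sup>+x. ennreal (h x) \<partial>X')"
  have orb: "(f ^^ n) y \<in> X" "(f ^^ n) y = T (\<Sum>l<n. h ((f ^^ l) y)) y" "0 \<le> (\<Sum>l<n. h ((f ^^ l) y))"
    if "y \<in> Y" for n y
    using iterate_eq_flow[OF SF.T_zero SF.T_add h_pos f_def f_X, where x=y and n=n] that YX by auto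
  have cell: "(\<Sum>l<n. \<integral>\<^sup>+u. indicator {0..h ((f ^^ l) y)} u * g (T u ((f ^^ l) y)) \<partial>lborel)
      = (\<integral>\<^sup>+u. indicator {0..<(\<Sum>l<n. h ((f ^^ l) y))} u * g (T u y) \<partial>lborel)"
    if y: "y \<in> Y" and [measurable]: "g \<in> borel_measurable borel" for y n and g :: "'a \<Rightarrow> ennreal"
  proof (induction n)
    case (Suc n)
    let ?s = "\<Sum>l<n. h ((f ^^ l) y)" and ?x = "(f ^^ n) y"
    have x: "?x = T ?s y" "0 \<le> ?s" "0 < h ?x" using orb[OF y] h_pos by blast+
    have "(\<integral>\<^sup>+u. indicator {0..h ?x} u * g (T u ?x) \<partial>lborel) = (\<integral>\<^sup>+u. indicator {0..<h ?x} u * g (T u ?x) \<partial>lborel)"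
      using AE_lborel_singleton[of "h ?x"] by (intro nn_integral_cong_AE) (auto simp: indicator_def elim!: eventually_mono)
    also have "\<dots> = (\<integral>\<^sup>+u. indicator {?s..<?s + h ?x} (?s + u) * g (T (?s + u) y) \<partial>lborel)"
    proof (rule nn_integral_cong)
      fix u
      show "indicator {0..<h ?x} u * g (T u ?x) = indicator {?s..<?s + h ?x} (?s + u) * g (T (?s + u) y)"
        using x by (cases "0 \<le> u \<and> u < h ?x") (auto simp: SF.T_add add.commute[of ?s] indicator_def)
    qed
    also have "\<dots> = (\<integral>\<^sup>+u. indicator {?s..<?s + h ?x} u * g (T u y) \<partial>lborel)"
      by (rule SF.nn_shift[symmetric]) measurable
    finally have "(\<Sum>l<Suc n. \<integral>\<^sup>+u. indicator {0..h ((f ^^ l) y)} u * g (T u ((f ^^ l) y)) \<partial>lborel)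
      = (\<integral>\<^sup>+u. indicator {0..<?s} u * g (T u y) \<partial>lborel) + (\<integral>\<^sup>+u. indicator {?s..<?s + h ?x} u * g (T u y) \<partial>lborel)"
      using Suc by simp
    also have "\<dots> = (\<integral>\<^sup>+u. indicator {0..<?s} u * g (T u y) + indicator {?s..<?s + h ?x} u * g (T u y) \<partial>lborel)"
      by (rule nn_integral_add[symmetric]) measurable
    also have "\<dots> = (\<integral>\<^sup>+u. indicator {0..<?s + h ?x} u * g (T u y) \<partial>lborel)"
      using x by (intro nn_integral_cong) (auto simp: indicator_def)
    finally show ?case by simp
  qed simp
  have MMnn: "(\<integral>\<^sup>+x. g x \<partial>suspension_measure X' h T) = (\<integral>\<^sup>+x. g x \<partial>SF.MM) / tb / hb"
    if [measurable]: "g \<in> borel_measurable borel" for g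
  proof -
    have im [measurable]: "(\<lambda>x. \<integral>\<^sup>+u. indicator {0..h x} u * g (T u x) \<partial>lborel) \<in> borel_measurable borel"
    proof (rule lborel.borel_measurable_nn_integral)
      show "(\<lambda>(x, u). indicator {0..h x} u * g (T u x)) \<in> borel_measurable (borel \<Otimes>\<^sub>M lborel)"
        unfolding indicator_def split_beta' by simp
    qed
    have "(\<integral>\<^sup>+x. (\<integral>\<^sup>+u. indicator {0..h x} u * g (T u x) \<partial>lborel) \<partial>X')
        = (\<integral>\<^sup>+y. (\<Sum>l<\<tau> y. \<integral>\<^sup>+u. indicator {0..h ((f ^^ l) y)} u * g (T u ((f ^^ l) y)) \<partial>lborel) \<partial>\<mu>Y) / tb"
      unfolding tb_def by (rule X'nn(2)) measurable
    also have "(\<integral>\<^sup>+y. (\<Sum>l<\<tau> y. \<integral>\<^sup>+u. indicator {0..h ((f ^^ l) y)} u * g (T u ((f ^^ l) y)) \<partial>lborel) \<partial>\<mu>Y)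
        = (\<integral>\<^sup>+y. \<integral>\<^sup>+u. indicator {0..<H y} u * g (T u y) \<partial>lborel \<partial>\<mu>Y)"
      using SF.AE_Y cell by (intro nn_integral_cong_AE) (auto simp: H_def induced_roof_def elim!: eventually_mono)
    also have "\<dots> = (\<integral>\<^sup>+x. g x \<partial>SF.MM)" by (rule SF.nn_MM[symmetric]) measurable
    finally show ?thesis by (simp add: Mnn(2) hb_def)
  qed
  define Hb where "Hb = (\<integral>y. H y \<partial>\<mu>Y)"
  have AEH: "AE y in \<mu>Y. \<epsilon> \<le> H y" using SF.AE_Y low(2) by (auto simp: H_def elim!: eventually_mono)
  have "(\<integral>y. \<epsilon> \<partial>\<mu>Y) \<le> Hb" unfolding Hb_def using AEH SF.H_int by (intro integral_mono_AE) auto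
  then have Hb0: "0 < Hb" using low(1) SF.Y.prob_space by simp
  have hb_eq: "hb = ennreal Hb / tb"
  proof -
    have "hb = (\<integral>\<^sup>+y. (\<Sum>l<\<tau> y. ennreal (h ((f ^^ l) y))) \<partial>\<mu>Y) / tb"
      unfolding hb_def tb_def by (rule X'nn(2)) measurable
    also have "(\<integral>\<^sup>+y. (\<Sum>l<\<tau> y. ennreal (h ((f ^^ l) y))) \<partial>\<mu>Y) = (\<integral>\<^sup>+y. ennreal (H y) \<partial>\<mu>Y)"
    proof (rule nn_integral_cong_AE)
      show "AE y in \<mu>Y. (\<Sum>l<\<tau> y. ennreal (h ((f ^^ l) y))) = ennreal (H y)"
        using SF.AE_Y
      proof eventually_elim
        case (elim y)
        have "0 \<le> h ((f ^^ l) y)" for l using orb(1)[OF elim] h_pos less_imp_le by blast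
        then show ?case by (simp add: H_def induced_roof_def sum_ennreal)
      qed
    qed
    also have "\<dots> = ennreal Hb" unfolding Hb_def using SF.H_int AEH low(1)
      by (intro nn_integral_eq_integral) (auto elim!: eventually_mono)
    finally show ?thesis .
  qed
  have "1 = (\<integral>\<^sup>+y. ennreal 1 \<partial>\<mu>Y)" using SF.Y.emeasure_space_1 by simp
  also have "\<dots> \<le> tb" unfolding tb_def
    using SF.AE_Y \<tau>1 by (intro nn_integral_mono_AE) (auto elim!: eventually_mono intro!: ennreal_leI)
  finally have tb1: "1 \<le> tb" .
  obtain c where c: "c \<ge> 0" "\<And>x. x / tb / hb = ennreal c * x"
  \<comment> \<open>Division by \<open>top\<close> is 0 in \<open>ennreal\<close>, so an infinite
    \<open>tb\<close> makes the measure null, recorded by \<open>c = 0\<close>.\<close>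
  proof (cases "tb = top")
    case True
    then show ?thesis using that[of 0] by (simp add: hb_eq divide_ennreal_def)
  next
    case False
    then obtain t where t: "tb = ennreal t" "t > 0"
      using tb1 by (cases tb) (auto simp: ennreal_ge_1)
    have "x / tb / hb = ennreal (1 / Hb) * x" for x
    proof -
      have "hb = ennreal (Hb / t)" unfolding hb_eq t(1) using Hb0 t by (simp add: divide_ennreal)
      moreover have "x / ennreal t / ennreal (Hb / t) = x * (ennreal (inverse t) * ennreal (inverse (Hb / t)))"
        using t Hb0 unfolding divide_ennreal_def by (simp add: inverse_ennreal mult.assoc)
      moreover have "ennreal (inverse t) * ennreal (inverse (Hb / t)) = ennreal (1 / Hb)"
        using t Hb0 by (simp add: ennreal_mult[symmetric] field_simps)
      ultimately show ?thesis using t by (simp add: mult.commute)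
    qed
    then show ?thesis using that[of "1 / Hb"] Hb0 by simp
  qed
  have "suspension_measure X' h T = density SF.MM (\<lambda>_. ennreal c)"
  proof (rule measure_eqI)
    fix A assume "A \<in> sets (suspension_measure X' h T)"
    then have A [measurable]: "A \<in> sets borel" by (simp add: Mnn(1))
    have "emeasure (suspension_measure X' h T) A = (\<integral>\<^sup>+x. indicator A x \<partial>suspension_measure X' h T)"
      by (simp add: Mnn(1))
    also have "\<dots> = ennreal c * emeasure SF.MM A" by (subst MMnn) (auto simp: c(2))
    also have "\<dots> = emeasure (density SF.MM (\<lambda>_. ennreal c)) A" by (simp add: emeasure_density_const)
    finally show "emeasure (suspension_measure X' h T) A = emeasure (density SF.MM (\<lambda>_. ennreal c)) A" .
  qed (simp add: Mnn(1))
  then show ?thesis using c(1) by (auto simp: X'_def H_def)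
qed

theorem theorem3p6:
  fixes T :: "real \<Rightarrow> 'a::metric_space \<Rightarrow> 'a"
    and X Y :: "'a set"
    and h :: "'a \<Rightarrow> real" and f :: "'a \<Rightarrow> 'a"
    and \<tau> :: "'a \<Rightarrow> nat" and F :: "'a \<Rightarrow> 'a"
    and \<mu>0 \<mu>Y :: "'a measure"
    and P :: "'a set set"
    and lam C0 \<eta> \<theta> C1 C2 \<beta> :: real
    and \<zeta>0 :: "'a \<Rightarrow> real"
  assumes bounded_M: "bounded (UNIV :: 'a set)"
    and sets_XY: "X \<in> sets borel" "Y \<in> sets borel" "Y \<subseteq> X"
    (* measurable semiflow *)
    and T_meas: "(\<lambda>(t, x). T t x) \<in> borel_measurable (borel \<Otimes>\<^sub>M borel)"
    and T_zero: "\<And>x. T 0 x = x"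
    and T_add: "\<And>s t x. s \<ge> 0 \<Longrightarrow> t \<ge> 0 \<Longrightarrow> T (s + t) x = T s (T t x)"
    (* roof h and the map f *)
    and h_meas: "h \<in> borel_measurable borel"
    and h_pos: "\<And>x. x \<in> X \<Longrightarrow> h x > 0"
    and f_def: "\<And>x. f x = T (h x) x"
    and f_X: "f ` X \<subseteq> X"
    (* return time tau and induced map F *)
    and tau_meas: "\<tau> \<in> measurable borel (count_space UNIV)"
    and tau_pos: "\<And>y. y \<in> Y \<Longrightarrow> \<tau> y \<ge> 1"
    and F_def: "\<And>y. F y = (f ^^ \<tau> y) y"
    and F_Y: "F ` Y \<subseteq> Y"
    (* the reference measure mu_0 *)
    and mu0_finite: "finite_measure \<mu>0"
    and mu0_sets: "sets \<mu>0 = sets borel"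
    and mu0_on_X: "emeasure \<mu>0 (UNIV - X) = 0"
    and mu0_Y: "emeasure \<mu>0 Y > 0"
    and f_nonsingular: "\<And>A. A \<in> sets borel \<Longrightarrow> A \<subseteq> X \<Longrightarrow>
            (emeasure \<mu>0 (f -` A \<inter> X) = 0 \<longleftrightarrow> emeasure \<mu>0 A = 0)"
    and f_ergodic: "\<And>A. A \<in> sets borel \<Longrightarrow> A \<subseteq> X \<Longrightarrow> f -` A \<inter> X = A \<Longrightarrow>
            emeasure \<mu>0 A = 0 \<or> emeasure \<mu>0 (X - A) = 0"
    and tau_L1: "integrable \<mu>0 (\<lambda>y. indicator Y y * real (\<tau> y))"
    (* the partition {Y_j} *)
    and P_countable: "countable P"
    and P_sets: "\<And>j. j \<in> P \<Longrightarrow> j \<in> sets borel"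
    and P_nonempty: "{} \<notin> P"
    and P_disjoint: "disjoint P"
    and P_cover: "\<Union> P = Y"
    and tau_const: "\<And>j y y'. j \<in> P \<Longrightarrow> y \<in> j \<Longrightarrow> y' \<in> j \<Longrightarrow> \<tau> y = \<tau> y'"
    and constants: "lam > 1" "C0 \<ge> 1" "0 < \<eta>" "\<eta> \<le> 1"
    (* (1) full branches (measure-theoretic bijections) and (3) the Jacobian zeta_0 *)
    and zeta0_meas: "\<zeta>0 \<in> borel_measurable borel"
    and zeta0_pos: "\<And>y. y \<in> Y \<Longrightarrow> \<zeta>0 y > 0"
    and full_branch: "\<And>j. j \<in> P \<Longrightarrow> \<exists>N. N \<in> null_sets \<mu>0 \<and> N \<subseteq> j
            \<and> inj_on F (j - N) \<and> F ` (j - N) \<subseteq> Y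
            \<and> (\<forall>A \<in> sets borel. A \<subseteq> j - N \<longrightarrow> F ` A \<in> sets borel)
            \<and> Y - F ` (j - N) \<in> null_sets \<mu>0
            \<and> (\<forall>A \<in> sets borel. A \<subseteq> j - N \<longrightarrow>
                 emeasure \<mu>0 A = (\<integral>\<^sup>+ y\<in>F ` A. ennreal (\<zeta>0 (the_inv_into (j - N) F y)) \<partial>\<mu>0))"
    (* (2) uniform expansion *)
    and expanding: "\<And>j y y'. j \<in> P \<Longrightarrow> y \<in> j \<Longrightarrow> y' \<in> j \<Longrightarrow> dist (F y) (F y') \<ge> lam * dist y y'"
    (* (3) bounded distortion *)
    and distortion: "\<And>j y y'. j \<in> P \<Longrightarrow> y \<in> j \<Longrightarrow> y' \<in> j \<Longrightarrow>
            \<bar>ln (\<zeta>0 y) - ln (\<zeta>0 y')\<bar> \<le> C0 * dist (F y) (F y') powr \<eta>"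
    (* mu_Y: ergodic F-invariant probability measure on Y, absolutely continuous w.r.t. mu_0 *)
    and muY_prob: "prob_space \<mu>Y"
    and muY_sets: "sets \<mu>Y = sets borel"
    and muY_on_Y: "emeasure \<mu>Y (UNIV - Y) = 0"
    and muY_ac: "absolutely_continuous \<mu>0 \<mu>Y"
    and muY_inv: "\<And>A. A \<in> sets borel \<Longrightarrow> emeasure \<mu>Y (F -` A \<inter> Y) = emeasure \<mu>Y A"
    and muY_erg: "\<And>A. A \<in> sets borel \<Longrightarrow> F -` A \<inter> Y = A \<inter> Y \<Longrightarrow>
            emeasure \<mu>Y A = 0 \<or> emeasure \<mu>Y A = 1"
    (* h in L^1(mu_X) *)
    and h_L1: "integrable (tower_measure \<mu>Y \<tau> f) h"
    (* regularity of the induced roof and of the flow along partition elements *)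
    and theta: "0 < \<theta>" "\<theta> < 1" "C1 \<ge> 1"
    and H_lip: "\<And>j y y'. j \<in> P \<Longrightarrow> y \<in> j \<Longrightarrow> y' \<in> j \<Longrightarrow> y \<noteq> y' \<Longrightarrow>
            \<bar>induced_roof h f \<tau> y - induced_roof h f \<tau> y'\<bar>
              \<le> C1 * (INF z\<in>j. induced_roof h f \<tau> z) * d_theta \<theta> P F y y'"
    and flow_contr: "\<And>j y y' t. j \<in> P \<Longrightarrow> y \<in> j \<Longrightarrow> y' \<in> j \<Longrightarrow> 0 \<le> t \<Longrightarrow>
            t \<le> induced_roof h f \<tau> y \<Longrightarrow> t \<le> induced_roof h f \<tau> y' \<Longrightarrow>
            dist (T t y) (T t y') \<le> C1 * d_theta \<theta> P F y y'"
    (* additional hypotheses of the theorem *)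
    and H_inf: "(INF y\<in>Y. induced_roof h f \<tau> y) > 0"
    and flow_holder: "C2 > 0" "\<And>t t' x. 0 \<le> t \<Longrightarrow> 0 \<le> t' \<Longrightarrow> dist (T t x) (T t' x) \<le> C2 * \<bar>t - t'\<bar> powr \<eta>"
    and beta: "\<beta> > 1"
    and tail: "\<exists>K. \<forall>n::nat. n \<ge> 1 \<longrightarrow>
            measure \<mu>Y {y \<in> Y. induced_roof h f \<tau> y > real n} \<le> K * real n powr (- \<beta>)"
  shows
    "(\<forall>p. 2 < p \<and> p < \<beta> \<longrightarrow>
        (\<exists>C>0. \<forall>v \<in> (holder0 \<eta> (suspension_measure (tower_measure \<mu>Y \<tau> f) h T)
                        :: ('a \<Rightarrow> real^'d) set).
           \<forall>t>0. Lq_norm (suspension_measure (tower_measure \<mu>Y \<tau> f) h T) (2 * (p - 1))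
                   (\<lambda>x. integral {0..t} (\<lambda>s. v (T s x)))
                 \<le> ereal (C * t powr (1/2) * holder_norm \<eta> v)))
     \<and> (\<forall>p. 4 < p \<and> p < \<beta> \<longrightarrow>
        (\<exists>C>0. \<forall>v \<in> (holder0 \<eta> (suspension_measure (tower_measure \<mu>Y \<tau> f) h T)
                        :: ('a \<Rightarrow> real^'d) set).
           \<forall>t>0. Lq_norm (suspension_measure (tower_measure \<mu>Y \<tau> f) h T) (2 * (p - 1) / 3)
                   (\<lambda>x. integral {0..t} (\<lambda>s. integral {0..s} (\<lambda>r. outer (v (T r x)) (v (T s x)))))
                 \<le> ereal (C * t * (holder_norm \<eta> v)\<^sup>2)))"
proof -
  define H where "H = induced_roof h f \<tau>"
  \<comment> \<open>The least rate dominating both \<open>\<theta> powr \<eta>\<close>, which comes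
    from Hoelder observables along contracted orbits, and \<open>lam powr (- \<eta>)\<close>, which
    comes from the distortion of the Jacobian.\<close>
  define \<theta>' where "\<theta>' = max (\<theta> powr \<eta>) (lam powr (- \<eta>))"
  have f_m [measurable]: "f \<in> borel_measurable borel"
    using measurable_compose[OF _ T_meas, of "\<lambda>x. (h x, x)" borel] h_meas
    by (simp add: f_def[abs_def])
  have fl_m [measurable]: "(f ^^ l) \<in> borel_measurable borel" for l by (induction l) auto
  have F_m: "F \<in> borel_measurable borel"
    unfolding F_def[abs_def] by (rule measurable_compose_countable[OF _ tau_meas]) measurable
  have H_m [measurable]: "H \<in> borel_measurable borel"
    unfolding H_def induced_roof_def[abs_def]
    by (rule measurable_compose_countable[OF _ tau_meas]) (use h_meas in measurable)
  have orb: "(f ^^ n) y = T (\<Sum>l<n. h ((f ^^ l) y)) y" "0 \<le> (\<Sum>l<n. h ((f ^^ l) y))" if "y \<in> Y" for n y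
    using iterate_eq_flow[OF T_zero T_add h_pos f_def f_X, where x=y and n=n] that sets_XY by auto
  have H0: "0 \<le> H y" if "y \<in> Y" for y using orb(2)[OF that, of "\<tau> y"] by (simp add: H_def induced_roof_def)
  have FH: "F y = T (H y) y" if "y \<in> Y" for y
    unfolding F_def H_def induced_roof_def by (rule orb(1)[OF that])
  have th: "0 < \<theta>'" "\<theta>' < 1" "lam powr (- \<eta>) \<le> \<theta>'" "\<theta> powr \<eta> \<le> \<theta>'"
  proof -
    have "\<theta> powr \<eta> < 1 powr \<eta>" using theta constants by (intro powr_less_mono2) auto
    moreover have "lam powr (- \<eta>) < lam powr 0" using constants by (intro powr_less_mono) auto
    ultimately show "\<theta>' < 1" using constants by (auto simp: \<theta>'_def)
    show "0 < \<theta>'" using theta by (simp add: \<theta>'_def less_max_iff_disj)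
  qed (auto simp: \<theta>'_def)
  have gm: "gibbs_markov F Y P \<mu>0 \<zeta>0 lam C0 \<eta> \<theta>'"
    by (rule gibbs_markov.intro)
      (fact bounded_M sets_XY F_m F_Y mu0_finite mu0_sets mu0_Y P_countable P_sets P_disjoint P_cover constants th
        zeta0_meas zeta0_pos full_branch expanding distortion)+
  interpret gibbs_markov_inv F Y P \<mu>0 \<zeta>0 lam C0 \<eta> \<theta>' \<mu>Y
    by (rule gibbs_markov_inv.intro[OF gm gibbs_markov_inv_axioms.intro])
      (fact muY_prob muY_sets muY_on_Y muY_ac muY_inv)+
  have bddH: "bdd_below (H ` Y)" using H0 by (intro bdd_belowI[of _ 0]) auto
  define \<epsilon> where "\<epsilon> = (INF y\<in>Y. H y)"
  have \<epsilon>: "\<epsilon> > 0" "\<And>y. y \<in> Y \<Longrightarrow> \<epsilon> \<le> H y"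
    using H_inf cINF_lower[OF bddH] by (auto simp: \<epsilon>_def H_def)
  obtain K where K: "\<And>n::nat. n \<ge> 1 \<Longrightarrow> measure \<mu>Y {y \<in> Y. H y > real n} \<le> K * real n powr (- \<beta>)"
    using tail unfolding H_def by blast
  have mom: "integrable \<mu>Y (\<lambda>y. H y powr p)" if "0 < p" "p < \<beta>" for p
    by (rule tail_imp_moment[OF muY_prob _ _ AE_Y H0 that K]) (use muY_sets sets_XY in auto)
  have main: "\<exists>c\<ge>0. suspension_measure (tower_measure \<mu>Y \<tau> f) h T = density (suspension_flow.MM T H \<mu>Y) (\<lambda>_. ennreal c)"
    and ES: "expanding_suspension F Y P \<mu>0 \<zeta>0 lam C0 \<eta> \<theta>' \<mu>Y T H \<theta> C1 C2"
    and iH: "integrable \<mu>Y (\<lambda>y. H y * (H y + 1) powr (p - 1))"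
    if p: "2 < p" "p < \<beta>" for p
  proof -
    have Hp: "integrable \<mu>Y (\<lambda>y. H y powr p)" using mom p by simp
    \<comment> \<open>The second moment makes \<open>(H + 1) * \<bar>Gd\<bar>\<close> integrable
      over the suspension in \<open>key_estimate\<close>, where a fibre has length
      \<open>H\<close>.\<close>
    have H2: "integrable \<mu>Y (\<lambda>y. (H y)\<^sup>2)"
    proof (rule Bochner_Integration.integrable_bound)
      show "integrable \<mu>Y (\<lambda>y. 1 + H y powr p)" using Hp by simp
      show "AE y in \<mu>Y. norm ((H y)\<^sup>2) \<le> norm (1 + H y powr p)"
        using AE_Y
      proof eventually_elim
        case (elim y)
        show ?case
        proof (cases "H y \<le> 1")
          case True
          then have "(H y)\<^sup>2 \<le> 1" using H0[OF elim] by (simp add: power_le_one)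
          then show ?thesis by (simp add: add_increasing2)
        next
          case False
          then have "(H y)\<^sup>2 = H y powr 2" by simp
          also have "\<dots> \<le> H y powr p" using False p by (intro powr_mono) auto
          finally show ?thesis by simp
        qed
      qed
    qed measurable
    show ES: "expanding_suspension F Y P \<mu>0 \<zeta>0 lam C0 \<eta> \<theta>' \<mu>Y T H \<theta> C1 C2"
      by unfold_locales
        (fact T_meas T_zero T_add flow_holder H_m H0 FH H2 theta th H_lip[folded H_def] flow_contr[folded H_def])+
    interpret ES: expanding_suspension F Y P \<mu>0 \<zeta>0 lam C0 \<eta> \<theta>' \<mu>Y T H \<theta> C1 C2 by (rule ES)
    have SF: "suspension_flow T Y F H \<mu>Y 0 0" by (rule ES.suspension) auto
    show "\<exists>c\<ge>0. suspension_measure (tower_measure \<mu>Y \<tau> f) h T = density (suspension_flow.MM T H \<mu>Y) (\<lambda>_. ennreal c)"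
      unfolding H_def
      by (rule suspension_tower_measure_eq[where X=X and \<epsilon>=\<epsilon>])
        (fact SF[unfolded H_def] sets_XY h_meas h_pos f_def f_X tau_meas tau_pos \<epsilon>[unfolded H_def])+
    show "integrable \<mu>Y (\<lambda>y. H y * (H y + 1) powr (p - 1))"
    proof (rule Bochner_Integration.integrable_bound)
      show "integrable \<mu>Y (\<lambda>y. 2 powr p * (H y powr p + 1))" using Hp by simp
      show "AE y in \<mu>Y. norm (H y * (H y + 1) powr (p - 1)) \<le> norm (2 powr p * (H y powr p + 1))"
        using AE_Y
      proof eventually_elim
        case (elim y)
        have "H y * (H y + 1) powr (p - 1) \<le> (H y + 1) powr 1 * (H y + 1) powr (p - 1)"
          using H0[OF elim] by (intro mult_right_mono) auto
        also have "\<dots> = (H y + 1) powr p" by (subst powr_add[symmetric]) simp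
        also have "\<dots> \<le> 2 powr p * (H y powr p + 1 powr p)" using H0[OF elim] p by (intro powr_sum_le) auto
        finally show ?case using H0[OF elim] by simp
      qed
    qed measurable
  qed
  show ?thesis
  proof (intro conjI allI impI)
    fix p assume "2 < p \<and> p < \<beta>"
    then have p: "2 < p" "p < \<beta>" by auto
    obtain c where c: "c \<ge> 0" "suspension_measure (tower_measure \<mu>Y \<tau> f) h T = density (suspension_flow.MM T H \<mu>Y) (\<lambda>_. ennreal c)"
      using main[OF p] by blast
    show "\<exists>C>0. \<forall>v \<in> (holder0 \<eta> (suspension_measure (tower_measure \<mu>Y \<tau> f) h T) :: ('a \<Rightarrow> real^'d) set).
           \<forall>t>0. Lq_norm (suspension_measure (tower_measure \<mu>Y \<tau> f) h T) (2 * (p - 1))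
                   (\<lambda>x. integral {0..t} (\<lambda>s. v (T s x)))
                 \<le> ereal (C * t powr (1/2) * holder_norm \<eta> v)"
      \<comment> \<open>Here \<open>q = p - 1\<close>: the condition \<open>p > 2\<close> becomes
        \<open>q > 1\<close>, and \<open>p > 4\<close> in the second half becomes
        \<open>q > 3\<close>.\<close>
      using p by (intro expanding_suspension.Lq_norm_flow_integral[OF ES[OF p] _ iH[OF p] c(2,1)]) auto
  next
    fix p assume "4 < p \<and> p < \<beta>"
    then have p: "2 < p" "p < \<beta>" "4 < p" by auto
    obtain c where c: "c \<ge> 0" "suspension_measure (tower_measure \<mu>Y \<tau> f) h T = density (suspension_flow.MM T H \<mu>Y) (\<lambda>_. ennreal c)"
      using main[OF p(1,2)] by blast
    show "\<exists>C>0. \<forall>v \<in> (holder0 \<eta> (suspension_measure (tower_measure \<mu>Y \<tau> f) h T) :: ('a \<Rightarrow> real^'d) set).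
           \<forall>t>0. Lq_norm (suspension_measure (tower_measure \<mu>Y \<tau> f) h T) (2 * (p - 1) / 3)
                   (\<lambda>x. integral {0..t} (\<lambda>s. integral {0..s} (\<lambda>r. outer (v (T r x)) (v (T s x)))))
                 \<le> ereal (C * t * (holder_norm \<eta> v)\<^sup>2)"
      using p by (intro expanding_suspension.Lq_norm_flow_iterated_integral[OF ES[OF p(1,2)] _ iH[OF p(1,2)] c(2,1)]) auto
  qed
qed

end
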